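(* Let $G$ be a connected block graph and $C$ an independent set of $G$. The procedure Compute-potentials$(G,C)$ terminates in time $O(|E(G)|^4)$, and upon termination $y[p]=pot_G(C,p)$ for every $p\in\mathcal{P}_G$.
   Context: All graphs are finite, simple and undirected. A cut-vertex of a graph is a vertex whose removal increases the number of connected components. A block of $G$ is a maximal set $S\subseteq V(G)$ such that $G[S]$ is 2-connected. A block graph is a graph every block of which induces a clique. For a connected block graph $G$: $V_{cut}(G)$ is its set of cut-vertices, $\mathcal{B}(G)$ its set of blocks, $\mathcal{B}_u(G)$ the set of blocks containing $u$, $K_B(G)=B\cap V_{cut}(G)$. For $u\in V_{cut}(G)$, $B\in\mathcal{B}_u(G)$: $G[u,B]$ is the connected component containing $u$ of $G$ minus all edges $uv$ with $v\in B$; $G[B,u]$ is the connected component containing $u$ of $G$ minus all edges $uv$ with $v\notin B$. $\mathcal{P}_G=\{(u,B),(B,u): u\in V_{cut}(G),B\in\mathcal{B}_u(G)\}$; $u$ is the base of these pairs, $G[p]$ is $G[u,B]$ resp. $G[B,u]$. $\beta(u,B)=\mathcal{B}_u(G[u,B])$, $\kappa(B,u)=K_B(G[B,u])$. For $p$ with base $u$, a $p$-independent set is a subset of $V(G[p])$ independent in $G$; $C^\circ=C\setminus\{u\}$; $S[q]=S\cap V(G[q])$. Depth: $d(B,u)=0$ if $\kappa(B,u)=\emptyset$, else $1+\max_{v\in\kappa(B,u)}d(v,B)$; $d(u,B)=1+\max_{B'\in\beta(u,B)}d(B',u)$. Boolean $ua(p)$ (True=1, False=0 in arithmetic): $ua(p)=$True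 if $d(p)=0$; for $d(B,u)>0$, $ua(B,u)$ is False exactly when $ua(v,B)=$True for all $v\in\kappa(B,u)$ and $B=\kappa(B,u)\cup\{u\}$; $ua(u,B)$ is True exactly when $ua(B',u)=$True for some $B'\in\beta(u,B)$. Capacity of a $p$-independent set $C$: for $p=(B,u)$, $cap(C)=\sum_{v\in\kappa(B,u)}cap(C[v,B])+ua(B,u)-|B\cap C^\circ|$; for $p=(u,B)$, $cap(C)=0$ if some $B'\in\beta(u,B)$ has $cap(C[B',u])=0$ and $ua(B',u)=$True, otherwise $cap(C)=\sum_{B'\in\beta(u,B)}(cap(C[B',u])-ua(B',u))+ua(u,B)$. Reachability: $I_1\rightarrow I_2$ if $I_1=I_2$ or $I_1\setminus I_2=\{v_1\}$, $I_2\setminus I_1=\{v_2\}$, $v_1v_2\in E(G)$; reachable means connected by a finite chain of $\rightarrow$. Potential: $pot_G(C,p)=\max\{cap(C'[p])+|C'[p]^\circ|-|C[p]^\circ|: C'$ independent set of $G$ reachable from $C\}$. Procedure Compute-potentials$(G,C)$: set $y[p]=0$ for all $p\in\mathcal{P}_G$. Then repeat the following round until a round makes no update: scan the pairs $p\in\mathcal{P}_G$; for the current $p$ let $y'=y[p]$, and if $p=(B,u)$ set $y'=\sum_{u'\in\kappa(B,u)}y[(u',B)]+ua(B,u)-|B\cap C[B,u]^\circ|$, while if $p=(u,B)$ and there do not exist two distinct $B',B''\in\mathcal{B}_u(G)$ with $y[(B',u)]=y[(B'',u)]=0$ and $ua(B',u)=ua(B'',u)=$True, set $y'=\sum_{B'\in\beta(u,B)}(y[(B',u)]-ua(B',u))+ua(u,B)$;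 if $y[p]<y'$, set $y[p]=y'$, record an update and end the current round immediately (starting a new round). Return the array $y$. *)

theory Defs
  imports "HOL-Library.Landau_Symbols"
begin

section \<open>Finite simple graphs, blocks and block graphs\<close>

record 'a sgraph =
  verts :: "'a set"
  edges :: "'a set set"

definition simple_graph :: "'a sgraph \<Rightarrow> bool" where
  "simple_graph G \<longleftrightarrow> finite (verts G) \<and> (\<forall>e\<in>edges G. e \<subseteq> verts G \<and> card e = 2)"

definition adj :: "'a sgraph \<Rightarrow> 'a \<Rightarrow> 'a \<Rightarrow> bool" where
  "adj G u v \<longleftrightarrow> {u, v} \<in> edges G"

definition induced :: "'a sgraph \<Rightarrow> 'a set \<Rightarrow> 'a sgraph" where
  "induced G S = \<lparr>verts = verts G \<inter> S, edges = {e \<in> edges G. e \<subseteq> S}\<rparr>"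

definition delete_edges :: "'a sgraph \<Rightarrow> 'a set set \<Rightarrow> 'a sgraph" where
  "delete_edges G F = \<lparr>verts = verts G, edges = edges G - F\<rparr>"

definition component_verts :: "'a sgraph \<Rightarrow> 'a \<Rightarrow> 'a set" where
  "component_verts G u = {v \<in> verts G. (adj G)\<^sup>*\<^sup>* u v}"

definition component :: "'a sgraph \<Rightarrow> 'a \<Rightarrow> 'a sgraph" where
  "component G u = induced G (component_verts G u)"

definition num_components :: "'a sgraph \<Rightarrow> nat" where
  "num_components G = card (component_verts G ` verts G)"

definition connected_graph :: "'a sgraph \<Rightarrow> bool" where
  "connected_graph G \<longleftrightarrow> verts G \<noteq> {} \<and> (\<forall>u\<in>verts G. \<forall>v\<in>verts G. (adj G)\<^sup>*\<^sup>* u v)"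

definition cut_verts :: "'a sgraph \<Rightarrow> 'a set" where
  "cut_verts G = {v \<in> verts G. num_components (induced G (verts G - {v})) > num_components G}"

text \<open>As usual for block decompositions, a single edge counts as 2-connected, so that bridges are
  blocks. A single vertex also counts; this only matters for graphs with isolated vertices.\<close>

definition two_connected :: "'a sgraph \<Rightarrow> bool" where
  "two_connected G \<longleftrightarrow> connected_graph G \<and> cut_verts G = {}"

definition blocks :: "'a sgraph \<Rightarrow> 'a set set" where
  "blocks G = {S. S \<subseteq> verts G \<and> two_connected (induced G S) \<and>
     (\<forall>T. S \<subset> T \<and> T \<subseteq> verts G \<longrightarrow> \<not> two_connected (induced G T))}"

definition clique :: "'a sgraph \<Rightarrow> 'a set \<Rightarrow> bool" where
  "clique G S \<longleftrightarrow> S \<subseteq> verts G \<and> (\<forall>u\<in>S. \<forall>v\<in>S. u \<noteq> v \<longrightarrow> adj G u v)"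

definition block_graph :: "'a sgraph \<Rightarrow> bool" where
  "block_graph G \<longleftrightarrow> simple_graph G \<and> (\<forall>B\<in>blocks G. clique G B)"

definition blocks_at :: "'a sgraph \<Rightarrow> 'a \<Rightarrow> 'a set set" where
  "blocks_at G u = {B \<in> blocks G. u \<in> B}"

definition block_cut_verts :: "'a sgraph \<Rightarrow> 'a set \<Rightarrow> 'a set" where
  "block_cut_verts G B = B \<inter> cut_verts G"

definition indep_set :: "'a sgraph \<Rightarrow> 'a set \<Rightarrow> bool" where
  "indep_set G I \<longleftrightarrow> I \<subseteq> verts G \<and> (\<forall>u\<in>I. \<forall>v\<in>I. \<not> adj G u v)"


section \<open>Vertex-block pairs\<close>

text \<open>\<open>VB u B\<close> and \<open>BV B u\<close> stand for the pairs $(u,B)$ and $(B,u)$.\<close>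

datatype 'a vbpair = VB 'a "'a set" | BV "'a set" 'a

definition pairs :: "'a sgraph \<Rightarrow> 'a vbpair set" where
  "pairs G = (\<Union>u\<in>cut_verts G. \<Union>B\<in>blocks_at G u. {VB u B, BV B u})"

fun base :: "'a vbpair \<Rightarrow> 'a" where
  "base (VB u B) = u"
| "base (BV B u) = u"

fun subg :: "'a sgraph \<Rightarrow> 'a vbpair \<Rightarrow> 'a sgraph" where
  "subg G (VB u B) = component (delete_edges G {{u, v} | v. v \<in> B}) u"
| "subg G (BV B u) = component (delete_edges G {{u, v} | v. v \<notin> B}) u"

definition \<beta> :: "'a sgraph \<Rightarrow> 'a \<Rightarrow> 'a set \<Rightarrow> 'a set set" where
  "\<beta> G u B = blocks_at (subg G (VB u B)) u"

definition \<kappa> :: "'a sgraph \<Rightarrow> 'a set \<Rightarrow> 'a \<Rightarrow> 'a set" where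
  "\<kappa> G B u = block_cut_verts (subg G (BV B u)) B"

definition restr :: "'a sgraph \<Rightarrow> 'a set \<Rightarrow> 'a vbpair \<Rightarrow> 'a set" where
  "restr G S q = S \<inter> verts (subg G q)"

definition off_base :: "'a set \<Rightarrow> 'a vbpair \<Rightarrow> 'a set" where
  "off_base S p = S - {base p}"

text \<open>The recursions below run along the tree of blocks and cut-vertices. They are introduced
  as partial functions: their equations are available on the domains of the
  recursions, which contain every pair in \<^term>\<open>pairs G\<close> if \<^term>\<open>G\<close> is a connected block graph.\<close>

function (domintros) depth :: "'a sgraph \<Rightarrow> 'a vbpair \<Rightarrow> nat" where
  "depth G (BV B u) =
     (if \<kappa> G B u = {} then 0 else 1 + Max ((\<lambda>v. depth G (VB v B)) ` \<kappa> G B u))"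
| "depth G (VB u B) = 1 + Max ((\<lambda>B'. depth G (BV B' u)) ` \<beta> G u B)"
  by pat_completeness auto

function (domintros) ua :: "'a sgraph \<Rightarrow> 'a vbpair \<Rightarrow> bool" where
  "ua G (BV B u) =
     (if depth G (BV B u) = 0 then True
      else \<not> ((\<forall>v\<in>\<kappa> G B u. ua G (VB v B)) \<and> B = \<kappa> G B u \<union> {u}))"
| "ua G (VB u B) = (\<exists>B'\<in>\<beta> G u B. ua G (BV B' u))"
  by pat_completeness auto

function (domintros) cap :: "'a sgraph \<Rightarrow> 'a vbpair \<Rightarrow> 'a set \<Rightarrow> int" where
  "cap G (BV B u) C =
     (\<Sum>v\<in>\<kappa> G B u. cap G (VB v B) (restr G C (VB v B))) + of_bool (ua G (BV B u))
       - int (card (B \<inter> off_base C (BV B u)))"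
| "cap G (VB u B) C =
     (if \<exists>B'\<in>\<beta> G u B. cap G (BV B' u) (restr G C (BV B' u)) = 0 \<and> ua G (BV B' u) then 0
      else (\<Sum>B'\<in>\<beta> G u B. cap G (BV B' u) (restr G C (BV B' u)) - of_bool (ua G (BV B' u)))
             + of_bool (ua G (VB u B)))"
  by pat_completeness auto


section \<open>Reachability and potentials\<close>

definition slide :: "'a sgraph \<Rightarrow> 'a set \<Rightarrow> 'a set \<Rightarrow> bool" where
  "slide G I J \<longleftrightarrow> indep_set G I \<and> indep_set G J \<and>
     (I = J \<or> (\<exists>u v. I - J = {u} \<and> J - I = {v} \<and> adj G u v))"

definition reachable :: "'a sgraph \<Rightarrow> 'a set \<Rightarrow> 'a set \<Rightarrow> bool" where
  "reachable G = (slide G)\<^sup>*\<^sup>*"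

definition pot :: "'a sgraph \<Rightarrow> 'a set \<Rightarrow> 'a vbpair \<Rightarrow> int" where
  "pot G C p =
     Max {cap G p (restr G C' p) + int (card (off_base (restr G C' p) p))
            - int (card (off_base (restr G C p) p)) | C'. indep_set G C' \<and> reachable G C C'}"


section \<open>The procedure Compute-potentials\<close>

text \<open>The value \<open>y'\<close> computed for \<open>p\<close> from the current array \<open>y\<close>.\<close>

fun candidate :: "'a sgraph \<Rightarrow> 'a set \<Rightarrow> ('a vbpair \<Rightarrow> int) \<Rightarrow> 'a vbpair \<Rightarrow> int" where
  "candidate G C y (BV B u) =
     (\<Sum>v\<in>\<kappa> G B u. y (VB v B)) + of_bool (ua G (BV B u))
       - int (card (B \<inter> off_base (restr G C (BV B u)) (BV B u)))"
| "candidate G C y (VB u B) =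
     (if \<not> (\<exists>B'\<in>blocks_at G u. \<exists>B''\<in>blocks_at G u. B' \<noteq> B'' \<and>
              y (BV B' u) = 0 \<and> y (BV B'' u) = 0 \<and> ua G (BV B' u) \<and> ua G (BV B'' u))
      then (\<Sum>B'\<in>\<beta> G u B. y (BV B' u) - of_bool (ua G (BV B' u))) + of_bool (ua G (VB u B))
      else y (VB u B))"

text \<open>Running times are counted in unit-cost operations, up to constant factors. One unit pays for a
  constant number of array accesses, comparisons, arithmetic operations and tests \<open>v \<in> C\<close>.

  Every evaluation of \<^const>\<open>ua\<close> is charged for its complete recursion (no values are stored).
  A call for $(B,u)$ scans \<open>B\<close> to enumerate \<open>\<kappa> G B u\<close>, which also decides whether the depth is 0;
  a call for $(u,B)$ scans the blocks at \<open>u\<close> to enumerate \<open>\<beta> G u B\<close>.\<close>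

function (domintros) T_ua :: "'a sgraph \<Rightarrow> 'a vbpair \<Rightarrow> nat" where
  "T_ua G (BV B u) = 1 + card B + (\<Sum>v\<in>\<kappa> G B u. T_ua G (VB v B))"
| "T_ua G (VB u B) = 1 + card (blocks_at G u) + (\<Sum>B'\<in>\<beta> G u B. T_ua G (BV B' u))"
  by pat_completeness auto

text \<open>For $(B,u)$ the scan of \<open>B\<close> also counts the elements of \<open>C\<close> other than \<open>u\<close> in \<open>B\<close>. For $(u,B)$ a
  single scan of the blocks at \<open>u\<close> evaluates \<^const>\<open>ua\<close> once for each of them, forms the sum, and counts
  the blocks \<open>B'\<close> with \<open>y (BV B' u) = 0\<close> and \<open>ua G (BV B' u)\<close> in order to decide whether there are two.\<close>

fun T_candidate :: "'a sgraph \<Rightarrow> 'a vbpair \<Rightarrow> nat" where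
  "T_candidate G (BV B u) = 1 + card B + T_ua G (BV B u)"
| "T_candidate G (VB u B) =
     1 + (\<Sum>B'\<in>blocks_at G u. 1 + T_ua G (BV B' u)) + T_ua G (VB u B)"

text \<open>One round, scanning the pairs in the order of the given list. The result consists of the new
  array, whether an update was made, and the time spent.\<close>

fun scan_round :: "'a sgraph \<Rightarrow> 'a set \<Rightarrow> 'a vbpair list \<Rightarrow> ('a vbpair \<Rightarrow> int) \<Rightarrow>
    ('a vbpair \<Rightarrow> int) \<times> bool \<times> nat" where
  "scan_round G C [] y = (y, False, 1)"
| "scan_round G C (p # ps) y =
     (let y' = candidate G C y p; t = 1 + T_candidate G p in
      if y p < y' then (y(p := y'), True, t)
      else (let (z, upd, t') = scan_round G C ps y in (z, upd, t + t')))"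

text \<open>The scanning order is not prescribed and may change from round to round; \<open>ord i\<close> is the order
  used in round \<open>i\<close>. \<open>run_rounds G C ord i y z t\<close> means that, started with array \<open>y\<close>
  in round \<open>i\<close>, the loop terminates with array \<open>z\<close> after time \<open>t\<close>. The rules are deterministic, so
  there is no derivation at all if the loop runs forever.\<close>

inductive run_rounds :: "'a sgraph \<Rightarrow> 'a set \<Rightarrow> (nat \<Rightarrow> 'a vbpair list) \<Rightarrow> nat \<Rightarrow>
    ('a vbpair \<Rightarrow> int) \<Rightarrow> ('a vbpair \<Rightarrow> int) \<Rightarrow> nat \<Rightarrow> bool" for G C ord where
  stop: "scan_round G C (ord i) y = (z, False, t) \<Longrightarrow> run_rounds G C ord i y z t"
| continue: "scan_round G C (ord i) y = (y', True, t) \<Longrightarrow>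
    run_rounds G C ord (Suc i) y' z t' \<Longrightarrow> run_rounds G C ord i y z (t + t')"

definition scan_orders :: "'a sgraph \<Rightarrow> (nat \<Rightarrow> 'a vbpair list) set" where
  "scan_orders G = {ord. \<forall>i. distinct (ord i) \<and> set (ord i) = pairs G}"

text \<open>The procedure works on the blocks of \<open>G\<close>, given as lists of vertices, with the cut-vertices
  marked and with a list of the blocks at each vertex. Obtaining this data by depth-first search is
  charged with $|V(G)| + |E(G)|$, the initialisation of \<open>y\<close> with the number of pairs.\<close>

definition compute_potentials :: "'a sgraph \<Rightarrow> 'a set \<Rightarrow> (nat \<Rightarrow> 'a vbpair list) \<Rightarrow>
    ('a vbpair \<Rightarrow> int) \<Rightarrow> nat \<Rightarrow> bool" where
  "compute_potentials G C ord y t \<longleftrightarrow>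
     (\<exists>t'. run_rounds G C ord 0 (\<lambda>p. 0) y t' \<and>
        t = card (verts G) + card (edges G) + card (pairs G) + t')"

end

theory Submission
  imports Defs
begin

text \<open>In a block graph two neighbours of \<open>u\<close> that are connected in \<open>G - u\<close> lie in a common block,
  so the blocks and cut-vertices form a tree and \<open>G[p]\<close> is an induced subgraph attached to the rest
  of the graph at its base only.

  For a configuration \<open>D\<close> let the total of \<open>p\<close> be the capacity of \<open>D[p]\<close> plus the number of tokens
  of \<open>D\<close> inside \<open>G[p]\<close> off the base; the potential of \<open>p\<close> is the maximal total of a reachable
  configuration minus the number of tokens of \<open>C\<close> inside. The capacity is meaningful: while it is
  positive a token at the base can be pushed inside, and a block that is not stuck can make its base
  available, in both cases without changing any total below \<open>p\<close>. Two stuck blocks at a cut-vertex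
  freeze it. Hence a configuration that is optimal inside \<open>G[p]\<close> can follow any
  sequence of slides outside \<open>G[p]\<close>, so optima of disjoint parts can be combined, and the potentials
  satisfy the equations used by the procedure. Conversely the array returned by the procedure
  bounds the potentials, by induction along a sequence of slides from \<open>C\<close>. Every update increases
  an entry that never exceeds the number of vertices, which bounds the number of rounds.\<close>

section \<open>Blocks of block graphs\<close>

text \<open>The obstacle is the pair \<open>(u,B)\<close>: as long as no block is stuck, its total
  is the sum of \<open>tot - ua\<close> over the other blocks at \<open>u\<close>, plus
  \<open>ua\<close>, whether or not \<open>u\<close> carries a token. One stuck block makes the
  total at most this value, since the surplus of the other blocks is lost; two stuck blocks can make
  it larger. The procedure tests for exactly this exception, and freezing shows that then the
  initial token counts decide. Separate optima of the parts of \<open>G[p]\<close> are of no use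
  unless one reachable configuration realizes them together. Hence \<open>opt\<close> asks for
  optimality at all descendants of a pair, \<open>keeps\<close> preserves all their totals, and
  rearrangements inside \<open>G[p]\<close> leave the tokens outside fixed, except possibly at the
  base. The exponent is 2 + 2. With m edges there are O(m) pairs and entries up to |V| = O(m), hence
  O(m^2) updates; a round evaluates O(m) candidates, and each costs O(m) because recomputing
  \<open>ua\<close> walks through a tree of linear size.\<close>

lemma adj_sym: "adj G a b \<longleftrightarrow> adj G b a"
  by (simp add: adj_def insert_commute)

lemma adj_verts: "simple_graph G \<Longrightarrow> adj G a b \<Longrightarrow> a \<in> verts G \<and> b \<in> verts G \<and> a \<noteq> b"
  unfolding simple_graph_def adj_def by fastforce

lemma adj_induced: "adj (induced G S) a b \<longleftrightarrow> adj G a b \<and> a \<in> S \<and> b \<in> S"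
  by (auto simp: adj_def induced_def)

lemma verts_induced [simp]: "verts (induced G S) = verts G \<inter> S"
  by (simp add: induced_def)

lemma induced_induced: "S \<subseteq> W \<Longrightarrow> induced (induced G W) S = induced G S"
  by (auto simp: induced_def)

lemma simple_induced: "simple_graph G \<Longrightarrow> simple_graph (induced G S)"
  by (auto simp: simple_graph_def induced_def)

section \<open>Connection in a graph with one vertex removed\<close>

definition av :: "'a sgraph \<Rightarrow> 'a \<Rightarrow> 'a \<Rightarrow> 'a \<Rightarrow> bool" where
  "av G u = (\<lambda>a b. adj G a b \<and> a \<noteq> u \<and> b \<noteq> u)\<^sup>*\<^sup>*"

lemma av_refl [simp]: "av G u x x"
  by (simp add: av_def)

lemma av_trans: "av G u x y \<Longrightarrow> av G u y z \<Longrightarrow> av G u x z"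
  by (simp add: av_def)

lemma av_adj: "adj G x y \<Longrightarrow> x \<noteq> u \<Longrightarrow> y \<noteq> u \<Longrightarrow> av G u x y"
  by (auto simp: av_def)

lemma av_sym:
  assumes "av G u x y"
  shows "av G u y x"
proof -
  have "symp ((\<lambda>a b. adj G a b \<and> a \<noteq> u \<and> b \<noteq> u)\<^sup>*\<^sup>*)"
    by (rule symp_rtranclp) (auto simp: symp_def adj_sym)
  from sympD[OF this] show ?thesis using assms by (simp add: av_def)
qed

lemma adj_rtranclp_sym: "(adj G)\<^sup>*\<^sup>* x y \<Longrightarrow> (adj G)\<^sup>*\<^sup>* y x"
  using sympD[OF symp_rtranclp[of "adj G"], of x y] by (auto simp: symp_def adj_sym)

lemma av_induced_minus:
  assumes "simple_graph G"
  shows "(adj (induced G (verts G - {u})))\<^sup>*\<^sup>* = av G u"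
proof -
  have "adj (induced G (verts G - {u})) = (\<lambda>a b. adj G a b \<and> a \<noteq> u \<and> b \<noteq> u)"
    using adj_verts[OF assms] by (auto simp: adj_induced fun_eq_iff)
  then show ?thesis by (simp add: av_def)
qed

lemma num_components_gt_1:
  assumes fin: "finite (verts H)"
  shows "num_components H > 1 \<longleftrightarrow> (\<exists>x\<in>verts H. \<exists>y\<in>verts H. \<not> (adj H)\<^sup>*\<^sup>* x y)"
proof
  assume "num_components H > 1"
  then have "\<not> card (component_verts H ` verts H) \<le> Suc 0"
    by (simp add: num_components_def)
  then obtain x y where xy: "x \<in> verts H" "y \<in> verts H" "component_verts H x \<noteq> component_verts H y"
    using fin card_le_Suc0_iff_eq[of "component_verts H ` verts H"] by auto
  have "\<not> (adj H)\<^sup>*\<^sup>* x y"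
  proof
    assume c: "(adj H)\<^sup>*\<^sup>* x y"
    have "component_verts H x = component_verts H y"
      unfolding component_verts_def using c adj_rtranclp_sym[OF c] by (auto intro: rtranclp_trans)
    then show False using xy by simp
  qed
  then show "\<exists>x\<in>verts H. \<exists>y\<in>verts H. \<not> (adj H)\<^sup>*\<^sup>* x y" using xy by blast
next
  assume "\<exists>x\<in>verts H. \<exists>y\<in>verts H. \<not> (adj H)\<^sup>*\<^sup>* x y"
  then obtain x y where xy: "x \<in> verts H" "y \<in> verts H" "\<not> (adj H)\<^sup>*\<^sup>* x y" by blast
  then have "component_verts H x \<noteq> component_verts H y"
    by (auto simp: component_verts_def)
  then have "\<not> card (component_verts H ` verts H) \<le> Suc 0"
    using fin card_le_Suc0_iff_eq[of "component_verts H ` verts H"] xy by auto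
  then show "num_components H > 1" by (simp add: num_components_def)
qed

text \<open>Since a connected graph has one component, more components after removing
  \<open>v\<close> simply means two vertices not connected off \<open>v\<close>; the count
  disappears from all later arguments.\<close>

lemma cut_verts_iff:
  assumes s: "simple_graph G" and c: "connected_graph G"
  shows "v \<in> cut_verts G \<longleftrightarrow> v \<in> verts G \<and> (\<exists>x\<in>verts G - {v}. \<exists>y\<in>verts G - {v}. \<not> av G v x y)"
proof -
  have fin: "finite (verts G)" using s by (simp add: simple_graph_def)
  have "component_verts G x = verts G" if "x \<in> verts G" for x
    using c that by (auto simp: component_verts_def connected_graph_def)
  then have "component_verts G ` verts G = {verts G}"
    using c by (auto simp: connected_graph_def)
  then have "num_components G = 1" by (simp add: num_components_def)
  moreover have "num_components (induced G (verts G - {v})) > 1 \<longleftrightarrow>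
      (\<exists>x\<in>verts G - {v}. \<exists>y\<in>verts G - {v}. \<not> av G v x y)"
    using num_components_gt_1[of "induced G (verts G - {v})"] fin av_induced_minus[OF s, of v]
    by (simp add: Int_absorb1)
  ultimately show ?thesis by (simp add: cut_verts_def)
qed

text \<open>Singletons and single edges are cliques too, and this is how every edge later finds a
  block.\<close>

lemma clique_two_connected:
  assumes s: "simple_graph G" and cl: "clique G S" and ne: "S \<noteq> {}"
  shows "two_connected (induced G S)"
proof -
  have SV: "verts G \<inter> S = S" using cl by (auto simp: clique_def)
  have a: "adj (induced G S) x y" if "x \<in> S" "y \<in> S" "x \<noteq> y" for x y
    using cl that by (simp add: clique_def adj_induced)
  have c: "connected_graph (induced G S)"
    unfolding connected_graph_def
  proof (intro conjI ballI)
    fix x y assume "x \<in> verts (induced G S)" "y \<in> verts (induced G S)"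
    then show "(adj (induced G S))\<^sup>*\<^sup>* x y" using a[of x y] by (cases "x = y") auto
  qed (use ne SV in auto)
  have "av (induced G S) v x y" if "x \<in> S - {v}" "y \<in> S - {v}" for x y v
    using that a by (cases "x = y") (auto intro: av_adj)
  then have "cut_verts (induced G S) = {}"
    using cut_verts_iff[OF simple_induced[OF s] c] by (auto simp: SV)
  with c show ?thesis by (simp add: two_connected_def)
qed

lemma two_connected_subset_block:
  assumes s: "simple_graph G" and S: "S \<subseteq> verts G" "two_connected (induced G S)"
  shows "\<exists>B\<in>blocks G. S \<subseteq> B"
proof -
  let ?F = "{T. T \<subseteq> verts G \<and> two_connected (induced G T)}"
  have "finite ?F" using s by (simp add: simple_graph_def)
  moreover have "S \<in> ?F" using S by simp
  ultimately obtain B where B: "B \<in> ?F" "S \<subseteq> B" "\<forall>T\<in>?F. B \<subseteq> T \<longrightarrow> B = T"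
    using finite_has_maximal2[of ?F S] by auto
  then have "B \<in> blocks G" unfolding blocks_def by blast
  then show ?thesis using B by blast
qed

lemma rtranclp_segment:
  assumes "i \<le> j" "\<And>l. i \<le> l \<Longrightarrow> l < j \<Longrightarrow> r (f l) (f (Suc l))"
  shows "r\<^sup>*\<^sup>* (f i) (f j)"
  using assms
proof (induction j)
  case (Suc j)
  show ?case
  proof (cases "i = Suc j")
    case False
    then have "r\<^sup>*\<^sup>* (f i) (f j)" "r (f j) (f (Suc j))" using Suc by auto
    then show ?thesis by (rule rtranclp.rtrancl_into_rtrancl)
  qed simp
qed simp

text \<open>A shortest walk between two neighbours of \<open>u\<close> that avoids \<open>u\<close> closes to a cycle, and a cycle is
  2-connected.\<close>

lemma block_graph_av_adj:
  assumes bg: "block_graph G" and ux: "adj G u x" and uy: "adj G u y" and xy: "x \<noteq> y"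
    and con: "av G u x y"
  shows "adj G x y"
proof -
  have s: "simple_graph G" using bg by (simp add: block_graph_def)
  define r where "r = (\<lambda>a b. adj G a b \<and> a \<noteq> u \<and> b \<noteq> u)"
  obtain k0 where k0: "(r ^^ k0) x y" using con rtranclp_imp_relpowp[of r x y] by (auto simp: av_def r_def)
  define k where "k = (LEAST l. (r ^^ l) x y)"
  have k: "(r ^^ k) x y" unfolding k_def using k0 by (rule LeastI)
  have kmin: "k \<le> l" if "(r ^^ l) x y" for l unfolding k_def using that by (rule Least_le)
  obtain f where f: "f 0 = x" "f k = y" "\<And>i. i < k \<Longrightarrow> r (f i) (f (Suc i))"
    using k unfolding relpowp_fun_conv by blast
  have inj: "f i \<noteq> f j" if "i < j" "j \<le> k" for i j
  proof
    assume eq: "f i = f j"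
    \<comment> \<open>Cutting out the positions between \<open>i\<close> and \<open>j\<close> leaves
      a walk with \<open>k - (j - i)\<close> steps, against minimality.\<close>
    define g where "g = (\<lambda>l. if l \<le> i then f l else f (l + (j - i)))"
    have "g 0 = x" by (simp add: g_def f)
    moreover have "g (k - (j - i)) = y"
    proof (cases "j = k")
      case True
      then have "k - (j - i) = i" using that by simp
      then show ?thesis using eq True f(2) by (simp add: g_def)
    next
      case False
      then have "\<not> k - (j - i) \<le> i" "k - (j - i) + (j - i) = k" using that by simp_all
      then show ?thesis using f(2) by (simp only: g_def if_False)
    qed
    moreover have "r (g l) (g (Suc l))" if l: "l < k - (j - i)" for l
    proof -
      consider "Suc l \<le> i" | "l = i" | "l > i" by linarith
      then show ?thesis
      proof cases
        case 1
        then have "g l = f l" "g (Suc l) = f (Suc l)" "l < k" using l by (simp_all add: g_def)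
        then show ?thesis using f(3) by simp
      next
        case 2
        then have "g l = f j" "g (Suc l) = f (Suc j)" "j < k"
          using l eq \<open>i < j\<close> by (simp_all add: g_def)
        then show ?thesis using f(3) by simp
      next
        case 3
        then have "g l = f (l + (j - i))" "g (Suc l) = f (Suc (l + (j - i)))" "l + (j - i) < k"
          using l by (simp_all add: g_def)
        then show ?thesis using f(3) by simp
      qed
    qed
    ultimately have "(r ^^ (k - (j - i))) x y" unfolding relpowp_fun_conv by blast
    from kmin[OF this] that show False by simp
  qed
  have kpos: "k > 0" using f xy by (cases k) auto
  have fu: "f i \<noteq> u" if "i \<le> k" for i
    using that f(3)[of i] f(3)[of "i - 1"] kpos by (cases "i < k") (auto simp: r_def)
  define S where "S = insert u (f ` {..k})"
  have fadj: "adj G (f i) (f (Suc i))" if "i < k" for i using f(3)[OF that] by (simp add: r_def)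
  have fV: "f i \<in> verts G" if "i \<le> k" for i
  proof (cases "i < k")
    case True
    then show ?thesis using adj_verts[OF s fadj] by blast
  next
    case False
    then have "adj G (f (i - 1)) (f i)" using that kpos fadj[of "i - 1"] by simp
    then show ?thesis using adj_verts[OF s] by blast
  qed
  have SV: "S \<subseteq> verts G" using fV adj_verts[OF s ux] by (auto simp: S_def)
  let ?H = "induced G S"
  have vH: "verts ?H = S" using SV by auto
  have sH: "simple_graph ?H" by (rule simple_induced[OF s])
  have HS: "adj ?H a b \<longleftrightarrow> adj G a b \<and> a \<in> S \<and> b \<in> S" for a b by (rule adj_induced)
  have fS: "f l \<in> S" if "l \<le> k" for l using that by (simp add: S_def)
  have uS: "u \<in> S" by (simp add: S_def)
  have fH: "adj ?H (f l) (f (Suc l))" if "l < k" for l using that fadj fS by (simp add: HS)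
  have seg: "av ?H w (f i) (f j)" if "i \<le> j" "j \<le> k" "\<And>l. i \<le> l \<Longrightarrow> l \<le> j \<Longrightarrow> f l \<noteq> w" for i j w
    unfolding av_def
    by (rule rtranclp_segment[OF that(1)]) (use that fH in auto)
  have av_le: "(adj ?H)\<^sup>*\<^sup>* a b" if "av ?H w a b" for a b w
    using that unfolding av_def by (rule rtranclp_mono[THEN predicate2D, rotated]) auto
  \<comment> \<open>After removing \<open>w\<close>, the vertex \<open>f i\<close> reaches
    \<open>u\<close> along the arc of the cycle that misses \<open>w\<close>: back to
    \<open>f 0\<close> if \<open>w\<close> does not occur up to \<open>i\<close>, otherwise on to
    \<open>f k\<close>, where injectivity excludes \<open>w\<close>.\<close>
  have toU: "av ?H w (f i) u" if "i \<le> k" "f i \<noteq> w" "w \<noteq> u" for i w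
  proof (cases "\<exists>l\<le>i. f l = w")
    case False
    then have "av ?H w (f 0) (f i)" using seg[of 0 i w] that by auto
    moreover have "av ?H w (f 0) u"
      using False f(1) ux that fS[of 0] uS by (intro av_adj) (auto simp: HS adj_sym[of G x])
    ultimately show ?thesis by (rule av_trans[OF av_sym])
  next
    case True
    then obtain l where l: "l \<le> i" "f l = w" by auto
    then have "l < i" using that by (cases "l = i") auto
    then have ne: "f m \<noteq> w" if "i \<le> m" "m \<le> k" for m using inj[of l m] l that by auto
    have "av ?H w (f i) (f k)" using seg[of i k w] that ne by auto
    moreover have "av ?H w (f k) u"
      using ne[of k] f(2) uy that fS[of k] uS by (intro av_adj) (auto simp: HS adj_sym[of G y])
    ultimately show ?thesis by (rule av_trans)
  qed
  have cU: "(adj ?H)\<^sup>*\<^sup>* a u" if aS: "a \<in> S" for a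
  proof (cases "a = u")
    case False
    then obtain i where i: "i \<le> k" "a = f i" using aS by (auto simp: S_def)
    have "(adj ?H)\<^sup>*\<^sup>* (f 0) (f i)"
      by (rule rtranclp_segment) (use fH i in auto)
    moreover have "adj ?H u (f 0)" using ux f(1) fS[of 0] uS by (simp add: HS)
    ultimately show ?thesis
      using i adj_rtranclp_sym[OF converse_rtranclp_into_rtranclp] by auto
  qed simp
  have conH: "connected_graph ?H"
    unfolding connected_graph_def vH
  proof (intro conjI ballI)
    fix a b assume "a \<in> S" "b \<in> S"
    then show "(adj ?H)\<^sup>*\<^sup>* a b" using rtranclp_trans[OF cU adj_rtranclp_sym[OF cU]] by blast
  qed (simp add: S_def)
  have "av ?H w a b" if abS: "a \<in> S - {w}" "b \<in> S - {w}" for a b w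
  proof (cases "w = u")
    case True
    then obtain i j where ij: "i \<le> k" "j \<le> k" "a = f i" "b = f j" using abS by (auto simp: S_def)
    then have "av ?H w (f 0) (f i)" "av ?H w (f 0) (f j)"
      using seg[of 0 i w] seg[of 0 j w] fu True by auto
    then show ?thesis unfolding ij by (rule av_trans[OF av_sym])
  next
    case False
    have c: "av ?H w c u" if cS: "c \<in> S - {w}" for c
    proof (cases "c = u")
      case False
      then obtain i where "i \<le> k" "c = f i" using cS by (auto simp: S_def)
      then show ?thesis using toU[of i w] cS \<open>w \<noteq> u\<close> by simp
    qed simp
    show ?thesis using av_trans[OF c[OF abS(1)] av_sym[OF c[OF abS(2)]]] .
  qed
  then have "cut_verts ?H = {}" using cut_verts_iff[OF sH conH] by (auto simp: vH)
  then have "two_connected ?H" using conH by (simp add: two_connected_def)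
  then obtain B where "B \<in> blocks G" "S \<subseteq> B" using two_connected_subset_block[OF s SV] by blast
  then have "clique G B" "x \<in> B" "y \<in> B" using bg f(1,2)
    by (auto simp: block_graph_def S_def)
  then show ?thesis using xy by (simp add: clique_def)
qed

text \<open>The union of those components of \<open>G - u\<close> that contain a neighbour of
  \<open>u\<close> satisfying \<open>P\<close>. With \<open>P\<close> selecting the neighbours in
  \<open>B\<close> or those off \<open>B\<close>, both kinds of pairs are covered.\<close>

definition attached :: "'a sgraph \<Rightarrow> 'a \<Rightarrow> ('a \<Rightarrow> bool) \<Rightarrow> 'a set" where
  "attached G u P = {x. x \<noteq> u \<and> (\<exists>b. adj G u b \<and> P b \<and> av G u b x)}"

text \<open>The vertices of \<open>G[p]\<close> other than its base.\<close>

fun inn :: "'a sgraph \<Rightarrow> 'a vbpair \<Rightarrow> 'a set" where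
  "inn G (VB u B) = attached G u (\<lambda>b. b \<notin> B)"
| "inn G (BV B u) = attached G u (\<lambda>b. b \<in> B)"

lemma attached_adj: "adj G x y \<Longrightarrow> x \<in> attached G u P \<Longrightarrow> y \<noteq> u \<Longrightarrow> y \<in> attached G u P"
  unfolding attached_def using av_trans av_adj by fastforce

lemma attached_nbr: "simple_graph G \<Longrightarrow> adj G u x \<Longrightarrow> P x \<Longrightarrow> x \<in> attached G u P"
  unfolding attached_def using adj_verts by fastforce

section \<open>The subgraphs G[p] and cut-vertices seen from neighbourhoods\<close>

lemma adj_delete_edges:
  assumes "simple_graph G"
  shows "adj (delete_edges G {{u, v} | v. P v}) a b \<longleftrightarrow>
    adj G a b \<and> (a = u \<longrightarrow> \<not> P b) \<and> (b = u \<longrightarrow> \<not> P a)"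
  using adj_verts[OF assms, of a b]
  by (auto simp: adj_def delete_edges_def doubleton_eq_iff)

text \<open>Every deleted edge is incident with \<open>u\<close>, so walks avoiding \<open>u\<close>
  survive; deletion only decides through which neighbours a walk may leave \<open>u\<close>.\<close>

lemma component_verts_delete_edges:
  assumes s: "simple_graph G" and u: "u \<in> verts G"
  shows "component_verts (delete_edges G {{u, v} | v. P v}) u = insert u (attached G u (\<lambda>b. \<not> P b))"
    (is "?L = insert u ?A")
proof -
  let ?K = "delete_edges G {{u, v} | v. P v}"
  note K = adj_delete_edges[OF s, of u P]
  have "x \<in> insert u ?A" if "(adj ?K)\<^sup>*\<^sup>* u x" for x
    using that
  proof (induction rule: rtranclp_induct)
    case (step y z)
    then have yz: "adj G y z" "y = u \<Longrightarrow> \<not> P z" by (auto simp: K)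
    show ?case
    proof (cases "z = u \<or> y = u")
      case True
      then show ?thesis using yz attached_nbr[OF s, of u z "\<lambda>b. \<not> P b"] by auto
    next
      case False
      then show ?thesis using step.IH attached_adj[OF yz(1)] by auto
    qed
  qed simp
  moreover have "x \<in> verts G \<and> (adj ?K)\<^sup>*\<^sup>* u x" if x: "x \<in> ?A" for x
  proof -
    obtain b where b: "adj G u b" "\<not> P b" "av G u b x" "x \<noteq> u"
      using x by (auto simp: attached_def)
    have bu: "b \<noteq> u" using adj_verts[OF s b(1)] by auto
    have "adj ?K u b" using b bu by (auto simp: K)
    moreover have "x \<in> verts G \<and> (adj ?K)\<^sup>*\<^sup>* b x"
      using b(3) unfolding av_def
    proof (induction rule: rtranclp_induct)
      case base
      then show ?case using adj_verts[OF s b(1)] by auto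
    next
      case (step y z)
      then have "adj ?K y z" by (auto simp: K)
      moreover have "z \<in> verts G" using step adj_verts[OF s] by blast
      ultimately show ?case using step.IH by (auto intro: rtranclp.rtrancl_into_rtrancl)
    qed
    ultimately show ?thesis by (auto intro: converse_rtranclp_into_rtranclp)
  qed
  ultimately show ?thesis
    using u by (auto simp: component_verts_def delete_edges_def)
qed

lemma rtranclp_component:
  assumes "(adj K)\<^sup>*\<^sup>* u x" and "simple_graph K" and "u \<in> verts K"
  shows "(adj (component K u))\<^sup>*\<^sup>* u x"
  using assms(1)
proof (induction rule: rtranclp_induct)
  case (step y z)
  have "y \<in> verts K" "z \<in> verts K" using adj_verts[OF assms(2) step(2)] by auto
  moreover have "(adj K)\<^sup>*\<^sup>* u z" using step by (auto intro: rtranclp.rtrancl_into_rtrancl)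
  ultimately have "adj (component K u) y z"
    using step by (auto simp: component_def adj_induced component_verts_def)
  then show ?case using step by (auto intro: rtranclp.rtrancl_into_rtrancl)
qed simp

lemma connected_component:
  assumes "simple_graph K" and "u \<in> verts K"
  shows "connected_graph (component K u)"
proof -
  have "(adj (component K u))\<^sup>*\<^sup>* u x" if "x \<in> verts (component K u)" for x
    using that rtranclp_component[OF _ assms, of x]
    by (auto simp: component_def component_verts_def)
  moreover have "u \<in> verts (component K u)"
    using assms by (auto simp: component_def component_verts_def)
  moreover have "(adj (component K u))\<^sup>*\<^sup>* x y"
    if "x \<in> verts (component K u)" "y \<in> verts (component K u)" for x y
    using rtranclp_trans[OF adj_rtranclp_sym, of "component K u" u x y] calculation(1) that by blast
  ultimately show ?thesis unfolding connected_graph_def by blast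
qed

text \<open>The wanted \<open>b\<close> follows the last visit of a walk to \<open>v\<close>; after
  it the walk stays off \<open>v\<close>.\<close>

lemma connected_nbr:
  assumes s: "simple_graph H" and c: "connected_graph H" and v: "v \<in> verts H" and x: "x \<in> verts H" "x \<noteq> v"
  obtains b where "adj H v b" "av H v b x"
proof -
  have "(adj H)\<^sup>*\<^sup>* v x" using c v x by (simp add: connected_graph_def)
  then have "x \<noteq> v \<longrightarrow> (\<exists>b. adj H v b \<and> av H v b x)"
  proof (induction rule: rtranclp_induct)
    case (step y z)
    show ?case
    proof (cases "y = v")
      case True
      then show ?thesis using step by (auto intro: exI[of _ z])
    next
      case False
      then show ?thesis using step av_trans[OF _ av_adj[OF step(2), of v]] by (cases "z = v") auto
    qed
  qed simp
  then show ?thesis using x that by blast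
qed

text \<open>Under \<open>F\<close> the neighbours of \<open>v\<close> in one component of
  \<open>H - v\<close> form a clique, so \<open>v\<close> separates something iff two of its
  neighbours are not adjacent. Keeping \<open>H\<close> general allows the use for \<open>G\<close>
  as well as for \<open>G[B,u]\<close>.\<close>

lemma cut_verts_nbrs:
  assumes s: "simple_graph H" and c: "connected_graph H"
    and F: "\<And>u x y. adj H u x \<Longrightarrow> adj H u y \<Longrightarrow> x \<noteq> y \<Longrightarrow> av H u x y \<Longrightarrow> adj H x y"
  shows "v \<in> cut_verts H \<longleftrightarrow> (\<exists>x y. adj H v x \<and> adj H v y \<and> x \<noteq> y \<and> \<not> adj H x y)"
proof
  assume "v \<in> cut_verts H"
  then obtain x y where xy: "v \<in> verts H" "x \<in> verts H" "y \<in> verts H" "x \<noteq> v" "y \<noteq> v" "\<not> av H v x y"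
    unfolding cut_verts_iff[OF s c] by blast
  obtain b where b: "adj H v b" "av H v b x" using connected_nbr[OF s c xy(1,2,4)] .
  obtain d where d: "adj H v d" "av H v d y" using connected_nbr[OF s c xy(1,3,5)] .
  have "\<not> av H v b d"
  proof
    assume "av H v b d"
    then have "av H v x y" using av_trans[OF av_trans[OF av_sym[OF b(2)]] d(2)] by blast
    then show False using xy by simp
  qed
  then have "b \<noteq> d" "\<not> adj H b d"
    using adj_verts[OF s b(1)] adj_verts[OF s d(1)] av_adj[of H b d v] by auto
  then show "\<exists>x y. adj H v x \<and> adj H v y \<and> x \<noteq> y \<and> \<not> adj H x y" using b d by blast
next
  assume "\<exists>x y. adj H v x \<and> adj H v y \<and> x \<noteq> y \<and> \<not> adj H x y"
  then obtain x y where xy: "adj H v x" "adj H v y" "x \<noteq> y" "\<not> adj H x y" by blast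
  then have "\<not> av H v x y" using F by blast
  then show "v \<in> cut_verts H" unfolding cut_verts_iff[OF s c]
    using adj_verts[OF s xy(1)] adj_verts[OF s xy(2)] by blast
qed

text \<open>For use in \<open>pull\<close>: \<open>A\<close> and \<open>A'\<close> are the insides
  of two blocks at \<open>u\<close>, and only \<open>A\<close> is rearranged while a token arrives
  at \<open>u\<close>.\<close>

lemma Int_eq_of_insert_Diff:
  assumes "E - A = insert u (D - A)" "A' \<inter> A = {}" "u \<notin> A'"
  shows "D \<inter> A' = E \<inter> A'"
proof -
  have "E \<inter> A' = (E - A) \<inter> A'" using assms(2) by blast
  also have "\<dots> = (D - A) \<inter> A'" unfolding assms(1) using assms(3) by blast
  finally show ?thesis using assms(2) by blast
qed

lemma insert_Diff_Un:
  assumes "E - A = insert u (D' - A)" "D' - U = D - U" "u \<notin> U"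
  shows "E - (A \<union> U) = insert u (D - (A \<union> U))"
proof -
  have "E - (A \<union> U) = (E - A) - U" by blast
  also have "\<dots> = insert u (D' - U - A)" unfolding assms(1) using assms(3) by blast
  finally show ?thesis unfolding assms(2) by blast
qed

section \<open>Blocks of a connected block graph as maximal cliques\<close>

locale conn_block_graph =
  fixes G :: "'a sgraph"
  assumes conG: "connected_graph G" and bgG: "block_graph G"
begin

lemma sG: "simple_graph G" using bgG by (simp add: block_graph_def)

lemma finV: "finite (verts G)" using sG by (simp add: simple_graph_def)

lemma av_adjG: "adj G u x \<Longrightarrow> adj G u y \<Longrightarrow> x \<noteq> y \<Longrightarrow> av G u x y \<Longrightarrow> adj G x y"
  using block_graph_av_adj[OF bgG] .

lemma block_clique: "B \<in> blocks G \<Longrightarrow> a \<in> B \<Longrightarrow> b \<in> B \<Longrightarrow> a \<noteq> b \<Longrightarrow> adj G a b"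
  using bgG by (auto simp: block_graph_def clique_def)

lemma block_sub: "B \<in> blocks G \<Longrightarrow> B \<subseteq> verts G"
  by (simp add: blocks_def)

lemma finite_block: "B \<in> blocks G \<Longrightarrow> finite B"
  using block_sub finV finite_subset by blast

lemma finite_blocks: "finite (blocks G)"
  using finV by (auto intro: finite_subset[of _ "Pow (verts G)"] simp: blocks_def)

text \<open>As cliques are 2-connected, maximality among 2-connected sets includes maximality among
  cliques.\<close>

lemma block_maximal: 
  assumes B: "B \<in> blocks G" and T: "clique G T" "B \<subseteq> T"
  shows "T = B"
proof -
  have "B \<noteq> {}" using B by (auto simp: blocks_def two_connected_def connected_graph_def)
  then have "two_connected (induced G T)" "T \<subseteq> verts G"
    using clique_two_connected[OF sG T(1)] T by (auto simp: clique_def)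
  then show ?thesis using B T(2) unfolding blocks_def by blast
qed

lemma adj_in_block:
  assumes "adj G a b"
  shows "\<exists>B\<in>blocks G. a \<in> B \<and> b \<in> B"
proof -
  have "clique G {a, b}" using assms adj_verts[OF sG assms] by (auto simp: clique_def adj_sym)
  then have "two_connected (induced G {a, b})" "{a, b} \<subseteq> verts G"
    using clique_two_connected[OF sG] by (auto simp: clique_def)
  then show ?thesis using two_connected_subset_block[OF sG, of "{a, b}"] by auto
qed

text \<open>For \<open>x\<close> in \<open>B\<close> and \<open>y\<close> in \<open>B'\<close> the
  walk through \<open>b\<close> avoids \<open>a\<close>, so these neighbours of \<open>a\<close> are
  adjacent. The union is then a clique, and maximality identifies both blocks with it.\<close>

lemma block_unique:
  assumes B: "B \<in> blocks G" "B' \<in> blocks G" and ab: "a \<in> B" "a \<in> B'" "b \<in> B" "b \<in> B'" "a \<noteq> b"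
  shows "B = B'"
proof -
  have "adj G x y" if x: "x \<in> B" and y: "y \<in> B'" and "x \<noteq> y" for x y
  proof (cases "x = a \<or> x = b \<or> y = a \<or> y = b")
    case True
    then show ?thesis using block_clique[OF B(1)] block_clique[OF B(2)] ab that by blast
  next
    case False
    then have "adj G a x" "adj G a y" "adj G x b" "adj G b y"
      using block_clique[OF B(1)] block_clique[OF B(2)] ab that by blast+
    then have "av G a x b" "av G a b y" using False ab by (auto intro: av_adj)
    then have "av G a x y" by (rule av_trans)
    then show ?thesis using av_adjG[of a x y] \<open>adj G a x\<close> \<open>adj G a y\<close> that by blast
  qed
  then have "clique G (B \<union> B')" unfolding clique_def
    using block_clique[OF B(1)] block_clique[OF B(2)] block_sub B adj_sym[of G] by blast
  then have "B \<union> B' = B" "B \<union> B' = B'" using block_maximal B by blast+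
  then show ?thesis by simp
qed

lemma block_triangle:
  assumes B: "B \<in> blocks G" "u \<in> B" "b \<in> B" "b \<noteq> u" and v: "adj G u v" "adj G b v"
  shows "v \<in> B"
proof -
  have ub: "adj G u b" using block_clique[OF B(1)] B by blast
  have "clique G {u, b, v}"
    using ub v adj_verts[OF sG ub] adj_verts[OF sG v(1)] by (auto simp: clique_def adj_sym)
  then have "two_connected (induced G {u, b, v})" "{u, b, v} \<subseteq> verts G"
    using clique_two_connected[OF sG] by (auto simp: clique_def)
  then obtain B' where "B' \<in> blocks G" "{u, b, v} \<subseteq> B'" 
    using two_connected_subset_block[OF sG, of "{u, b, v}"] by auto
  then show ?thesis using block_unique[of B B' u b] B by auto
qed

text \<open>Unless \<open>v = b\<close>, the three vertices \<open>u\<close>, \<open>b\<close>,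
  \<open>v\<close> form a triangle. Hence a block at \<open>u\<close> contains all neighbours of
  \<open>u\<close> in the component of \<open>G - u\<close> that it meets, which separates the
  branches at \<open>u\<close>.\<close>

lemma block_av:
  assumes B: "B \<in> blocks G" "u \<in> B" "b \<in> B" "b \<noteq> u" and v: "adj G u v" "av G u b v"
  shows "v \<in> B"
proof (cases "b = v")
  case False
  have ub: "adj G u b" using block_clique[OF B(1)] B by blast
  show ?thesis using block_triangle[OF B v(1) av_adjG[OF ub v(1) False v(2)]] .
qed (use B in simp)

text \<open>A one-vertex block is possible only at an isolated vertex, since any edge is a larger
  clique.\<close>

lemma block_other:
  assumes B: "B \<in> blocks G" "a \<in> B" and w: "adj G a w"
  shows "\<exists>b\<in>B. b \<noteq> a"
proof (rule ccontr)
  assume "\<not> ?thesis"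
  then have Ba: "B = {a}" using B(2) by blast
  moreover have "clique G {a, w}" using w adj_verts[OF sG w] by (auto simp: clique_def adj_sym)
  ultimately have "{a, w} = {a}" using block_maximal[OF B(1), of "{a, w}"] by simp
  then show False using adj_verts[OF sG w] by auto
qed

lemma cut_iff: "v \<in> cut_verts G \<longleftrightarrow> (\<exists>x y. adj G v x \<and> adj G v y \<and> x \<noteq> y \<and> \<not> adj G x y)"
  using cut_verts_nbrs[OF sG conG av_adjG] .

section \<open>Branches at a vertex and how they nest\<close>

lemma inn_subset: "inn G p \<subseteq> verts G - {base p}"
proof -
  have "x \<in> verts G" if "adj G u b" "av G u b x" for u b x
    using that(2,1) unfolding av_def
    by (induction rule: rtranclp_induct) (use adj_verts[OF sG] in blast)+
  then show ?thesis by (cases p) (auto simp: attached_def)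
qed

lemma finite_inn: "finite (inn G p)"
  using finite_subset[OF inn_subset] finV by blast

lemma inn_BV_block: "B \<in> blocks G \<Longrightarrow> u \<in> B \<Longrightarrow> x \<in> inn G (BV B u) \<Longrightarrow> adj G u x \<Longrightarrow> x \<in> B"
  using block_av[of B u] adj_verts[OF sG] by (auto simp: attached_def)

lemma inn_VB_block:
  assumes B: "B \<in> blocks G" "u \<in> B" and x: "x \<in> inn G (VB u B)"
  shows "x \<notin> B"
proof
  assume xB: "x \<in> B"
  obtain b where b: "adj G u b" "b \<notin> B" "av G u b x" "x \<noteq> u" using x by (auto simp: attached_def)
  show False using block_av[OF B xB b(4) b(1) av_sym[OF b(3)]] b by blast
qed

lemma block_inn_BV: "B \<in> blocks G \<Longrightarrow> u \<in> B \<Longrightarrow> B - {u} \<subseteq> inn G (BV B u)"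
  using attached_nbr[OF sG] block_clique by fastforce

lemma inn_VB_BV_disjoint:
  assumes "B \<in> blocks G" "u \<in> B"
  shows "inn G (VB u B) \<inter> inn G (BV B u) = {}"
proof -
  have False if h: "b \<in> B" "adj G u b" "av G u b x" "d \<notin> B" "adj G u d" "av G u d x" for b d x
  proof -
    have "b \<noteq> u" using adj_verts[OF sG h(2)] by auto
    then show False
      using block_av[OF assms h(1) _ h(5)] av_trans[OF h(3) av_sym[OF h(6)]] h(4) by blast
  qed
  then show ?thesis by (auto simp: attached_def)
qed

lemma inn_VB_eq:
  assumes "B \<in> blocks G" "u \<in> B"
  shows "inn G (VB u B) = (\<Union>B'\<in>blocks_at G u - {B}. inn G (BV B' u))"
proof (intro equalityI subsetI)
  fix x assume "x \<in> inn G (VB u B)"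
  then obtain b where b: "adj G u b" "b \<notin> B" "av G u b x" "x \<noteq> u" by (auto simp: attached_def)
  then obtain B' where "B' \<in> blocks G" "u \<in> B'" "b \<in> B'" using adj_in_block by blast
  then have "B' \<in> blocks_at G u - {B}" "x \<in> inn G (BV B' u)"
    using b by (auto simp: blocks_at_def attached_def)
  then show "x \<in> (\<Union>B'\<in>blocks_at G u - {B}. inn G (BV B' u))" by blast
next
  fix x assume "x \<in> (\<Union>B'\<in>blocks_at G u - {B}. inn G (BV B' u))"
  then obtain B' b where B': "B' \<in> blocks G" "u \<in> B'" "B' \<noteq> B" and b: "b \<in> B'" "adj G u b" "av G u b x" "x \<noteq> u"
    by (auto simp: attached_def blocks_at_def)
  have "b \<noteq> u" using adj_verts[OF sG b(2)] by auto
  then have "b \<notin> B" using block_unique[of B B' u b] assms B' b by blast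
  then show "x \<in> inn G (VB u B)" using b by (auto simp: attached_def)
qed

lemma inn_BV_disjoint:
  assumes "B \<in> blocks_at G u" "B' \<in> blocks_at G u" "B \<noteq> B'"
  shows "inn G (BV B u) \<inter> inn G (BV B' u) = {}"
proof -
  have "inn G (BV B' u) \<subseteq> inn G (VB u B)"
    using assms inn_VB_eq[of B u] by (auto simp: blocks_at_def)
  then show ?thesis using inn_VB_BV_disjoint[of B u] assms by (auto simp: blocks_at_def)
qed

text \<open>A branch hanging at \<open>v\<close> never meets \<open>B\<close> again, so walks in it
  also avoid \<open>v'\<close>; preceded by the edge from \<open>v'\<close> to \<open>v\<close> they
  belong to the side of \<open>B\<close> as seen from \<open>v'\<close>.\<close>

lemma inn_VB_cross:
  assumes B: "B \<in> blocks G" "v \<in> B" "v' \<in> B" "v \<noteq> v'"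
  shows "inn G (VB v B) \<subseteq> inn G (BV B v')"
proof
  fix x assume x: "x \<in> inn G (VB v B)"
  then obtain b where b: "adj G v b" "b \<notin> B" "av G v b x" by (auto simp: attached_def)
  have bv: "b \<noteq> v" using adj_verts[OF sG b(1)] by auto
  have bin: "b \<in> inn G (VB v B)" using b attached_nbr[OF sG] by simp
  have "av G v' b x \<and> x \<in> inn G (VB v B)" using b(3) unfolding av_def[of G v]
  proof (induction rule: rtranclp_induct)
    case base
    show ?case using bin by simp
  next
    case (step y z)
    then have z: "z \<in> inn G (VB v B)" using attached_adj[of G y z v] by simp
    have "y \<notin> B" "z \<notin> B" using step z inn_VB_block[OF B(1,2)] by blast+
    then have "av G v' y z" using B step by (intro av_adj) auto
    then show ?case using step z av_trans[of G v' b y z] by blast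
  qed
  moreover have "av G v' v b" using B b by (intro av_adj) auto
  ultimately have "av G v' v x" using av_trans[of G v' v b x] by blast
  moreover have "x \<noteq> v'" using inn_VB_block[OF B(1,2) x] B by auto
  moreover have "adj G v' v" using block_clique[OF B(1)] B by blast
  ultimately show "x \<in> inn G (BV B v')" using B by (auto simp: attached_def)
qed

lemma inn_VB_disjoint:
  assumes "B \<in> blocks G" "v \<in> B" "v' \<in> B" "v \<noteq> v'"
  shows "inn G (VB v B) \<inter> inn G (VB v' B) = {}"
  using inn_VB_cross[OF assms] inn_VB_BV_disjoint[of B v'] assms by blast

text \<open>A neighbour of \<open>v\<close> off \<open>B\<close> and another vertex of
  \<open>B\<close> would be non-adjacent neighbours of \<open>v\<close>. Therefore the recursion
  loses nothing by visiting cut-vertices only.\<close>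

lemma inn_VB_noncut:
  assumes B: "B \<in> blocks G" "v \<in> B" and nc: "v \<notin> cut_verts G"
  shows "inn G (VB v B) = {}"
proof (rule ccontr)
  assume "inn G (VB v B) \<noteq> {}"
  then obtain b where b: "adj G v b" "b \<notin> B" by (auto simp: attached_def)
  then obtain d where d: "d \<in> B" "d \<noteq> v" using block_other[OF B] by blast
  then have "adj G v d" using block_clique[OF B(1)] B by blast
  moreover have "\<not> adj G d b" using block_triangle[OF B d b(1)] b by blast
  ultimately show False using cut_iff[of v] nc b d by blast
qed

lemma inn_BV_eq:
  assumes B: "B \<in> blocks G" "u \<in> B"
  shows "inn G (BV B u) = (B - {u}) \<union> (\<Union>v\<in>B \<inter> cut_verts G - {u}. inn G (VB v B))"
proof -
  \<comment> \<open>Along a walk from \<open>u\<close>, a vertex off \<open>B\<close> stays behind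
    the same \<open>v\<close> of \<open>B\<close> until the walk returns to
    \<open>v\<close>.\<close>
  have cov: "x \<in> B \<or> (\<exists>v\<in>B. x \<in> inn G (VB v B))" if "(adj G)\<^sup>*\<^sup>* u x" for x
    using that
  proof (induction rule: rtranclp_induct)
    case (step y z)
    show ?case
    proof (cases "z \<in> B \<or> y \<in> B")
      case True
      then show ?thesis using step attached_nbr[OF sG, of y z "\<lambda>b. b \<notin> B"] by auto
    next
      case False
      then obtain v where v: "v \<in> B" "y \<in> inn G (VB v B)" using step by blast
      then have "z \<in> inn G (VB v B)" using attached_adj[OF step(2), of v] False by auto
      then show ?thesis using v by blast
    qed
  qed (use B in simp)
  have "x \<in> (B - {u}) \<union> (\<Union>v\<in>B \<inter> cut_verts G - {u}. inn G (VB v B))" if x: "x \<in> inn G (BV B u)" for x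
  proof -
    have "x \<in> verts G" "x \<noteq> u" using x inn_subset by fastforce+
    moreover have "u \<in> verts G" using B block_sub by blast
    ultimately have "(adj G)\<^sup>*\<^sup>* u x" using conG by (simp add: connected_graph_def)
    then consider "x \<in> B" | v where "v \<in> B" "x \<in> inn G (VB v B)" using cov by blast
    then show ?thesis
    proof cases
      case 2
      then have "v \<noteq> u" using inn_VB_BV_disjoint[OF B] x by blast
      moreover have "v \<in> cut_verts G" using 2 inn_VB_noncut[OF B(1)] by blast
      ultimately show ?thesis using 2 by blast
    qed (use \<open>x \<noteq> u\<close> in simp)
  qed
  moreover have "inn G (VB v B) \<subseteq> inn G (BV B u)" if "v \<in> B" "v \<noteq> u" for v
    using inn_VB_cross[OF B(1) that(1) B(2)] that by blast
  ultimately show ?thesis using block_inn_BV[OF B] by blast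
qed

text \<open>Deleting edges could leave fewer edges than the induced subgraph has. It does not,
  because the remaining part contains no neighbour of \<open>u\<close> whose edge was
  deleted.\<close>

lemma subg_induced:
  assumes B: "B \<in> blocks G" "base p = u" "u \<in> B" and p: "p = VB u B \<or> p = BV B u"
  shows "subg G p = induced G (insert u (inn G p))"
proof -
  \<comment> \<open>\<open>P\<close> marks the neighbours of \<open>u\<close> whose edge to
    \<open>u\<close> is deleted, so that both kinds of pairs are treated at once.\<close>
  define P where "P = (\<lambda>v. if p = VB u B then v \<in> B else v \<notin> B)"
  let ?F = "{{u, v} | v. P v}"
  let ?K = "delete_edges G ?F"
  have u: "u \<in> verts G" using B block_sub by blast
  have inn: "inn G p = attached G u (\<lambda>b. \<not> P b)" using p by (auto simp: P_def)
  have "subg G p = component ?K u" using p by (auto simp: P_def)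
  also have "\<dots> = induced ?K (insert u (inn G p))"
    unfolding component_def inn component_verts_delete_edges[OF sG u] ..
  also have "\<dots> = induced G (insert u (inn G p))"
  proof -
    have "e \<notin> ?F" if e: "e \<in> edges G" "e \<subseteq> insert u (inn G p)" for e
    proof
      assume "e \<in> ?F"
      then obtain v where v: "e = {u, v}" "P v" by blast
      then have uv: "adj G u v" using e by (simp add: adj_def)
      then have "v \<in> inn G p" using e v adj_verts[OF sG uv] by auto
      then show False
        using p v uv inn_VB_block[OF B(1,3), of v] inn_BV_block[OF B(1,3), of v] by (auto simp: P_def)
    qed
    then show ?thesis by (auto simp: induced_def delete_edges_def)
  qed
  finally show ?thesis .
qed

lemma verts_subg:
  assumes "B \<in> blocks G" "u \<in> B" "p = VB u B \<or> p = BV B u"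
  shows "verts (subg G p) = insert u (inn G p)"
proof -
  have b: "base p = u" using assms by auto
  have "u \<in> verts G" using assms block_sub by blast
  then show ?thesis using subg_induced[OF assms(1) b assms(2,3)] inn_subset[of p] b by auto
qed

lemma blocks_at_other:
  assumes u: "u \<in> cut_verts G" "B \<in> blocks_at G u"
  shows "blocks_at G u - {B} \<noteq> {}"
proof -
  obtain x y where xy: "adj G u x" "adj G u y" "x \<noteq> y" "\<not> adj G x y" using u cut_iff by blast
  obtain Bx By where Bs: "Bx \<in> blocks G" "u \<in> Bx" "x \<in> Bx" "By \<in> blocks G" "u \<in> By" "y \<in> By"
    using adj_in_block[OF xy(1)] adj_in_block[OF xy(2)] by blast
  then have "Bx \<noteq> By" using xy block_clique by blast
  then show ?thesis using Bs by (auto simp: blocks_at_def)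
qed

lemma block_other_cut:
  assumes u: "u \<in> cut_verts G" "B \<in> blocks_at G u"
  shows "\<exists>b\<in>B. b \<noteq> u"
  using assms block_other[of B u] cut_iff[of u] by (auto simp: blocks_at_def)

text \<open>Blocks of \<open>G[u,B]\<close> are maximal within a smaller vertex set. The other
  blocks at \<open>u\<close> lie inside that set and stay maximal; conversely a block of
  \<open>G[u,B]\<close> at \<open>u\<close> extends to one of \<open>G\<close>, and the extension
  cannot be \<open>B\<close>.\<close>

lemma \<beta>_eq:
  assumes u: "u \<in> cut_verts G" "B \<in> blocks_at G u"
  shows "\<beta> G u B = blocks_at G u - {B}"
proof -
  have B: "B \<in> blocks G" "u \<in> B" using u by (auto simp: blocks_at_def)
  let ?W = "insert u (inn G (VB u B))"
  have uV: "u \<in> verts G" using B block_sub by blast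
  have W: "verts G \<inter> ?W = ?W" using inn_subset[of "VB u B"] uV by auto
  have sub: "subg G (VB u B) = induced G ?W" using subg_induced[of B "VB u B" u] B by simp
  have ind: "induced (induced G ?W) S = induced G S" if "S \<subseteq> ?W" for S
    using induced_induced that by blast
  have inW: "B' \<subseteq> ?W" if "B' \<in> blocks_at G u - {B}" for B'
  proof
    fix x assume x: "x \<in> B'"
    show "x \<in> ?W"
    proof (cases "x = u")
      case False
      have B': "B' \<in> blocks G" "u \<in> B'" "B' \<noteq> B" using that by (auto simp: blocks_at_def)
      then have "x \<notin> B" using block_unique[of B B' u x] B x False by blast
      moreover have "adj G u x" using block_clique[OF B'(1)] B' x False by blast
      ultimately show ?thesis using attached_nbr[OF sG] by auto
    qed simp
  qed
  have bl: "S \<in> blocks (induced G ?W) \<longleftrightarrow> S \<subseteq> ?W \<and> two_connected (induced G S) \<and>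
      (\<forall>T. S \<subset> T \<and> T \<subseteq> ?W \<longrightarrow> \<not> two_connected (induced G T))" for S
    unfolding blocks_def verts_induced W using ind by auto
  show ?thesis
  proof (intro equalityI subsetI)
    fix S assume "S \<in> \<beta> G u B"
    then have S: "u \<in> S" "S \<subseteq> ?W" "two_connected (induced G S)"
      "\<And>T. S \<subset> T \<Longrightarrow> T \<subseteq> ?W \<Longrightarrow> \<not> two_connected (induced G T)"
      unfolding \<beta>_def sub blocks_at_def mem_Collect_eq bl by blast+
    obtain B' where B': "B' \<in> blocks G" "S \<subseteq> B'"
      using two_connected_subset_block[OF sG _ S(3)] S(2) W by blast
    show "S \<in> blocks_at G u - {B}"
    proof (cases "B' = B")
      case True
      \<comment> \<open>\<open>B\<close> meets \<open>G[u,B]\<close> only in \<open>u\<close>, and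
        \<open>{u}\<close> is not maximal there because a cut-vertex lies in a second block.\<close>
      then have "S = {u}" using S B' inn_VB_block[OF B] by blast
      moreover obtain B2 where B2: "B2 \<in> blocks_at G u - {B}" using blocks_at_other[OF u] by blast
      then obtain b where "b \<in> B2" "b \<noteq> u" using block_other_cut[OF u(1), of B2] by blast
      then have "{u} \<subset> B2" "two_connected (induced G B2)" using B2 by (auto simp: blocks_at_def blocks_def)
      ultimately show ?thesis using S(4)[of B2] inW[OF B2] by blast
    next
      case False
      then have B'a: "B' \<in> blocks_at G u - {B}" using B' S by (auto simp: blocks_at_def)
      then have "S = B'" using S(4)[of B'] inW[OF B'a] B' by (auto simp: blocks_def)
      then show ?thesis using B'a by simp
    qed
  next
    fix S assume S: "S \<in> blocks_at G u - {B}"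
    then have SB: "S \<in> blocks G" by (simp add: blocks_at_def)
    have "\<not> two_connected (induced G T)" if "S \<subset> T" "T \<subseteq> ?W" for T
    proof -
      have "T \<subseteq> verts G" using that(2) W by blast
      then show ?thesis using SB that(1) unfolding blocks_def by blast
    qed
    moreover have "two_connected (induced G S)" using SB by (simp add: blocks_def)
    ultimately have "S \<in> blocks (induced G ?W)" unfolding bl using inW[OF S] by blast
    moreover have "u \<in> S" using S by (simp add: blocks_at_def)
    ultimately show "S \<in> \<beta> G u B" unfolding \<beta>_def sub blocks_at_def mem_Collect_eq by (rule conjI)
  qed
qed

text \<open>Being a cut-vertex is visible in the neighbourhood. In \<open>G[B,u]\<close> the vertex
  \<open>u\<close> keeps only neighbours in the clique \<open>B\<close> and stops being one, while
  the other vertices of \<open>B\<close> keep all their neighbours.\<close>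

lemma \<kappa>_eq:
  assumes B: "B \<in> blocks G" "u \<in> B"
  shows "\<kappa> G B u = B \<inter> cut_verts G - {u}"
proof -
  let ?W = "insert u (inn G (BV B u))"
  let ?H = "induced G ?W"
  have uV: "u \<in> verts G" using B block_sub by blast
  have sub: "subg G (BV B u) = ?H" using subg_induced[of B "BV B u" u] B by simp
  have sK: "simple_graph (delete_edges G F)" for F
    using sG by (auto simp: simple_graph_def delete_edges_def)
  have conH: "connected_graph ?H"
    unfolding sub[symmetric] subg.simps by (rule connected_component[OF sK]) (simp add: delete_edges_def uV)
  have F1: "adj ?H x y" if "adj ?H w x" "adj ?H w y" "x \<noteq> y" "av ?H w x y" for w x y
  proof -
    have "av G w x y" using that(4) unfolding av_def
      by (rule rtranclp_mono[THEN predicate2D, rotated]) (auto simp: adj_induced)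
    then show ?thesis using av_adjG[of w x y] that by (auto simp: adj_induced)
  qed
  have cutH: "v \<in> cut_verts ?H \<longleftrightarrow> (\<exists>x y. adj ?H v x \<and> adj ?H v y \<and> x \<noteq> y \<and> \<not> adj ?H x y)" for v
    using F1 by (rule cut_verts_nbrs[OF simple_induced[OF sG] conH])
  have "u \<notin> cut_verts ?H"
  proof
    assume "u \<in> cut_verts ?H"
    then obtain x y where xy: "adj ?H u x" "adj ?H u y" "x \<noteq> y" "\<not> adj ?H x y" unfolding cutH by blast
    then have "x \<in> inn G (BV B u)" "y \<in> inn G (BV B u)" "adj G u x" "adj G u y"
      using adj_verts[OF sG] by (auto simp: adj_induced)
    then have "adj G x y" using inn_BV_block[OF B] block_clique[OF B(1)] xy(3) by blast
    then show False using xy by (auto simp: adj_induced)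
  qed
  moreover have "v \<in> cut_verts ?H \<longleftrightarrow> v \<in> cut_verts G" if v: "v \<in> B" "v \<noteq> u" for v
  proof -
    have vW: "v \<in> inn G (BV B u)" using block_inn_BV[OF B] v by blast
    have nW: "x \<in> ?W" if "adj G v x" for x
      using attached_adj[OF that, of u] vW by auto
    have "adj ?H v x \<longleftrightarrow> adj G v x" for x unfolding adj_induced using vW nW by blast
    moreover have "adj ?H x y \<longleftrightarrow> adj G x y" if "adj G v x" "adj G v y" for x y
      unfolding adj_induced using nW[OF that(1)] nW[OF that(2)] by blast
    ultimately show ?thesis unfolding cutH cut_iff by metis
  qed
  ultimately show ?thesis unfolding \<kappa>_def block_cut_verts_def sub by blast
qed

section \<open>Pairs and capacities\<close>

fun children :: "'a vbpair \<Rightarrow> 'a vbpair set" where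
  "children (BV B u) = (\<lambda>v. VB v B) ` (B \<inter> cut_verts G - {u})"
| "children (VB u B) = (\<lambda>B'. BV B' u) ` (blocks_at G u - {B})"

lemma pairs_BV [simp]: "BV B u \<in> pairs G \<longleftrightarrow> u \<in> cut_verts G \<and> B \<in> blocks_at G u"
  by (auto simp: pairs_def)

lemma pairs_VB [simp]: "VB u B \<in> pairs G \<longleftrightarrow> u \<in> cut_verts G \<and> B \<in> blocks_at G u"
  by (auto simp: pairs_def)

lemma blocks_at_iff: "B \<in> blocks_at G u \<longleftrightarrow> B \<in> blocks G \<and> u \<in> B"
  by (auto simp: blocks_at_def)

lemma finite_blocks_at: "finite (blocks_at G u)"
  using finite_blocks by (simp add: blocks_at_def)

lemma finite_pairs: "finite (pairs G)"
proof -
  have "finite (cut_verts G)" using finV by (simp add: cut_verts_def)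
  then show ?thesis unfolding pairs_def using finite_blocks_at by auto
qed

lemma children_pairs: "p \<in> pairs G \<Longrightarrow> q \<in> children p \<Longrightarrow> q \<in> pairs G"
  by (cases p) (auto simp: blocks_at_iff)

lemma base_notin_inn: "base p \<notin> inn G p"
  using inn_subset by blast

lemma children_inn: "p \<in> pairs G \<Longrightarrow> q \<in> children p \<Longrightarrow> inn G q \<subseteq> inn G p"
proof (cases p)
  case (BV B u)
  assume a: "p \<in> pairs G" "q \<in> children p"
  then have "B \<in> blocks G" "u \<in> B" by (auto simp: BV blocks_at_iff)
  from inn_BV_eq[OF this] show ?thesis using a unfolding BV by (auto simp del: inn.simps)
next
  case (VB u B)
  assume a: "p \<in> pairs G" "q \<in> children p"
  then have "B \<in> blocks G" "u \<in> B" by (auto simp: VB blocks_at_iff)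
  from inn_VB_eq[OF this] show ?thesis using a unfolding VB by (auto simp del: inn.simps)
qed

lemma pair_induct [consumes 1, case_names BV VB]:
  assumes p: "p \<in> pairs G"
    and BV: "\<And>B u. u \<in> cut_verts G \<Longrightarrow> B \<in> blocks G \<Longrightarrow> u \<in> B \<Longrightarrow>
      (\<And>v. v \<in> B \<inter> cut_verts G - {u} \<Longrightarrow> P (VB v B)) \<Longrightarrow> P (BV B u)"
    and VB: "\<And>u B. u \<in> cut_verts G \<Longrightarrow> B \<in> blocks G \<Longrightarrow> u \<in> B \<Longrightarrow>
      (\<And>B'. B' \<in> blocks_at G u - {B} \<Longrightarrow> P (BV B' u)) \<Longrightarrow> P (VB u B)"
  shows "P p"
proof -
  \<comment> \<open>The step from \<open>VB u B\<close> to \<open>BV B' u\<close> keeps the inside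
    if \<open>u\<close> lies in just two blocks, so the extra 1 is what decreases; the step from
    \<open>BV B u\<close> to \<open>VB v B\<close> loses \<open>v\<close> from the inside, which the
    factor 2 makes outweigh that 1.\<close>
  define m where "m = (\<lambda>q. 2 * card (inn G q) + (case q of VB u B \<Rightarrow> 1 | BV B u \<Rightarrow> 0))"
  show ?thesis using p
  proof (induction "m p" arbitrary: p rule: less_induct)
    case less
    show ?case
    proof (cases p)
      case p: (BV B u)
      have B: "u \<in> cut_verts G" "B \<in> blocks G" "u \<in> B" using less.prems by (auto simp: p blocks_at_iff)
      have "P (VB v B)" if v: "v \<in> B \<inter> cut_verts G - {u}" for v
      proof (rule less.hyps)
        have "VB v B \<in> children p" using v by (simp add: p)
        then have sub: "inn G (VB v B) \<subseteq> inn G p" and prs: "VB v B \<in> pairs G"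
          using children_inn[OF less.prems] children_pairs[OF less.prems] by blast+
        have "v \<in> inn G p" using block_inn_BV[OF B(2,3)] v unfolding p by blast
        moreover have "v \<notin> inn G (VB v B)" using base_notin_inn[of "VB v B"] by simp
        ultimately have "card (inn G (VB v B)) < card (inn G p)"
          using sub finite_inn psubset_card_mono by blast
        then show "m (VB v B) < m p" unfolding m_def p by simp
        show "VB v B \<in> pairs G" by (rule prs)
      qed
      then show ?thesis unfolding p by (rule BV[OF B])
    next
      case p: (VB u B)
      have B: "u \<in> cut_verts G" "B \<in> blocks G" "u \<in> B" using less.prems by (auto simp: p blocks_at_iff)
      have "P (BV B' u)" if v: "B' \<in> blocks_at G u - {B}" for B'
      proof (rule less.hyps)
        have "BV B' u \<in> children p" using v by (simp add: p)
        then have sub: "inn G (BV B' u) \<subseteq> inn G p" and prs: "BV B' u \<in> pairs G"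
          using children_inn[OF less.prems] children_pairs[OF less.prems] by blast+
        have "card (inn G (BV B' u)) \<le> card (inn G p)" using sub finite_inn card_mono by blast
        then show "m (BV B' u) < m p" unfolding m_def p by simp
        show "BV B' u \<in> pairs G" by (rule prs)
      qed
      then show ?thesis unfolding p by (rule VB[OF B])
    qed
  qed
qed

definition desc :: "'a vbpair \<Rightarrow> 'a vbpair set" where
  "desc p = {q. (\<lambda>a b. b \<in> children a)\<^sup>*\<^sup>* p q}"

lemma desc_eq: "desc p = insert p (\<Union>q\<in>children p. desc q)"
proof (intro equalityI subsetI)
  fix x assume "x \<in> desc p"
  then have "(\<lambda>a b. b \<in> children a)\<^sup>*\<^sup>* p x" by (simp add: desc_def)
  then show "x \<in> insert p (\<Union>q\<in>children p. desc q)"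
    by (cases rule: converse_rtranclpE) (auto simp: desc_def)
next
  fix x assume "x \<in> insert p (\<Union>q\<in>children p. desc q)"
  then consider "x = p" | q where "q \<in> children p" "(\<lambda>a b. b \<in> children a)\<^sup>*\<^sup>* q x"
    by (auto simp: desc_def)
  then show "x \<in> desc p"
    by cases (auto simp: desc_def intro: converse_rtranclp_into_rtranclp[of _ p])
qed

lemma desc_BV: "desc (BV B u) = insert (BV B u) (\<Union>v\<in>B \<inter> cut_verts G - {u}. desc (VB v B))"
  using desc_eq[of "BV B u"] by auto

lemma desc_VB: "desc (VB u B) = insert (VB u B) (\<Union>B'\<in>blocks_at G u - {B}. desc (BV B' u))"
  using desc_eq[of "VB u B"] by auto

lemma desc_refl [simp]: "p \<in> desc p"
  by (simp add: desc_def)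

lemma desc_pairs_inn:
  assumes "q \<in> desc p" and p: "p \<in> pairs G"
  shows "q \<in> pairs G \<and> inn G q \<subseteq> inn G p"
proof -
  have "(\<lambda>a b. b \<in> children a)\<^sup>*\<^sup>* p q" using assms(1) by (simp add: desc_def)
  then show ?thesis
  proof (induction rule: rtranclp_induct)
    case base
    show ?case using p by simp
  next
    case (step a b)
    then show ?case using children_pairs[of a b] children_inn[of a b] by blast
  qed
qed

section \<open>Domains and closed equations of the partial functions\<close>

lemma depth_dom: "p \<in> pairs G \<Longrightarrow> depth_dom (G, p)"
proof (induction rule: pair_induct)
  case (BV B u)
  then show ?case using \<kappa>_eq[of B u] by (intro depth.domintros(1)) auto
next
  case (VB u B)
  then show ?case using \<beta>_eq[of u B] by (intro depth.domintros(2)) (auto simp: blocks_at_iff)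
qed

lemma ua_dom: "p \<in> pairs G \<Longrightarrow> ua_dom (G, p)"
proof (induction rule: pair_induct)
  case (BV B u)
  then show ?case using \<kappa>_eq[of B u] by (intro ua.domintros(1)) auto
next
  case (VB u B)
  then show ?case using \<beta>_eq[of u B] by (intro ua.domintros(2)) (auto simp: blocks_at_iff)
qed

lemma T_ua_dom: "p \<in> pairs G \<Longrightarrow> T_ua_dom (G, p)"
proof (induction rule: pair_induct)
  case (BV B u)
  then show ?case using \<kappa>_eq[of B u] by (intro T_ua.domintros(1)) auto
next
  case (VB u B)
  then show ?case using \<beta>_eq[of u B] by (intro T_ua.domintros(2)) (auto simp: blocks_at_iff)
qed

lemma cap_dom: "p \<in> pairs G \<Longrightarrow> cap_dom (G, p, C)"
proof (induction arbitrary: C rule: pair_induct)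
  case (BV B u)
  then show ?case using \<kappa>_eq[of B u] by (intro cap.domintros(1)) auto
next
  case (VB u B)
  then show ?case using \<beta>_eq[of u B] by (intro cap.domintros(2)) (auto simp: blocks_at_iff)
qed

text \<open>The case distinction on the depth merges into one formula: at depth 0 there is no
  cut-vertex in \<open>B\<close> other than \<open>u\<close>, but \<open>B\<close> has another
  vertex, so the equation for \<open>B\<close> fails.\<close>

lemma ua_BV:
  assumes "u \<in> cut_verts G" "B \<in> blocks G" "u \<in> B"
  shows "ua G (BV B u) \<longleftrightarrow>
    \<not> ((\<forall>v\<in>B \<inter> cut_verts G - {u}. ua G (VB v B)) \<and> B = B \<inter> cut_verts G - {u} \<union> {u})"
proof -
  have p: "BV B u \<in> pairs G" using assms by (auto simp: blocks_at_iff)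
  have d: "depth G (BV B u) = 0 \<longleftrightarrow> B \<inter> cut_verts G - {u} = {}"
    using depth.psimps(1)[OF depth_dom[OF p]] \<kappa>_eq[of B u] assms by simp
  have "B \<noteq> {u}" using block_other_cut[of u B] assms by (auto simp: blocks_at_iff)
  then show ?thesis using ua.psimps(1)[OF ua_dom[OF p]] d \<kappa>_eq[of B u] assms by auto
qed

lemma ua_VB:
  assumes "u \<in> cut_verts G" "B \<in> blocks G" "u \<in> B"
  shows "ua G (VB u B) \<longleftrightarrow> (\<exists>B'\<in>blocks_at G u - {B}. ua G (BV B' u))"
proof -
  have p: "VB u B \<in> pairs G" using assms by (auto simp: blocks_at_iff)
  show ?thesis using ua.psimps(2)[OF ua_dom[OF p]] \<beta>_eq[of u B] assms by (simp add: blocks_at_iff)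
qed

lemma verts_subg_pair: "p \<in> pairs G \<Longrightarrow> verts (subg G p) = insert (base p) (inn G p)"
proof (cases p)
  case (BV B u)
  assume "p \<in> pairs G"
  then show ?thesis using verts_subg[of B u p] by (simp add: BV blocks_at_iff del: subg.simps inn.simps)
next
  case (VB u B)
  assume "p \<in> pairs G"
  then show ?thesis using verts_subg[of B u p] by (simp add: VB blocks_at_iff del: subg.simps inn.simps)
qed

text \<open>Capacity read off a configuration of the whole graph; \<open>restr_restr\<close> removes
  the nested restrictions from its recursion.\<close>

definition cp :: "'a set \<Rightarrow> 'a vbpair \<Rightarrow> int" where
  "cp C p = cap G p (restr G C p)"

lemma restr_restr:
  assumes p: "p \<in> pairs G" and q: "q \<in> children p"
  shows "restr G (restr G C p) q = restr G C q"
proof -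
  have "base q \<in> insert (base p) (inn G p)"
  proof (cases p)
    case (BV B u)
    then show ?thesis using block_inn_BV[of B u] p q by (auto simp: blocks_at_iff simp del: inn.simps)
  next
    case (VB u B)
    then show ?thesis using q by auto
  qed
  then show ?thesis
    using children_inn[OF p q] verts_subg_pair[OF p] verts_subg_pair[OF children_pairs[OF p q]]
    by (auto simp: restr_def simp del: inn.simps)
qed

lemma cp_BV:
  assumes "u \<in> cut_verts G" "B \<in> blocks G" "u \<in> B"
  shows "cp C (BV B u) = (\<Sum>v\<in>B \<inter> cut_verts G - {u}. cp C (VB v B)) + of_bool (ua G (BV B u))
    - int (card (B \<inter> C - {u}))"
proof -
  have p: "BV B u \<in> pairs G" using assms by (auto simp: blocks_at_iff)
  have r: "restr G (restr G C (BV B u)) (VB v B) = restr G C (VB v B)"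
    if "v \<in> B \<inter> cut_verts G - {u}" for v
    by (rule restr_restr[OF p]) (use that in auto)
  have "B \<inter> off_base (restr G C (BV B u)) (BV B u) = B \<inter> C - {u}"
    using verts_subg_pair[OF p] block_inn_BV[OF assms(2,3)]
    by (auto simp: off_base_def restr_def simp del: inn.simps subg.simps)
  then show ?thesis
    unfolding cp_def cap.psimps(1)[OF cap_dom[OF p]] \<kappa>_eq[OF assms(2,3)] using r by simp
qed

lemma cp_VB:
  assumes "u \<in> cut_verts G" "B \<in> blocks G" "u \<in> B"
  shows "cp C (VB u B) =
    (if \<exists>B'\<in>blocks_at G u - {B}. cp C (BV B' u) = 0 \<and> ua G (BV B' u) then 0
     else (\<Sum>B'\<in>blocks_at G u - {B}. cp C (BV B' u) - of_bool (ua G (BV B' u))) + of_bool (ua G (VB u B)))"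
proof -
  have p: "VB u B \<in> pairs G" using assms by (auto simp: blocks_at_iff)
  have r: "restr G (restr G C (VB u B)) (BV B' u) = restr G C (BV B' u)"
    if "B' \<in> blocks_at G u - {B}" for B'
    by (rule restr_restr[OF p]) (use that in auto)
  have b: "\<beta> G u B = blocks_at G u - {B}" using \<beta>_eq[of u B] assms by (simp add: blocks_at_iff)
  show ?thesis
    unfolding cp_def cap.psimps(2)[OF cap_dom[OF p]] b by (simp only: r cong: sum.cong bex_cong)
qed

text \<open>A token on the base of \<open>p\<close> never enters the recursion, so the inside
  determines the capacity.\<close>

lemma cp_local: "p \<in> pairs G \<Longrightarrow> C \<inter> inn G p = D \<inter> inn G p \<Longrightarrow> cp C p = cp D p"
proof (induction rule: pair_induct)
  case (BV B u)
  have p: "BV B u \<in> pairs G" using BV by (auto simp: blocks_at_iff)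
  have "cp C (VB v B) = cp D (VB v B)" if v: "v \<in> B \<inter> cut_verts G - {u}" for v
  proof (rule BV.IH[OF v])
    have "inn G (VB v B) \<subseteq> inn G (BV B u)" by (rule children_inn[OF p]) (use v in auto)
    then show "C \<inter> inn G (VB v B) = D \<inter> inn G (VB v B)" using BV.prems by blast
  qed
  moreover have "B \<inter> C - {u} = B \<inter> D - {u}"
    using block_inn_BV[OF BV.hyps(2,3)] BV.prems by blast
  ultimately show ?case using cp_BV[OF BV.hyps] by simp
next
  case (VB u B)
  have p: "VB u B \<in> pairs G" using VB by (auto simp: blocks_at_iff)
  have e: "cp C (BV B' u) = cp D (BV B' u)" if v: "B' \<in> blocks_at G u - {B}" for B'
  proof (rule VB.IH[OF v])
    have "inn G (BV B' u) \<subseteq> inn G (VB u B)" by (rule children_inn[OF p]) (use v in auto)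
    then show "C \<inter> inn G (BV B' u) = D \<inter> inn G (BV B' u)" using VB.prems by blast
  qed
  show ?case unfolding cp_VB[OF VB.hyps] by (simp only: e cong: sum.cong bex_cong)
qed

section \<open>Token counts and totals\<close>

definition nt :: "'a set \<Rightarrow> 'a vbpair \<Rightarrow> int" where
  "nt C p = int (card (C \<inter> inn G p))"

definition tot :: "'a set \<Rightarrow> 'a vbpair \<Rightarrow> int" where
  "tot C p = cp C p + nt C p"

text \<open>A stuck block could in principle free its base (\<open>ua\<close>), but its tokens have
  used up the capacity for that. Such a block keeps a token next to the base
  (\<open>stuck_token\<close>).\<close>

definition stuck :: "'a set \<Rightarrow> 'a vbpair \<Rightarrow> bool" where
  "stuck C p \<longleftrightarrow> cp C p = 0 \<and> ua G p"

lemma nt_local: "C \<inter> inn G p = D \<inter> inn G p \<Longrightarrow> nt C p = nt D p"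
  by (simp add: nt_def)

lemma tot_local: "p \<in> pairs G \<Longrightarrow> C \<inter> inn G p = D \<inter> inn G p \<Longrightarrow> tot C p = tot D p"
  unfolding tot_def using cp_local[of p C D] nt_local[of C p D] by simp

lemma tot_local_desc:
  assumes "p \<in> pairs G" "C \<inter> inn G p = D \<inter> inn G p" "q \<in> desc p"
  shows "tot C q = tot D q"
  using desc_pairs_inn[OF assms(3,1)] assms(2) by (intro tot_local) auto

lemma nt_BV:
  assumes B: "B \<in> blocks G" "u \<in> B"
  shows "nt C (BV B u) = int (card (B \<inter> C - {u})) + (\<Sum>v\<in>B \<inter> cut_verts G - {u}. nt C (VB v B))"
proof -
  let ?K = "B \<inter> cut_verts G - {u}"
  have fB: "finite B" using finite_block B by blast
  have eq: "C \<inter> inn G (BV B u) = (B \<inter> C - {u}) \<union> (\<Union>v\<in>?K. C \<inter> inn G (VB v B))"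
    unfolding inn_BV_eq[OF B] by blast
  have "card (\<Union>v\<in>?K. C \<inter> inn G (VB v B)) = (\<Sum>v\<in>?K. card (C \<inter> inn G (VB v B)))"
  proof (rule card_UN_disjoint)
    show "finite ?K" using fB by simp
    show "\<forall>v\<in>?K. finite (C \<inter> inn G (VB v B))" using finite_inn by blast
    show "\<forall>v\<in>?K. \<forall>w\<in>?K. v \<noteq> w \<longrightarrow> C \<inter> inn G (VB v B) \<inter> (C \<inter> inn G (VB w B)) = {}"
      using inn_VB_disjoint[OF B(1)] by blast
  qed
  moreover have "card (C \<inter> inn G (BV B u)) = card (B \<inter> C - {u}) + card (\<Union>v\<in>?K. C \<inter> inn G (VB v B))"
    unfolding eq
  proof (rule card_Un_disjoint)
    show "finite (B \<inter> C - {u})" using fB by simp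
    show "finite (\<Union>v\<in>?K. C \<inter> inn G (VB v B))" using fB finite_inn by blast
    show "(B \<inter> C - {u}) \<inter> (\<Union>v\<in>?K. C \<inter> inn G (VB v B)) = {}"
      using inn_VB_block[OF B(1)] by blast
  qed
  ultimately show ?thesis by (simp add: nt_def)
qed

lemma nt_blocks:
  assumes Q: "Q \<subseteq> blocks_at G u"
  shows "int (card (C \<inter> (\<Union>B'\<in>Q. inn G (BV B' u)))) = (\<Sum>B'\<in>Q. nt C (BV B' u))"
proof -
  have "card (\<Union>B'\<in>Q. C \<inter> inn G (BV B' u)) = (\<Sum>B'\<in>Q. card (C \<inter> inn G (BV B' u)))"
  proof (rule card_UN_disjoint)
    show "finite Q" using Q finite_blocks_at finite_subset by blast
    show "\<forall>v\<in>Q. finite (C \<inter> inn G (BV v u))" using finite_inn by blast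
    show "\<forall>v\<in>Q. \<forall>w\<in>Q. v \<noteq> w \<longrightarrow> C \<inter> inn G (BV v u) \<inter> (C \<inter> inn G (BV w u)) = {}"
      using inn_BV_disjoint Q by blast
  qed
  moreover have "C \<inter> (\<Union>B'\<in>Q. inn G (BV B' u)) = (\<Union>B'\<in>Q. C \<inter> inn G (BV B' u))" by blast
  ultimately show ?thesis by (simp add: nt_def)
qed

lemma nt_VB:
  assumes B: "B \<in> blocks G" "u \<in> B"
  shows "nt C (VB u B) = (\<Sum>B'\<in>blocks_at G u - {B}. nt C (BV B' u))"
  using nt_blocks[of "blocks_at G u - {B}" u C] inn_VB_eq[OF B] by (simp add: nt_def)

text \<open>Each token on \<open>B\<close> off \<open>u\<close> lowers the capacity and raises the
  count by one. Since these cancel, a move within \<open>B\<close> does not change the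
  total.\<close>

lemma tot_BV:
  assumes "u \<in> cut_verts G" "B \<in> blocks G" "u \<in> B"
  shows "tot C (BV B u) = (\<Sum>v\<in>B \<inter> cut_verts G - {u}. tot C (VB v B)) + of_bool (ua G (BV B u))"
  unfolding tot_def using cp_BV[OF assms] nt_BV[OF assms(2,3)] by (simp add: sum.distrib)

lemma tot_VB_stuck:
  assumes "u \<in> cut_verts G" "B \<in> blocks G" "u \<in> B" 
    and "B' \<in> blocks_at G u - {B}" "stuck C (BV B' u)"
  shows "tot C (VB u B) = nt C (VB u B)"
  unfolding tot_def using cp_VB[OF assms(1-3), of C] assms(4,5) by (auto simp: stuck_def)

lemma tot_VB_free:
  assumes "u \<in> cut_verts G" "B \<in> blocks G" "u \<in> B" 
    and "\<And>B'. B' \<in> blocks_at G u - {B} \<Longrightarrow> \<not> stuck C (BV B' u)"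
  shows "tot C (VB u B) = (\<Sum>B'\<in>blocks_at G u - {B}. tot C (BV B' u) - of_bool (ua G (BV B' u)))
    + of_bool (ua G (VB u B))"
proof -
  have "\<not> (\<exists>B'\<in>blocks_at G u - {B}. cp C (BV B' u) = 0 \<and> ua G (BV B' u))"
    using assms(4) by (auto simp: stuck_def)
  then have "cp C (VB u B) = (\<Sum>B'\<in>blocks_at G u - {B}. cp C (BV B' u) - of_bool (ua G (BV B' u)))
    + of_bool (ua G (VB u B))"
    unfolding cp_VB[OF assms(1-3), of C] by (simp only: if_False)
  then show ?thesis
    unfolding tot_def nt_VB[OF assms(2,3), of C] by (simp add: sum.distrib sum_subtractf)
qed

section \<open>Moving tokens\<close>

lemma card_block_indep:
  assumes "B \<in> blocks G" "indep_set G C" "x \<in> B" "x \<in> C" 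
  shows "B \<inter> C = {x}"
proof -
  have "y = x" if "y \<in> B" "y \<in> C" for y
    using block_clique[OF assms(1,3) that(1)] assms that by (auto simp: indep_set_def)
  then show ?thesis using assms by blast
qed

text \<open>Both claims go through one induction because availability at the vertex of
  \<open>B\<close> that carries a token is what pays for this token in the nonnegativity
  claim.\<close>

lemma cp_nonneg_avail:
  "p \<in> pairs G \<Longrightarrow> indep_set G C \<Longrightarrow>
    0 \<le> cp C p \<and> ((\<forall>x\<in>C \<inter> inn G p. \<not> adj G (base p) x) \<longrightarrow> of_bool (ua G p) \<le> cp C p)"
proof (induction rule: pair_induct)
  case (BV B u)
  let ?K = "B \<inter> cut_verts G - {u}"
  have fK: "finite ?K" using finite_block BV by blast
  have IH: "0 \<le> cp C (VB v B)" if "v \<in> ?K" for v using BV.IH[OF that] BV.prems by blast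
  then have s0: "0 \<le> (\<Sum>v\<in>?K. cp C (VB v B))" by (rule sum_nonneg)
  note eq = cp_BV[OF BV.hyps, of C]
  show ?case
  proof (cases "B \<inter> C - {u} = {}")
    case True
    then have "cp C (BV B u) = (\<Sum>v\<in>?K. cp C (VB v B)) + of_bool (ua G (BV B u))"
      unfolding eq True by simp
    then show ?thesis using s0 by simp
  next
    case False
    then obtain x where x: "x \<in> B" "x \<in> C" "x \<noteq> u" by blast
    then have Bx: "B \<inter> C - {u} = {x}" using card_block_indep[OF BV.hyps(2) BV.prems x(1,2)] by auto
    then have eq': "cp C (BV B u) = (\<Sum>v\<in>?K. cp C (VB v B)) + of_bool (ua G (BV B u)) - 1"
      using eq by simp
    \<comment> \<open>Without \<open>ua\<close>, all of \<open>B\<close> except \<open>u\<close>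
      consists of cut-vertices with \<open>ua\<close>. As \<open>x\<close> is occupied, no token
      behind \<open>x\<close> is next to it, so the branch at \<open>x\<close> has capacity at least
      1 to pay for the token.\<close>
    have "1 \<le> (\<Sum>v\<in>?K. cp C (VB v B))" if nua: "\<not> ua G (BV B u)"
    proof -
      have K: "\<forall>v\<in>?K. ua G (VB v B)" "B = ?K \<union> {u}" using ua_BV[OF BV.hyps] nua by blast+
      then have xK: "x \<in> ?K" using x by blast
      have "\<forall>y\<in>C \<inter> inn G (VB x B). \<not> adj G (base (VB x B)) y"
        using BV.prems x by (auto simp: indep_set_def simp del: inn.simps)
      then have "1 \<le> cp C (VB x B)" using BV.IH[OF xK] BV.prems K(1) xK by auto
      also have "\<dots> \<le> (\<Sum>v\<in>?K. cp C (VB v B))"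
        by (rule member_le_sum) (use xK IH fK in auto)
      finally show ?thesis .
    qed
    then have "0 \<le> cp C (BV B u)" using eq' s0 by (cases "ua G (BV B u)") auto
    moreover have "x \<in> C \<inter> inn G (BV B u)" "adj G u x"
      using x block_inn_BV[OF BV.hyps(2,3)] block_clique[OF BV.hyps(2,3) x(1)] by blast+
    ultimately show ?thesis by auto
  qed
next
  case (VB u B)
  let ?S = "blocks_at G u - {B}"
  have c: "of_bool (ua G (BV B' u)) \<le> cp C (BV B' u)"
    if "\<not> stuck C (BV B' u)" "B' \<in> ?S" for B'
    using VB.IH[OF that(2)] VB.prems that(1) by (auto simp: stuck_def)
  have fr: "of_bool (ua G (VB u B)) \<le> cp C (VB u B)" if "\<And>B'. B' \<in> ?S \<Longrightarrow> \<not> stuck C (BV B' u)"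
  proof -
    have "cp C (VB u B) = (\<Sum>B'\<in>?S. cp C (BV B' u) - of_bool (ua G (BV B' u))) + of_bool (ua G (VB u B))"
      using cp_VB[OF VB.hyps, of C] that by (auto simp: stuck_def)
    moreover have "0 \<le> (\<Sum>B'\<in>?S. cp C (BV B' u) - of_bool (ua G (BV B' u)))"
      by (rule sum_nonneg) (use c that in simp)
    ultimately show ?thesis by simp
  qed
  have "0 \<le> cp C (VB u B)"
  proof (cases "\<exists>B'\<in>?S. stuck C (BV B' u)")
    case True
    then show ?thesis using cp_VB[OF VB.hyps, of C] by (auto simp: stuck_def)
  next
    case False
    then have "of_bool (ua G (VB u B)) \<le> cp C (VB u B)" using fr by blast
    moreover have "(0::int) \<le> of_bool (ua G (VB u B))" by simp
    ultimately show ?thesis by (rule order_trans[rotated])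
  qed
  moreover have "of_bool (ua G (VB u B)) \<le> cp C (VB u B)" if a: "\<forall>x\<in>C \<inter> inn G (VB u B). \<not> adj G u x"
  proof (rule fr)
    fix B' assume B': "B' \<in> ?S"
    then have "inn G (BV B' u) \<subseteq> inn G (VB u B)" using inn_VB_eq[OF VB.hyps(2,3)] by blast
    then have "of_bool (ua G (BV B' u)) \<le> cp C (BV B' u)"
      using VB.IH[OF B' VB.prems] a by auto
    then show "\<not> stuck C (BV B' u)" by (auto simp: stuck_def)
  qed
  ultimately show ?case by simp
qed

lemma cp_nonneg: "p \<in> pairs G \<Longrightarrow> indep_set G C \<Longrightarrow> 0 \<le> cp C p"
  using cp_nonneg_avail by blast

lemma cp_avail: "p \<in> pairs G \<Longrightarrow> indep_set G C \<Longrightarrow> (\<And>x. x \<in> C \<Longrightarrow> x \<in> inn G p \<Longrightarrow> \<not> adj G (base p) x) \<Longrightarrow>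
   of_bool (ua G p) \<le> cp C p"
  using cp_nonneg_avail by blast

lemma not_stuck_iff: "p \<in> pairs G \<Longrightarrow> indep_set G C \<Longrightarrow> \<not> stuck C p \<longleftrightarrow> of_bool (ua G p) \<le> cp C p"
  using cp_nonneg[of p C] by (auto simp: stuck_def)

lemma base_not_stuck:
  assumes "p \<in> pairs G" "indep_set G C" "base p \<in> C"
  shows "\<not> stuck C p"
  unfolding not_stuck_iff[OF assms(1,2)]
  by (rule cp_avail[OF assms(1,2)]) (use assms in \<open>auto simp: indep_set_def\<close>)

lemma indep_finite: "indep_set G C \<Longrightarrow> finite C"
  using finV finite_subset by (auto simp: indep_set_def)

section \<open>Slides and reachability\<close>

lemma slide_move:
  assumes D: "indep_set G D" and a: "a \<in> D" "adj G a b" and b: "\<And>x. x \<in> D \<Longrightarrow> adj G b x \<Longrightarrow> x = a"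
  shows "slide G D (insert b (D - {a}))" "indep_set G (insert b (D - {a}))"
proof -
  have ne: "a \<noteq> b" "b \<in> verts G" using adj_verts[OF sG a(2)] by auto
  have bD: "b \<notin> D" using D a by (auto simp: indep_set_def)
  show i: "indep_set G (insert b (D - {a}))"
  proof -
    have n1: "\<not> adj G b x" if "x \<in> D - {a}" for x using b that by blast
    have n2: "\<not> adj G x b" if "x \<in> D - {a}" for x using n1[OF that] adj_sym[of G x b] by simp
    have "\<not> adj G b b" using adj_verts[OF sG, of b b] by blast
    then show ?thesis using D ne(2) n1 n2 unfolding indep_set_def by blast
  qed
  have "D - insert b (D - {a}) = {a}" using a(1) ne(1) by blast
  moreover have "insert b (D - {a}) - D = {b}" using bD by blast
  ultimately show "slide G D (insert b (D - {a}))" using D i a(2) unfolding slide_def by blast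
qed

lemma slide_cases:
  assumes "slide G D E"
  obtains "E = D" | a b where "a \<in> D" "b \<notin> D" "adj G a b" "E = insert b (D - {a})"
proof -
  consider "D = E" | a b where "D - E = {a}" "E - D = {b}" "adj G a b"
    using assms by (auto simp: slide_def)
  then show ?thesis
  proof cases
    case 2
    then have "a \<in> D" "b \<notin> D" "E = insert b (D - {a})" by auto
    then show ?thesis using that(2) 2(3) by blast
  qed (use that(1) in blast)
qed

lemma slide_sym: "slide G D E \<Longrightarrow> slide G E D"
  by (auto simp: slide_def adj_sym)

lemma slide_card:
  assumes "slide G D E"
  shows "card E = card D"
  using assms
proof (cases rule: slide_cases)
  case (2 a b)
  have "finite D" using assms indep_finite by (auto simp: slide_def)
  moreover from this have "card D > 0" using 2 by (auto simp: card_gt_0_iff)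
  ultimately show ?thesis using 2 by simp
qed simp

lemma reachable_refl [simp]: "reachable G D D"
  by (simp add: reachable_def)

lemma reachable_trans: "reachable G C D \<Longrightarrow> reachable G D E \<Longrightarrow> reachable G C E"
  by (simp add: reachable_def)

lemma reachable_slide: "slide G D E \<Longrightarrow> reachable G D E"
  by (auto simp: reachable_def)

lemma reachable_sym: "reachable G D E \<Longrightarrow> reachable G E D"
  using sympD[OF symp_rtranclp[of "slide G"], of D E] slide_sym
  by (auto simp: symp_def reachable_def)

lemma reachable_indep: "reachable G D E \<Longrightarrow> indep_set G D \<Longrightarrow> indep_set G E"
  unfolding reachable_def by (induction rule: rtranclp_induct) (auto simp: slide_def)

lemma reachable_card: "reachable G D E \<Longrightarrow> card E = card D"
  unfolding reachable_def by (induction rule: rtranclp_induct) (auto simp: slide_card)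

text \<open>Slides preserve the number of tokens, so equal parts outside mean equal counts
  inside.\<close>

lemma nt_outside:
  assumes r: "card E = card D" and fin: "finite D" "finite E" and out: "E - inn G p = D - inn G p"
  shows "nt E p = nt D p"
proof -
  have "card E = card (E \<inter> inn G p) + card (E - inn G p)" "card D = card (D \<inter> inn G p) + card (D - inn G p)"
    using fin by (simp_all add: card_Int_Diff)
  then show ?thesis using r out by (simp add: nt_def)
qed

lemma nt_outside_minus:
  assumes r: "card E = card D" and fin: "finite D" "finite E"
    and out: "E - inn G p = D - inn G p - {x}" and x: "x \<in> D" "x \<notin> inn G p"
  shows "nt E p = nt D p + 1"
proof -
  have "card E = card (E \<inter> inn G p) + card (E - inn G p)" "card D = card (D \<inter> inn G p) + card (D - inn G p)"
    using fin by (simp_all add: card_Int_Diff)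
  moreover have "card (D - inn G p) = Suc (card (E - inn G p))"
    unfolding out using card_Suc_Diff1[of "D - inn G p" x] x fin by simp
  ultimately show ?thesis using r by (simp add: nt_def)
qed

section \<open>Freeing the base and pushing a token inside\<close>

definition keeps :: "'a set \<Rightarrow> 'a set \<Rightarrow> 'a vbpair \<Rightarrow> bool" where
  "keeps D E p \<longleftrightarrow> (\<forall>q\<in>desc p. tot E q = tot D q)"

text \<open>For an independent set the premise says that \<open>p\<close> is not stuck
  (\<open>not_stuck_iff\<close>). The tokens outside stay where they are, so that branches can be
  treated one after the other.\<close>

definition availp :: "'a vbpair \<Rightarrow> bool" where
  "availp p \<longleftrightarrow> (\<forall>D. indep_set G D \<and> of_bool (ua G p) \<le> cp D p \<longrightarrow>
     (\<exists>E. reachable G D E \<and> E - inn G p = D - inn G p \<and> keeps D E p \<and>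
        (\<forall>x\<in>E \<inter> inn G p. \<not> adj G (base p) x)))"

definition pushp :: "'a vbpair \<Rightarrow> bool" where
  "pushp p \<longleftrightarrow> (\<forall>D. indep_set G D \<and> base p \<in> D \<and> 1 \<le> cp D p \<longrightarrow>
     (\<exists>E. reachable G D E \<and> E - inn G p = D - inn G p - {base p} \<and> keeps D E p))"

lemma keeps_refl [simp]: "keeps D D p"
  by (simp add: keeps_def)

lemma keeps_trans: "keeps C D p \<Longrightarrow> keeps D E p \<Longrightarrow> keeps C E p"
  by (simp add: keeps_def)

lemma keeps_local: "p \<in> pairs G \<Longrightarrow> D \<inter> inn G p = E \<inter> inn G p \<Longrightarrow> keeps D E p"
  unfolding keeps_def using tot_local_desc by metis

lemma keepsD: "keeps D E p \<Longrightarrow> tot E p = tot D p"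
  by (simp add: keeps_def)

lemma keeps_BV:
  assumes "u \<in> cut_verts G" "B \<in> blocks G" "u \<in> B"
    and "\<And>v. v \<in> B \<inter> cut_verts G - {u} \<Longrightarrow> keeps D E (VB v B)"
  shows "keeps D E (BV B u)"
proof -
  have "tot E (BV B u) = tot D (BV B u)"
    unfolding tot_BV[OF assms(1-3)] using keepsD[OF assms(4)] by simp
  then show ?thesis using assms(4) unfolding keeps_def desc_BV by blast
qed

lemma keeps_VB:
  assumes "\<And>B'. B' \<in> blocks_at G u - {B} \<Longrightarrow> keeps D E (BV B' u)" "tot E (VB u B) = tot D (VB u B)"
  shows "keeps D E (VB u B)"
  using assms unfolding keeps_def desc_VB by blast

text \<open>Distinct blocks at \<open>u\<close> have disjoint insides, so freeing \<open>u\<close>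
  in one block does not disturb the others. Preserved counts are recorded so that capacities, not
  only totals, survive.\<close>

lemma avail_blocks:
  assumes Q: "Q \<subseteq> blocks_at G u" and u: "u \<in> cut_verts G"
    and av: "\<And>B'. B' \<in> Q \<Longrightarrow> availp (BV B' u)"
    and D: "indep_set G D" "\<And>B'. B' \<in> Q \<Longrightarrow> \<not> stuck D (BV B' u)"
  obtains E where "reachable G D E" "E - (\<Union>B'\<in>Q. inn G (BV B' u)) = D - (\<Union>B'\<in>Q. inn G (BV B' u))"
    "\<And>B'. B' \<in> Q \<Longrightarrow> keeps D E (BV B' u)" "\<And>B'. B' \<in> Q \<Longrightarrow> nt E (BV B' u) = nt D (BV B' u)"
    "\<And>B' x. B' \<in> Q \<Longrightarrow> x \<in> E \<Longrightarrow> x \<in> inn G (BV B' u) \<Longrightarrow> \<not> adj G u x"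
proof -
  have fQ: "finite Q" using Q finite_blocks_at finite_subset by blast
  have "\<exists>E. reachable G D E \<and> E - (\<Union>B'\<in>Q. inn G (BV B' u)) = D - (\<Union>B'\<in>Q. inn G (BV B' u)) \<and>
     (\<forall>B'\<in>Q. keeps D E (BV B' u) \<and> nt E (BV B' u) = nt D (BV B' u) \<and>
       (\<forall>x\<in>E \<inter> inn G (BV B' u). \<not> adj G u x))"
    using fQ Q av D(2)
  proof (induction Q rule: finite_induct)
    case empty
    show ?case by (intro exI[of _ D]) simp
  next
    case (insert B Q)
    let ?U = "\<Union>B'\<in>Q. inn G (BV B' u)"
    have "\<exists>E. reachable G D E \<and> E - ?U = D - ?U \<and>
     (\<forall>B'\<in>Q. keeps D E (BV B' u) \<and> nt E (BV B' u) = nt D (BV B' u) \<and>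
       (\<forall>x\<in>E \<inter> inn G (BV B' u). \<not> adj G u x))"
      by (rule insert.IH) (use insert.prems in blast)+
    then obtain E where E: "reachable G D E" "E - ?U = D - ?U"
      and EQ: "\<forall>B'\<in>Q. keeps D E (BV B' u) \<and> nt E (BV B' u) = nt D (BV B' u) \<and>
       (\<forall>x\<in>E \<inter> inn G (BV B' u). \<not> adj G u x)" by blast
    have dj: "inn G (BV B u) \<inter> inn G (BV B' u) = {}" if "B' \<in> Q" for B'
      by (rule inn_BV_disjoint) (use insert that in auto)
    have p: "BV B u \<in> pairs G" using insert.prems u by simp
    have loc: "E \<inter> inn G (BV B u) = D \<inter> inn G (BV B u)" using E(2) dj by blast
    have iE: "indep_set G E" using reachable_indep[OF E(1) D(1)] .
    have "of_bool (ua G (BV B u)) \<le> cp D (BV B u)"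
      using insert.prems(3)[of B] not_stuck_iff[OF p D(1)] by simp
    then have "of_bool (ua G (BV B u)) \<le> cp E (BV B u)" using cp_local[OF p loc] by simp
    then obtain F where F: "reachable G E F" "F - inn G (BV B u) = E - inn G (BV B u)"
      "keeps E F (BV B u)" "\<forall>x\<in>F \<inter> inn G (BV B u). \<not> adj G u x"
      using insert.prems(2)[of B] iE by (auto simp: availp_def simp del: inn.simps)
    have fin: "finite E" "finite F" using iE reachable_indep[OF F(1) iE] indep_finite by blast+
    have "nt F (BV B u) = nt E (BV B u)" 
      by (rule nt_outside[OF reachable_card[OF F(1)] fin F(2)])
    then have ntB: "nt F (BV B u) = nt D (BV B u)" using nt_local[OF loc] by simp
    have kB: "keeps D F (BV B u)" using keeps_trans[OF keeps_local[OF p loc[symmetric]] F(3)] .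
    have locQ: "F \<inter> inn G (BV B' u) = E \<inter> inn G (BV B' u)" if "B' \<in> Q" for B'
      using F(2) dj[OF that] by blast
    have kQ: "keeps D F (BV B' u) \<and> nt F (BV B' u) = nt D (BV B' u) \<and>
       (\<forall>x\<in>F \<inter> inn G (BV B' u). \<not> adj G u x)" if B': "B' \<in> Q" for B'
    proof -
      have p': "BV B' u \<in> pairs G" using insert.prems u B' by auto
      have "keeps E F (BV B' u)" by (rule keeps_local[OF p' locQ[OF B', symmetric]])
      then show ?thesis using EQ B' keeps_trans nt_local[OF locQ[OF B']] locQ[OF B'] by auto
    qed
    have "F - (\<Union>B'\<in>insert B Q. inn G (BV B' u)) = D - (\<Union>B'\<in>insert B Q. inn G (BV B' u))"
      using F(2) E(2) by blast
    then show ?case using reachable_trans[OF E(1) F(1)] kB ntB F(4) kQ by blast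
  qed
  then obtain E where "reachable G D E" "E - (\<Union>B'\<in>Q. inn G (BV B' u)) = D - (\<Union>B'\<in>Q. inn G (BV B' u))"
    "\<forall>B'\<in>Q. keeps D E (BV B' u) \<and> nt E (BV B' u) = nt D (BV B' u) \<and>
       (\<forall>x\<in>E \<inter> inn G (BV B' u). \<not> adj G u x)" by blast
  then show ?thesis by (intro that[of E]) blast+
qed

lemma block_nbr: "adj G v y \<Longrightarrow> y \<notin> B \<Longrightarrow> y \<in> inn G (VB v B)"
  using attached_nbr[OF sG, of v y "\<lambda>b. b \<notin> B"] by simp

lemma inn_adj: "adj G x y \<Longrightarrow> y \<noteq> base p \<Longrightarrow> x \<in> inn G p \<Longrightarrow> y \<in> inn G p"
  using attached_adj by (cases p) auto

text \<open>Once the branch behind \<open>v\<close> keeps no token next to \<open>v\<close>, the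
  token on \<open>x\<close> is the only one adjacent to \<open>v\<close>, as \<open>B\<close> is a
  clique, and may slide to \<open>v\<close>.\<close>

lemma slide_into:
  assumes B: "B \<in> blocks G" "v \<in> B" and vc: "v \<in> cut_verts G"
    and a: "availp (VB v B)" and D: "indep_set G D" "of_bool (ua G (VB v B)) \<le> cp D (VB v B)"
    and x: "x \<in> B" "x \<in> D" "x \<noteq> v"
  obtains E where "reachable G D E" "E - inn G (VB v B) = insert v (D - inn G (VB v B) - {x})"
    "keeps D E (VB v B)" "nt E (VB v B) = nt D (VB v B)"
proof -
  let ?I = "inn G (VB v B)"
  have p: "VB v B \<in> pairs G" using B vc by (simp add: blocks_at_iff)
  obtain D1 where D1: "reachable G D D1" "D1 - ?I = D - ?I" "keeps D D1 (VB v B)"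
    "\<forall>y\<in>D1 \<inter> ?I. \<not> adj G v y"
    using a D unfolding availp_def by auto
  have iD1: "indep_set G D1" using reachable_indep[OF D1(1) D(1)] .
  have xI: "x \<notin> ?I" using inn_VB_block[OF B] x by blast
  have vI: "v \<notin> ?I" using inn_VB_block[OF B] B by blast
  have xD1: "x \<in> D1" using D1(2) x xI by blast
  have Bx: "B \<inter> D1 = {x}" by (rule card_block_indep[OF B(1) iD1 x(1) xD1])
  have xv: "adj G x v" using block_clique[OF B(1) x(1) B(2) x(3)] .
  have nb: "y = x" if "y \<in> D1" "adj G v y" for y
    using that D1(4) block_nbr[OF that(2), of B] Bx by blast
  let ?E = "insert v (D1 - {x})"
  have E: "slide G D1 ?E" using slide_move(1)[OF iD1 xD1 xv nb] .
  have loc: "?E \<inter> ?I = D1 \<inter> ?I" using xI vI by blast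
  have "finite D" "finite D1" using indep_finite D iD1 by blast+
  then have "nt D1 (VB v B) = nt D (VB v B)" 
    using nt_outside[OF reachable_card[OF D1(1)] _ _ D1(2)] by blast
  then have "nt ?E (VB v B) = nt D (VB v B)" using nt_local[OF loc] by simp
  moreover have "keeps D ?E (VB v B)"
    using keeps_trans[OF D1(3) keeps_local[OF p loc[symmetric]]] .
  moreover have "?E - ?I = insert v (D - ?I - {x})" using D1(2) vI by blast
  moreover have "reachable G D ?E" using reachable_trans[OF D1(1) reachable_slide[OF E]] .
  ultimately show ?thesis using that[of ?E] by simp
qed

text \<open>Every branch other than that behind \<open>v\<close> is untouched, and tokens on
  \<open>B\<close> do not affect the total of \<open>BV B u\<close>.\<close>

lemma keeps_BV_except:
  assumes u: "u \<in> cut_verts G" "B \<in> blocks G" "u \<in> B" and v: "v \<in> B" 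
    and k: "v \<in> cut_verts G \<Longrightarrow> v \<noteq> u \<Longrightarrow> keeps D E (VB v B)"
    and out: "E - inn G (VB v B) - B = D - inn G (VB v B) - B"
  shows "keeps D E (BV B u)"
proof (rule keeps_BV[OF u])
  fix w assume w: "w \<in> B \<inter> cut_verts G - {u}"
  show "keeps D E (VB w B)"
  proof (cases "w = v")
    case False
    have "inn G (VB w B) \<inter> inn G (VB v B) = {}" using inn_VB_disjoint[of B w v] u v w False by blast
    moreover have "inn G (VB w B) \<inter> B = {}" using inn_VB_block[of B w] u w by blast
    ultimately have "D \<inter> inn G (VB w B) = E \<inter> inn G (VB w B)" using out by blast
    moreover have "VB w B \<in> pairs G" using w u by (simp add: blocks_at_iff)
    ultimately show ?thesis using keeps_local by blast
  qed (use k w in blast)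
qed

text \<open>The two properties rely on each other: freeing \<open>u\<close> in a block means pushing
  a token of the block into a branch, and pushing into a block means freeing a vertex of it to
  receive the token.\<close>

lemma avail_push: "p \<in> pairs G \<Longrightarrow> availp p \<and> pushp p"
proof (induction rule: pair_induct)
  case (BV B u)
  note h = BV.hyps
  let ?K = "B \<inter> cut_verts G - {u}"
  let ?I = "inn G (BV B u)"
  have av: "availp (VB v B)" and pu: "pushp (VB v B)" if "v \<in> ?K" for v using BV.IH[OF that] by auto
  have pv: "VB v B \<in> pairs G" if "v \<in> ?K" for v using that h by (simp add: blocks_at_iff)
  have p: "BV B u \<in> pairs G" using h by (simp add: blocks_at_iff)
  have Ieq: "?I = (B - {u}) \<union> (\<Union>v\<in>?K. inn G (VB v B))" using inn_BV_eq[OF h(2,3)] .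
  have fK: "finite ?K" using finite_block[OF h(2)] by blast
  have KI: "inn G (VB v B) \<subseteq> ?I" if "v \<in> ?K" for v unfolding Ieq using that by blast
  have BI: "v \<in> ?I" if "v \<in> B" "v \<noteq> u" for v unfolding Ieq using that by blast
  have uI: "u \<notin> inn G (VB v B)" if "v \<in> ?K" for v using inn_VB_block[OF h(2), of v] that h by blast
  have "availp (BV B u)"
    unfolding availp_def
  proof (intro allI impI, elim conjE)
    fix D assume D: "indep_set G D" and c: "of_bool (ua G (BV B u)) \<le> cp D (BV B u)"
    show "\<exists>E. reachable G D E \<and> E - ?I = D - ?I \<and> keeps D E (BV B u) \<and>
       (\<forall>x\<in>E \<inter> ?I. \<not> adj G (base (BV B u)) x)"
    proof (cases "B \<inter> D - {u} = {}")
      case True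
      have "\<not> adj G u x" if "x \<in> D \<inter> ?I" for x
        using inn_BV_block[OF h(2,3), of x] adj_verts[OF sG, of u x] that True by blast
      then show ?thesis by (intro exI[of _ D]) simp
    next
      case False
      then obtain x where x: "x \<in> B" "x \<in> D" "x \<noteq> u" by blast
      have Bx: "B \<inter> D = {x}" by (rule card_block_indep[OF h(2) D x(1,2)])
      then have "B \<inter> D - {u} = {x}" using x by blast
      then have cps: "(\<Sum>v\<in>?K. cp D (VB v B)) \<ge> 1" using cp_BV[OF h, of D] c by simp
      \<comment> \<open>The token on \<open>x\<close> is removed from \<open>B\<close>: into its own
        branch if that has capacity, otherwise via some \<open>v\<close> whose branch has.\<close>
      have "\<exists>v\<in>?K. \<exists>E. reachable G D E \<and> E - inn G (VB v B) = D - inn G (VB v B) - {x} \<and> keeps D E (VB v B)"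
      proof (cases "x \<in> ?K \<and> 1 \<le> cp D (VB x B)")
        case True
        then have "\<exists>E. reachable G D E \<and> E - inn G (VB x B) = D - inn G (VB x B) - {x} \<and> keeps D E (VB x B)"
          using pu[of x] D x unfolding pushp_def by simp
        then show ?thesis using True by blast
      next
        case False
        have "\<not> (\<forall>v\<in>?K. cp D (VB v B) \<le> 0)"
          using cps sum_nonpos[of ?K "\<lambda>v. cp D (VB v B)"] by force
        then obtain v where v: "v \<in> ?K" "1 \<le> cp D (VB v B)" by (auto simp: not_le int_one_le_iff_zero_less)
        then have xv: "x \<noteq> v" using False by blast
        have "of_bool (ua G (VB v B)) \<le> cp D (VB v B)" using v(2) by (cases "ua G (VB v B)") auto
        then obtain E where E: "reachable G D E" "E - inn G (VB v B) = insert v (D - inn G (VB v B) - {x})"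
          "keeps D E (VB v B)" "nt E (VB v B) = nt D (VB v B)"
          using slide_into[OF h(2) _ _ av[OF v(1)] D _ x(1,2) xv] v(1) by blast
        have "cp E (VB v B) = cp D (VB v B)" using keepsD[OF E(3)] E(4) by (simp add: tot_def)
        moreover have "v \<in> E" using E(2) by blast
        moreover have "indep_set G E" using reachable_indep[OF E(1) D] .
        ultimately obtain F where F: "reachable G E F" "F - inn G (VB v B) = E - inn G (VB v B) - {v}"
            "keeps E F (VB v B)"
          using pu[OF v(1)] v(2) unfolding pushp_def by auto
        have "v \<notin> D"
        proof
          assume "v \<in> D"
          then have "v \<in> B \<inter> D" using v(1) by simp
          then show False using Bx xv by simp
        qed
        then have "F - inn G (VB v B) = D - inn G (VB v B) - {x}" using F(2) E(2) by blast
        then show ?thesis using v(1) reachable_trans[OF E(1) F(1)] keeps_trans[OF E(3) F(3)] by blast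
      qed
      then obtain v E where v: "v \<in> ?K" and E: "reachable G D E"
        "E - inn G (VB v B) = D - inn G (VB v B) - {x}" "keeps D E (VB v B)" by blast
      have "keeps D E (BV B u)"
        using keeps_BV_except[OF h, of v D E] v E x(1) by blast
      moreover have "E - ?I = D - ?I"
      proof -
        have "E - ?I = E - inn G (VB v B) - ?I" using KI[OF v] by blast
        also have "\<dots> = D - ?I" unfolding E(2) using KI[OF v] BI[OF x(1,3)] by blast
        finally show ?thesis .
      qed
      moreover have "\<not> adj G u y" if y: "y \<in> E \<inter> ?I" for y
      proof
        assume a: "adj G u y"
        have yB: "y \<in> B" using inn_BV_block[OF h(2,3) _ a] y by blast
        then have "y \<notin> inn G (VB v B)" using inn_VB_block[OF h(2), of v] v by blast
        then show False using E(2) y yB Bx by blast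
      qed
      ultimately show ?thesis using E(1) by (intro exI[of _ E]) simp
    qed
  qed
  moreover have "pushp (BV B u)"
    unfolding pushp_def
  proof (intro allI impI, elim conjE)
    fix D assume D: "indep_set G D" and bu: "base (BV B u) \<in> D" and c: "1 \<le> cp D (BV B u)"
    have uD: "u \<in> D" using bu by simp
    have Bu: "B \<inter> D = {u}" by (rule card_block_indep[OF h(2) D h(3) uD])
    then have cps: "(\<Sum>v\<in>?K. cp D (VB v B)) + of_bool (ua G (BV B u)) \<ge> 1" 
      using cp_BV[OF h, of D] c by simp
    show "\<exists>E. reachable G D E \<and> E - ?I = D - ?I - {base (BV B u)} \<and> keeps D E (BV B u)"
    proof (cases "\<exists>v\<in>?K. 1 \<le> cp D (VB v B) \<or> \<not> ua G (VB v B)")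
      case True
      then obtain v where v: "v \<in> ?K" "1 \<le> cp D (VB v B) \<or> \<not> ua G (VB v B)" by blast
      have "of_bool (ua G (VB v B)) \<le> cp D (VB v B)" 
        using v(2) cp_nonneg[OF pv[OF v(1)] D] by (cases "ua G (VB v B)") auto
      then obtain E where E: "reachable G D E" "E - inn G (VB v B) = insert v (D - inn G (VB v B) - {u})"
        "keeps D E (VB v B)"
        using slide_into[OF h(2) _ _ av[OF v(1)] D _ h(3) uD] v(1) by blast
      have "keeps D E (BV B u)"
      proof (rule keeps_BV_except[OF h])
        show "v \<in> B" using v(1) by blast
        show "keeps D E (VB v B)" by (rule E(3))
        show "E - inn G (VB v B) - B = D - inn G (VB v B) - B"
          unfolding E(2) using v(1) h(3) by auto
      qed
      moreover have "E - ?I = D - ?I - {u}"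
      proof -
        have "E - ?I = E - inn G (VB v B) - ?I" using KI[OF v(1)] by blast
        also have "\<dots> = D - ?I - {u}" unfolding E(2) using KI[OF v(1)] BI[of v] v(1) by blast
        finally show ?thesis .
      qed
      ultimately show ?thesis using E(1) by auto
    next
      case False
      then have n1: "\<not> 1 \<le> cp D (VB v B)" if "v \<in> ?K" for v using that by blast
      have "cp D (VB v B) \<le> 0" if "v \<in> ?K" for v using n1[OF that] by linarith
      then have "(\<Sum>v\<in>?K. cp D (VB v B)) \<le> 0" by (rule sum_nonpos)
      \<comment> \<open>No branch has positive capacity although \<open>ua\<close> holds for all of
        them, so the capacity comes from \<open>ua G (BV B u)\<close> itself; then \<open>B\<close>
        must contain a vertex that is not a cut-vertex, and it can receive the token.\<close>
      then have "ua G (BV B u)" using cps by (cases "ua G (BV B u)") auto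
      then have "B \<noteq> ?K \<union> {u}" using ua_BV[OF h] False by blast
      then obtain w where w: "w \<in> B" "w \<notin> cut_verts G" "w \<noteq> u" using h by blast
      have uw: "adj G u w" using block_clique[OF h(2,3) w(1)] w by blast
      have "y = u" if "y \<in> D" "adj G w y" for y
        using block_nbr[OF that(2), of B] inn_VB_noncut[OF h(2) w(1,2)] that Bu by blast
      then have sl: "slide G D (insert w (D - {u}))" using slide_move(1)[OF D uD uw] by blast
      have "keeps D (insert w (D - {u})) (BV B u)"
        by (rule keeps_BV_except[OF h w(1)]) (use w h in blast)+
      moreover have "insert w (D - {u}) - ?I = D - ?I - {u}" using BI[OF w(1,3)] by blast
      ultimately show ?thesis using reachable_slide[OF sl] by auto
    qed
  qed
  ultimately show ?case by blast
next
  case (VB u B)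
  note h = VB.hyps
  let ?S = "blocks_at G u - {B}"
  let ?I = "inn G (VB u B)"
  have av: "availp (BV B' u)" and pu: "pushp (BV B' u)" if "B' \<in> ?S" for B' using VB.IH[OF that] by auto
  have pb: "BV B' u \<in> pairs G" if "B' \<in> ?S" for B' using that h by simp
  have p: "VB u B \<in> pairs G" using h by (simp add: blocks_at_iff)
  have Ieq: "?I = (\<Union>B'\<in>?S. inn G (BV B' u))" using inn_VB_eq[OF h(2,3)] .
  have "availp (VB u B)"
    unfolding availp_def
  proof (intro allI impI, elim conjE)
    fix D assume D: "indep_set G D" and c: "of_bool (ua G (VB u B)) \<le> cp D (VB u B)"
    have ns: "\<not> stuck D (BV B' u)" if "B' \<in> ?S" for B'
    proof
      assume st: "stuck D (BV B' u)"
      then have "ua G (VB u B)" using ua_VB[OF h] that by (auto simp: stuck_def)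
      moreover have "cp D (VB u B) = 0" using cp_VB[OF h, of D] that st by (auto simp: stuck_def)
      ultimately show False using c by simp
    qed
    obtain E where E: "reachable G D E" "E - ?I = D - ?I"
      "\<And>B'. B' \<in> ?S \<Longrightarrow> keeps D E (BV B' u)" "\<And>B'. B' \<in> ?S \<Longrightarrow> nt E (BV B' u) = nt D (BV B' u)"
      "\<And>B' x. B' \<in> ?S \<Longrightarrow> x \<in> E \<Longrightarrow> x \<in> inn G (BV B' u) \<Longrightarrow> \<not> adj G u x"
      using avail_blocks[of ?S u D] h(1) av D ns unfolding Ieq by blast
    have ns': "\<not> stuck E (BV B' u)" if "B' \<in> ?S" for B'
      using ns[OF that] keepsD[OF E(3)[OF that]] E(4)[OF that] by (simp add: tot_def stuck_def)
    have "tot E (VB u B) = tot D (VB u B)"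
    proof -
      have "tot E (VB u B) = (\<Sum>B'\<in>?S. tot E (BV B' u) - of_bool (ua G (BV B' u))) + of_bool (ua G (VB u B))"
        by (rule tot_VB_free[OF h]) (rule ns')
      also have "\<dots> = (\<Sum>B'\<in>?S. tot D (BV B' u) - of_bool (ua G (BV B' u))) + of_bool (ua G (VB u B))"
        by (simp only: keepsD[OF E(3)] cong: sum.cong)
      also have "\<dots> = tot D (VB u B)"
        by (rule tot_VB_free[OF h, symmetric]) (rule ns)
      finally show ?thesis .
    qed
    then have "keeps D E (VB u B)" using keeps_VB E(3) by blast
    moreover have "\<not> adj G u x" if "x \<in> E \<inter> ?I" for x using that E(5) unfolding Ieq by blast
    ultimately show "\<exists>E. reachable G D E \<and> E - ?I = D - ?I \<and> keeps D E (VB u B) \<and>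
       (\<forall>x\<in>E \<inter> ?I. \<not> adj G (base (VB u B)) x)" using E(1,2) by (intro exI[of _ E]) simp
  qed
  moreover have "pushp (VB u B)"
    unfolding pushp_def
  proof (intro allI impI, elim conjE)
    fix D assume D: "indep_set G D" and bu: "base (VB u B) \<in> D" and c: "1 \<le> cp D (VB u B)"
    have uD: "u \<in> D" using bu by simp
    have ns: "\<not> stuck D (BV B' u)" if "B' \<in> ?S" for B'
      using base_not_stuck[OF pb[OF that] D] uD by simp
    have ge: "of_bool (ua G (BV B' u)) \<le> cp D (BV B' u)" if "B' \<in> ?S" for B'
      using ns[OF that] not_stuck_iff[OF pb[OF that] D] by blast
    have ceq: "cp D (VB u B) = (\<Sum>B'\<in>?S. cp D (BV B' u) - of_bool (ua G (BV B' u))) + of_bool (ua G (VB u B))"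
      using cp_VB[OF h, of D] ns by (auto simp: stuck_def)
    \<comment> \<open>The pushed token must go to a block that does not get stuck by it, if there is one. Otherwise
      all blocks other than \<open>B\<close> are at their limit, and getting stuck costs no capacity.\<close>
    define roomy where "roomy = (\<exists>B'\<in>?S. 1 + of_bool (ua G (BV B' u)) \<le> cp D (BV B' u))"
    have full: "cp D (BV B' u) = of_bool (ua G (BV B' u))" if "\<not> roomy" "B' \<in> ?S" for B'
      using that ge[OF that(2)] by (force simp: roomy_def)
    obtain B0 where B0: "B0 \<in> ?S" "1 \<le> cp D (BV B0 u)"
      and B0r: "roomy \<Longrightarrow> 1 + of_bool (ua G (BV B0 u)) \<le> cp D (BV B0 u)"
      and B0f: "\<not> roomy \<Longrightarrow> ua G (BV B0 u)"
    proof (cases roomy)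
      case True
      then obtain B0 where b: "B0 \<in> ?S" "1 + of_bool (ua G (BV B0 u)) \<le> cp D (BV B0 u)"
        by (auto simp: roomy_def)
      moreover have "(0::int) \<le> of_bool (ua G (BV B0 u))" by simp
      ultimately show ?thesis using that[of B0] True by linarith
    next
      case False
      have "cp D (VB u B) = of_bool (ua G (VB u B))"
        unfolding ceq by (simp only: full[OF False] cong: sum.cong) simp
      then have "ua G (VB u B)" using c by (cases "ua G (VB u B)") auto
      then obtain B0 where "B0 \<in> ?S" "ua G (BV B0 u)" using ua_VB[OF h] by blast
      moreover from this have "cp D (BV B0 u) = 1" using full[OF False, of B0] by simp
      ultimately show ?thesis using that[of B0] False by simp
    qed
    obtain E where E: "reachable G D E" "E - inn G (BV B0 u) = D - inn G (BV B0 u) - {u}"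
      "keeps D E (BV B0 u)"
      using pu[OF B0(1)] D uD B0(2) unfolding pushp_def by auto
    have iE: "indep_set G E" using reachable_indep[OF E(1) D] .
    have fin: "finite D" "finite E" using indep_finite D iE by blast+
    have u0: "u \<notin> inn G q" if "base q = u" for q using base_notin_inn[of q] that by simp
    have nt0: "nt E (BV B0 u) = nt D (BV B0 u) + 1"
      by (rule nt_outside_minus[OF reachable_card[OF E(1)] fin E(2) uD]) (rule u0, simp)
    have loc: "E \<inter> inn G (BV B' u) = D \<inter> inn G (BV B' u)" if "B' \<in> ?S" "B' \<noteq> B0" for B'
    proof -
      have "inn G (BV B' u) \<inter> inn G (BV B0 u) = {}" using inn_BV_disjoint[of B' u B0] that B0(1) by blast
      moreover have "u \<notin> inn G (BV B' u)" by (rule u0) simp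
      ultimately show ?thesis using E(2) by blast
    qed
    have k: "keeps D E (BV B' u)" if "B' \<in> ?S" for B'
      using E(3) keeps_local[OF pb[OF that] loc[OF that, symmetric]] by (cases "B' = B0") auto
    have sub: "inn G (BV B0 u) \<subseteq> ?I" unfolding Ieq using B0(1) by blast
    have out: "E - ?I = D - ?I - {u}" using E(2) sub by blast
    have ntI: "nt E (VB u B) = nt D (VB u B) + 1"
      by (rule nt_outside_minus[OF reachable_card[OF E(1)] fin out uD]) (rule u0, simp)
    have c0: "cp E (BV B0 u) = cp D (BV B0 u) - 1" using keepsD[OF E(3)] nt0 by (simp add: tot_def)
    have "tot E (VB u B) = tot D (VB u B)"
    proof (cases roomy)
      case True
      have ns': "\<not> stuck E (BV B' u)" if "B' \<in> ?S" for B'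
      proof (cases "B' = B0")
        case True
        then show ?thesis using B0r[OF \<open>roomy\<close>] c0 by (auto simp: stuck_def)
      next
        case False
        then show ?thesis using ns[OF that] cp_local[OF pb[OF that] loc[OF that False]] by (simp add: stuck_def)
      qed
      have "tot E (VB u B) = (\<Sum>B'\<in>?S. tot E (BV B' u) - of_bool (ua G (BV B' u))) + of_bool (ua G (VB u B))"
        by (rule tot_VB_free[OF h]) (rule ns')
      also have "\<dots> = (\<Sum>B'\<in>?S. tot D (BV B' u) - of_bool (ua G (BV B' u))) + of_bool (ua G (VB u B))"
        by (simp only: keepsD[OF k] cong: sum.cong)
      also have "\<dots> = tot D (VB u B)"
        by (rule tot_VB_free[OF h, symmetric]) (rule ns)
      finally show ?thesis .
    next
      case False
      \<comment> \<open>Here \<open>B0\<close> had capacity 1 and becomes stuck. The total of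
        \<open>VB u B\<close> switches from \<open>1 + nt\<close> before to the count alone, which
        has grown by one.\<close>
      then have "stuck E (BV B0 u)" using B0f full[OF False B0(1)] c0 by (simp add: stuck_def)
      then have "tot E (VB u B) = nt E (VB u B)" using tot_VB_stuck[OF h B0(1)] by blast
      moreover have "ua G (VB u B)" using ua_VB[OF h] B0(1) B0f[OF False] by blast
      then have "cp D (VB u B) = 1"
        unfolding ceq by (simp only: full[OF False] cong: sum.cong) simp
      ultimately show ?thesis using ntI by (simp add: tot_def)
    qed
    then have "keeps D E (VB u B)" using keeps_VB k by blast
    then show "\<exists>E. reachable G D E \<and> E - ?I = D - ?I - {base (VB u B)} \<and> keeps D E (VB u B)"
      using E(1) out by auto
  qed
  ultimately show ?case by blast
qed

section \<open>Stuck blocks and frozen cut-vertices\<close>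

lemma slide_nt:
  assumes s: "slide G D E" and u: "base p \<notin> D" "base p \<notin> E"
  shows "nt E p = nt D p"
  using s
proof (cases rule: slide_cases)
  case (2 a b)
  have fD: "finite D" using s indep_finite by (auto simp: slide_def)
  have ab: "a \<noteq> base p" "b \<noteq> base p" using 2 u by auto
  \<comment> \<open>An edge between inside and outside has the base as an end, and the base is empty
    before and after the slide.\<close>
  have iff: "a \<in> inn G p \<longleftrightarrow> b \<in> inn G p"
    using inn_adj[OF 2(3) ab(2)] inn_adj[of b a p] 2(3) ab(1) adj_sym[of G a b] by blast
  show ?thesis
  proof (cases "a \<in> inn G p")
    case True
    then have "E \<inter> inn G p = insert b (D \<inter> inn G p - {a})" using 2(4) iff by blast
    moreover have "b \<notin> D \<inter> inn G p - {a}" "a \<in> D \<inter> inn G p" using 2 True by auto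
    moreover have "card (D \<inter> inn G p) > 0" using calculation(3) fD by (auto simp: card_gt_0_iff)
    ultimately show ?thesis using fD by (simp add: nt_def)
  next
    case False
    then have "E \<inter> inn G p = D \<inter> inn G p" using 2(4) iff by blast
    then show ?thesis by (rule nt_local)
  qed
qed simp

lemma stuck_token:
  assumes "p \<in> pairs G" "indep_set G D" "stuck D p"
  obtains x where "x \<in> D" "x \<in> inn G p" "adj G (base p) x"
  using cp_avail[OF assms(1,2)] not_stuck_iff[OF assms(1,2)] assms(3) by blast

text \<open>Each stuck block has a token next to \<open>u\<close>, and one slide can remove only one
  of the two. So \<open>u\<close> is empty before and after it.\<close>

lemma frozen_step:
  assumes B: "B1 \<in> blocks_at G u" "B2 \<in> blocks_at G u" "B1 \<noteq> B2" and u: "u \<in> cut_verts G"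
    and D: "indep_set G D" "stuck D (BV B1 u)" "stuck D (BV B2 u)" and s: "slide G D E" and q: "base q = u"
  shows "nt E q = nt D q"
proof -
  have p: "BV B1 u \<in> pairs G" "BV B2 u \<in> pairs G" using B u by auto
  obtain x where x: "x \<in> D" "x \<in> inn G (BV B1 u)" "adj G u x" using stuck_token[OF p(1) D(1,2)] by auto
  obtain y where y: "y \<in> D" "y \<in> inn G (BV B2 u)" "adj G u y" using stuck_token[OF p(2) D(1,3)] by auto
  have xy: "x \<noteq> y" using inn_BV_disjoint[OF B] x y by blast
  have uD: "u \<notin> D" using D(1) x by (auto simp: indep_set_def)
  have uE: "u \<notin> E"
    using s
  proof (cases rule: slide_cases)
    case 1
    then show ?thesis using uD by simp
  next
    case (2 a b)
    have "x \<in> E \<or> y \<in> E" using x(1) y(1) 2(4) xy by blast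
    moreover have "indep_set G E" using s by (simp add: slide_def)
    ultimately show ?thesis using x(3) y(3) by (auto simp: indep_set_def)
  qed
  show ?thesis by (rule slide_nt[OF s]) (use q uD uE in auto)
qed

text \<open>Two stuck blocks at \<open>u\<close> keep each other from releasing a token through \<open>u\<close>.\<close>

lemma frozen:
  assumes B: "B1 \<in> blocks_at G u" "B2 \<in> blocks_at G u" "B1 \<noteq> B2" and u: "u \<in> cut_verts G"
    and D: "indep_set G D" and ua: "ua G (BV B1 u)" "ua G (BV B2 u)"
    and path: "(\<lambda>D E. slide G D E \<and> tot D (BV B1 u) \<le> nt D0 (BV B1 u) \<and> tot D (BV B2 u) \<le> nt D0 (BV B2 u))\<^sup>*\<^sup>* D E"
    and start: "nt D (BV B1 u) = nt D0 (BV B1 u)" "nt D (BV B2 u) = nt D0 (BV B2 u)"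
    and q: "base q = u"
  shows "nt E q = nt D q"
proof -
  have p: "BV B1 u \<in> pairs G" "BV B2 u \<in> pairs G" using B u by auto
  have "indep_set G E \<and> (\<forall>q. base q = u \<longrightarrow> nt E q = nt D q)"
    using path
  proof (induction rule: rtranclp_induct)
    case base
    show ?case using D by simp
  next
    case (step E F)
    have E: "indep_set G E" "nt E (BV B1 u) = nt D0 (BV B1 u)" "nt E (BV B2 u) = nt D0 (BV B2 u)"
      using step.IH start by simp_all
    \<comment> \<open>The counts are still the initial ones, so the bound on the totals leaves no
      capacity.\<close>
    have "stuck E (BV B1 u)" "stuck E (BV B2 u)"
      using step.hyps(2) E ua cp_nonneg[OF p(1) E(1)] cp_nonneg[OF p(2) E(1)]
      by (simp_all add: stuck_def tot_def)
    then have "nt F q = nt E q" if "base q = u" for q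
      using frozen_step[OF B u E(1) _ _ _ that, of F] step.hyps(2) by blast
    moreover have "indep_set G F" using step.hyps(2) by (simp add: slide_def)
    ultimately show ?case using step.IH by simp
  qed
  then show ?thesis using q by simp
qed

text \<open>If a block is stuck, the total is the plain count, and a block contributes at most
  \<open>Y - ua\<close> to it, unless it is stuck and attains \<open>Y\<close>. Only one block may
  do so, and its excess of one is covered by the final \<open>ua\<close>, which holds because of the
  stuck block.\<close>

lemma tot_VB_le:
  assumes h: "u \<in> cut_verts G" "B \<in> blocks G" "u \<in> B" and D: "indep_set G D"
    and Y: "\<And>B'. B' \<in> blocks_at G u - {B} \<Longrightarrow> tot D (BV B' u) \<le> Y B'"
    and one: "\<And>B1 B2. B1 \<in> blocks_at G u - {B} \<Longrightarrow> B2 \<in> blocks_at G u - {B} \<Longrightarrow> B1 \<noteq> B2 \<Longrightarrow>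
       stuck D (BV B1 u) \<Longrightarrow> stuck D (BV B2 u) \<Longrightarrow> tot D (BV B1 u) = Y B1 \<Longrightarrow> tot D (BV B2 u) = Y B2 \<Longrightarrow> False"
  shows "tot D (VB u B) \<le> (\<Sum>B'\<in>blocks_at G u - {B}. Y B' - of_bool (ua G (BV B' u))) + of_bool (ua G (VB u B))"
proof (cases "\<exists>B'\<in>blocks_at G u - {B}. stuck D (BV B' u)")
  case False
  let ?S = "blocks_at G u - {B}"
  have "tot D (VB u B) = (\<Sum>B'\<in>?S. tot D (BV B' u) - of_bool (ua G (BV B' u))) + of_bool (ua G (VB u B))"
    by (rule tot_VB_free[OF h]) (use False in blast)
  also have "\<dots> \<le> (\<Sum>B'\<in>?S. Y B' - of_bool (ua G (BV B' u))) + of_bool (ua G (VB u B))"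
    by (intro add_right_mono sum_mono diff_right_mono Y)
  finally show ?thesis .
next
  case True
  let ?S = "blocks_at G u - {B}"
  define tight where "tight B' \<longleftrightarrow> stuck D (BV B' u) \<and> tot D (BV B' u) = Y B'" for B'
  have fS: "finite ?S" using finite_blocks_at by simp
  obtain Bs where Bs: "Bs \<in> ?S" "stuck D (BV Bs u)" using True by blast
  \<comment> \<open>If no block is tight, \<open>B0\<close> is an arbitrary block of the sum;
    \<open>le\<close> then merely grants it an allowance of one.\<close>
  obtain B0 where B0: "B0 \<in> ?S" "\<And>B'. B' \<in> ?S \<Longrightarrow> tight B' \<Longrightarrow> B' = B0"
  proof (cases "\<exists>B'\<in>?S. tight B'")
    case True
    then obtain B0 where b: "B0 \<in> ?S" "tight B0" by blast
    have "B' = B0" if "B' \<in> ?S" "tight B'" for B'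
      using one[OF that(1) b(1)] that(2) b(2) by (auto simp: tight_def)
    then show ?thesis using that[of B0] b by blast
  next
    case False
    then show ?thesis using that[of Bs] Bs by blast
  qed
  have le: "nt D (BV B' u) \<le> Y B' - of_bool (ua G (BV B' u)) + of_bool (B' = B0)" if B': "B' \<in> ?S" for B'
  proof -
    have p: "BV B' u \<in> pairs G" using B' h by simp
    have c: "0 \<le> cp D (BV B' u)" by (rule cp_nonneg[OF p D])
    have t: "cp D (BV B' u) + nt D (BV B' u) \<le> Y B'" using Y[OF B'] by (simp add: tot_def)
    show ?thesis
    proof (cases "stuck D (BV B' u)")
      case False
      then have "of_bool (ua G (BV B' u)) \<le> cp D (BV B' u)" using not_stuck_iff[OF p D] by blast
      moreover have "(0::int) \<le> of_bool (B' = B0)" by simp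
      ultimately show ?thesis using t by linarith
    next
      case True
      show ?thesis
      proof (cases "tight B'")
        case t': True
        then show ?thesis using B0(2)[OF B' t'] t c by (cases "ua G (BV B' u)") auto
      next
        case False
        then have "tot D (BV B' u) < Y B'" using True Y[OF B'] by (auto simp: tight_def)
        then show ?thesis using c by (cases "ua G (BV B' u)") (auto simp: tot_def)
      qed
    qed
  qed
  have "tot D (VB u B) = nt D (VB u B)" by (rule tot_VB_stuck[OF h Bs])
  also have "\<dots> = (\<Sum>B'\<in>?S. nt D (BV B' u))" by (rule nt_VB[OF h(2,3)])
  also have "\<dots> \<le> (\<Sum>B'\<in>?S. Y B' - of_bool (ua G (BV B' u)) + of_bool (B' = B0))"
    by (rule sum_mono) (rule le)
  also have "\<dots> = (\<Sum>B'\<in>?S. Y B' - of_bool (ua G (BV B' u))) + (\<Sum>B'\<in>?S. if B' = B0 then 1 else 0)"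
    by (simp add: sum.distrib of_bool_def)
  also have "(\<Sum>B'\<in>?S. if B' = B0 then 1 else 0 :: int) = 1" using fS B0(1) by (simp only: sum.delta if_True)
  also have "(1::int) = of_bool (ua G (VB u B))" using ua_VB[OF h] Bs by (auto simp: stuck_def)
  finally show ?thesis by simp
qed

text \<open>If exactly one block at \<open>u\<close> is stuck, its token next to \<open>u\<close> can be moved to \<open>u\<close>.\<close>

lemma unstick:
  assumes u: "u \<in> cut_verts G" and B1: "B1 \<in> blocks_at G u" and Q: "Q \<subseteq> blocks_at G u" "B1 \<notin> Q"
    and D: "indep_set G D" "stuck D (BV B1 u)" and ns: "\<And>B'. B' \<in> Q \<Longrightarrow> \<not> stuck D (BV B' u)"
    and nb: "\<And>y. y \<in> D \<Longrightarrow> adj G u y \<Longrightarrow> y \<in> (\<Union>B'\<in>insert B1 Q. inn G (BV B' u))"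
  shows "\<exists>E. reachable G D E \<and>
    E - (\<Union>B'\<in>insert B1 Q. inn G (BV B' u)) = insert u (D - (\<Union>B'\<in>insert B1 Q. inn G (BV B' u))) \<and>
    (\<forall>B'\<in>insert B1 Q. keeps D E (BV B' u))"
proof -
  let ?U = "\<Union>B'\<in>Q. inn G (BV B' u)"
  have p: "BV B' u \<in> pairs G" if "B' \<in> insert B1 Q" for B' using that Q u B1 by auto
  have B: "B1 \<in> blocks G" "u \<in> B1" using B1 by (auto simp: blocks_at_iff)
  obtain D1 where D1: "reachable G D D1" "D1 - ?U = D - ?U"
    "\<And>B'. B' \<in> Q \<Longrightarrow> keeps D D1 (BV B' u)" 
    "\<And>B' x. B' \<in> Q \<Longrightarrow> x \<in> D1 \<Longrightarrow> x \<in> inn G (BV B' u) \<Longrightarrow> \<not> adj G u x"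
  proof (rule avail_blocks[OF Q(1) u _ D(1) ns])
    show "availp (BV B' u)" if "B' \<in> Q" for B' using avail_push[OF p, of B'] that by blast
  qed blast+
  have iD1: "indep_set G D1" using reachable_indep[OF D1(1) D(1)] .
  have dj: "inn G (BV B' u) \<inter> inn G (BV B1 u) = {}" if "B' \<in> Q" for B'
    using inn_BV_disjoint[of B' u B1] that B1 Q by blast
  have loc1: "D1 \<inter> inn G (BV B1 u) = D \<inter> inn G (BV B1 u)" using D1(2) dj by blast
  have "stuck D1 (BV B1 u)" using D(2) cp_local[OF p loc1] by (simp add: stuck_def)
  then obtain x where x: "x \<in> D1" "x \<in> inn G (BV B1 u)" "adj G u x"
    using stuck_token[OF p iD1, of B1] by auto
  have xB: "x \<in> B1" using inn_BV_block[OF B x(2,3)] .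
  \<comment> \<open>After the blocks in \<open>Q\<close> have been cleared, a token next to
    \<open>u\<close> can only lie in the clique \<open>B1\<close>, hence is
    \<open>x\<close>.\<close>
  have "y = x" if y: "y \<in> D1" "adj G u y" for y
  proof -
    have nU: "y \<notin> ?U" using D1(4) y by blast
    then have "y \<in> D" using D1(2) y by blast
    then have "y \<in> inn G (BV B1 u)" using nb[OF _ y(2)] nU by blast
    then have "y \<in> B1" using inn_BV_block[OF B] y(2) by blast
    then show "y = x" using card_block_indep[OF B(1) iD1 xB x(1)] y(1) by blast
  qed
  moreover have "adj G x u" using x(3) adj_sym[of G u x] by simp
  ultimately have sl: "slide G D1 (insert u (D1 - {x}))" using slide_move(1)[OF iD1 x(1)] by blast
  let ?E = "insert u (D1 - {x})"
  have uI: "u \<notin> inn G (BV B' u)" for B' using base_notin_inn[of "BV B' u"] by simp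
  have xQ: "x \<notin> inn G (BV B' u)" if "B' \<in> Q" for B' using dj[OF that] x(2) by blast
  have "keeps D ?E (BV B' u)" if B': "B' \<in> insert B1 Q" for B'
  proof (cases "B' = B1")
    case True
    have "keeps D1 ?E (BV B1 u)"
    proof (rule keeps_BV[OF u B])
      fix v assume v: "v \<in> B1 \<inter> cut_verts G - {u}"
      have "x \<notin> inn G (VB v B1)" "u \<notin> inn G (VB v B1)"
        using inn_VB_block[OF B(1), of v] v xB B(2) by blast+
      then have "D1 \<inter> inn G (VB v B1) = ?E \<inter> inn G (VB v B1)" by blast
      moreover have "VB v B1 \<in> pairs G" using v B by (simp add: blocks_at_iff)
      ultimately show "keeps D1 ?E (VB v B1)" using keeps_local by blast
    qed
    moreover have "keeps D D1 (BV B1 u)" using keeps_local[OF p loc1[symmetric]] by simp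
    ultimately show ?thesis using True keeps_trans by blast
  next
    case False
    then have BQ: "B' \<in> Q" using B' by blast
    have "D1 \<inter> inn G (BV B' u) = ?E \<inter> inn G (BV B' u)" using uI[of B'] xQ[OF BQ] by blast
    then have "keeps D1 ?E (BV B' u)" using keeps_local[OF p[OF B']] by blast
    then show ?thesis using keeps_trans[OF D1(3)[OF BQ]] by blast
  qed
  moreover have "?E - (\<Union>B'\<in>insert B1 Q. inn G (BV B' u)) = insert u (D - (\<Union>B'\<in>insert B1 Q. inn G (BV B' u)))"
    using D1(2) x(2) uI by blast
  moreover have "reachable G D ?E" using reachable_trans[OF D1(1) reachable_slide[OF sl]] .
  ultimately show ?thesis by blast
qed

lemma keeps_BV_block:
  assumes u: "u \<in> cut_verts G" "B \<in> blocks G" "u \<in> B" and out: "E - B = D - B"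
  shows "keeps D E (BV B u)"
proof (rule keeps_BV[OF u])
  fix w assume w: "w \<in> B \<inter> cut_verts G - {u}"
  have "inn G (VB w B) \<inter> B = {}" using inn_VB_block[of B w] u w by blast
  then have "D \<inter> inn G (VB w B) = E \<inter> inn G (VB w B)" using out by blast
  moreover have "VB w B \<in> pairs G" using w u by (simp add: blocks_at_iff)
  ultimately show "keeps D E (VB w B)" using keeps_local by blast
qed

end

section \<open>Optimal reachable configurations\<close>

locale conn_block_graph_indep = conn_block_graph +
  fixes C :: "'a set"
  assumes indC: "indep_set G C"
begin

definition mx :: "'a vbpair \<Rightarrow> int" where
  "mx p = Max {tot D p | D. reachable G C D}"

text \<open>Optimality at all descendants at once. That such configurations exist is the content of
  \<open>opt_exists\<close>.\<close>

definition opt :: "'a set \<Rightarrow> 'a vbpair \<Rightarrow> bool" where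
  "opt D p \<longleftrightarrow> reachable G C D \<and> (\<forall>q\<in>desc p. tot D q = mx q)"

lemma reach_indep: "reachable G C D \<Longrightarrow> indep_set G D"
  using reachable_indep indC by blast

lemma finite_reach: "finite {D. reachable G C D}"
  by (rule finite_subset[of _ "Pow (verts G)"]) (use reach_indep finV in \<open>auto simp: indep_set_def\<close>)

lemma mx_ge: "reachable G C D \<Longrightarrow> tot D p \<le> mx p"
  unfolding mx_def
proof (rule Max_ge)
  have "{tot D p | D. reachable G C D} = (\<lambda>D. tot D p) ` {D. reachable G C D}" by blast
  then show "finite {tot D p | D. reachable G C D}" using finite_reach by simp
qed blast

lemma mx_eqI:
  assumes "reachable G C D" "\<And>E. reachable G C E \<Longrightarrow> tot E p \<le> tot D p"
  shows "tot D p = mx p"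
  unfolding mx_def
proof (rule Max_eqI[symmetric])
  have "{tot D p | D. reachable G C D} = (\<lambda>D. tot D p) ` {D. reachable G C D}" by blast
  then show "finite {tot D p | D. reachable G C D}" using finite_reach by simp
qed (use assms in auto)

lemma opt_reach: "opt D p \<Longrightarrow> reachable G C D"
  by (simp add: opt_def)

lemma opt_tot: "opt D p \<Longrightarrow> tot D p = mx p"
  by (simp add: opt_def)

lemma opt_keeps: "opt D p \<Longrightarrow> reachable G D E \<Longrightarrow> keeps D E p \<Longrightarrow> opt E p"
  unfolding opt_def keeps_def using reachable_trans by auto

lemma opt_opt_keeps: "opt D p \<Longrightarrow> opt E p \<Longrightarrow> keeps D E p"
  by (simp add: opt_def keeps_def)

lemma opt_desc: "opt D p \<Longrightarrow> q \<in> children p \<Longrightarrow> opt D q"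
  unfolding opt_def using desc_eq[of p] by blast

text \<open>At \<open>D\<close> both maxima equal the plain counts, so every reachable configuration
  satisfies the bounds under which \<open>frozen\<close> applies.\<close>

lemma frozen_mx:
  assumes B: "B1 \<in> blocks_at G u" "B2 \<in> blocks_at G u" "B1 \<noteq> B2" and u: "u \<in> cut_verts G"
    and D: "reachable G C D" "stuck D (BV B1 u)" "stuck D (BV B2 u)"
       "tot D (BV B1 u) = mx (BV B1 u)" "tot D (BV B2 u) = mx (BV B2 u)"
    and E: "reachable G C E"
  shows "base q = u \<Longrightarrow> nt E q = nt D q" "u \<notin> E"
proof -
  let ?r = "\<lambda>D' E. slide G D' E \<and> tot D' (BV B1 u) \<le> nt D (BV B1 u) \<and> tot D' (BV B2 u) \<le> nt D (BV B2 u)"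
  have nt: "nt D (BV B1 u) = mx (BV B1 u)" "nt D (BV B2 u) = mx (BV B2 u)"
    using D by (simp_all add: stuck_def tot_def)
  have "(slide G)\<^sup>*\<^sup>* D E" using reachable_trans[OF reachable_sym[OF D(1)] E] by (simp add: reachable_def)
  then have "?r\<^sup>*\<^sup>* D E \<and> reachable G C E"
  proof (induction rule: rtranclp_induct)
    case base
    show ?case using D by simp
  next
    case (step E F)
    then have "?r E F" using mx_ge nt by simp
    then have "?r\<^sup>*\<^sup>* D F" using step.IH by (auto intro: rtranclp.rtrancl_into_rtrancl)
    moreover have "reachable G C F" using step reachable_trans reachable_slide by blast
    ultimately show ?case by blast
  qed
  then have r: "?r\<^sup>*\<^sup>* D E" by blast
  have "ua G (BV B1 u)" "ua G (BV B2 u)" using D by (simp_all add: stuck_def)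
  then have eq: "nt E q = nt D q" if "base q = u" for q
    using frozen[OF B u reach_indep[OF D(1)] _ _ r refl refl that] by blast
  then show "base q = u \<Longrightarrow> nt E q = nt D q" .
  have p: "BV B1 u \<in> pairs G" using B u by simp
  have iE: "indep_set G E" using reach_indep[OF E] .
  have "cp E (BV B1 u) \<le> 0" using mx_ge[OF E, of "BV B1 u"] eq[of "BV B1 u"] nt by (simp add: tot_def)
  then have "stuck E (BV B1 u)" using cp_nonneg[OF p iE] D(2) by (simp add: stuck_def)
  then show "u \<notin> E" using base_not_stuck[OF p iE] by auto
qed

lemma tot_VB_le_mx:
  assumes "u \<in> cut_verts G" "B \<in> blocks G" "u \<in> B" "reachable G C D"
    and "\<not> (\<exists>B1\<in>blocks_at G u - {B}. \<exists>B2\<in>blocks_at G u - {B}. B1 \<noteq> B2 \<and> stuck D (BV B1 u) \<and> stuck D (BV B2 u) \<and>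
       tot D (BV B1 u) = mx (BV B1 u) \<and> tot D (BV B2 u) = mx (BV B2 u))"
  shows "tot D (VB u B) \<le> (\<Sum>B'\<in>blocks_at G u - {B}. mx (BV B' u) - of_bool (ua G (BV B' u))) + of_bool (ua G (VB u B))"
proof (rule tot_VB_le[OF assms(1-3) reach_indep[OF assms(4)]])
  show "tot D (BV B' u) \<le> mx (BV B' u)" for B' by (rule mx_ge[OF assms(4)])
qed (use assms(5) in blast)

text \<open>A token on \<open>u\<close> keeps every block from being stuck. Configurations occupying
  \<open>u\<close> therefore turn optimal blocks into the value of the formula.\<close>

lemma tot_VB_base:
  assumes h: "u \<in> cut_verts G" "B \<in> blocks G" "u \<in> B" and E: "indep_set G E" "u \<in> E"
    and o: "\<And>B'. B' \<in> blocks_at G u - {B} \<Longrightarrow> tot E (BV B' u) = mx (BV B' u)"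
  shows "tot E (VB u B) = (\<Sum>B'\<in>blocks_at G u - {B}. mx (BV B' u) - of_bool (ua G (BV B' u))) + of_bool (ua G (VB u B))"
proof -
  have "\<not> stuck E (BV B' u)" if "B' \<in> blocks_at G u - {B}" for B'
    using base_not_stuck[of "BV B' u" E] that h E by simp
  then have "tot E (VB u B) =
      (\<Sum>B'\<in>blocks_at G u - {B}. tot E (BV B' u) - of_bool (ua G (BV B' u))) + of_bool (ua G (VB u B))"
    by (rule tot_VB_free[OF h])
  then show ?thesis by (simp only: o cong: sum.cong)
qed

text \<open>This reverses a push. Tokens inside need not be able to come out, as two stuck blocks
  may hold \<open>u\<close>; a reachable \<open>D0\<close> with fewer tokens inside certifies that
  \<open>u\<close> is not frozen.\<close>

lemma pull:
  "p \<in> pairs G \<Longrightarrow> opt D p \<Longrightarrow> base p \<notin> D \<Longrightarrow>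
    (\<And>x. x \<in> D \<Longrightarrow> adj G (base p) x \<Longrightarrow> x \<in> inn G p) \<Longrightarrow>
    reachable G C D0 \<Longrightarrow> nt D0 p < nt D p \<Longrightarrow>
    \<exists>E. reachable G D E \<and> E - inn G p = insert (base p) (D - inn G p) \<and> opt E p"
proof (induction arbitrary: D rule: pair_induct)
  case (BV B u)
  note h = BV.hyps
  let ?K = "B \<inter> cut_verts G - {u}"
  let ?I = "inn G (BV B u)"
  have iD: "indep_set G D" using reach_indep opt_reach BV.prems(1) by blast
  have uD: "u \<notin> D" using BV.prems(2) by simp
  have nbD: "x \<in> B" if "x \<in> D" "adj G u x" for x
    using BV.prems(3)[OF that(1)] that(2) inn_BV_block[OF h(2,3)] by simp
  have uI: "u \<notin> ?I" using base_notin_inn[of "BV B u"] by simp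
  have BI: "x \<in> ?I" if "x \<in> B" "x \<noteq> u" for x using block_inn_BV[OF h(2,3)] that by blast
  show ?case
  proof (cases "B \<inter> D = {}")
    case False
    then obtain x where x: "x \<in> B" "x \<in> D" by blast
    have Bx: "B \<inter> D = {x}" by (rule card_block_indep[OF h(2) iD x])
    have xu: "x \<noteq> u" using x uD by blast
    have "adj G x u" using block_clique[OF h(2) x(1) h(3) xu] .
    moreover have "y = x" if "y \<in> D" "adj G u y" for y using nbD[OF that] that Bx by blast
    ultimately have sl: "slide G D (insert u (D - {x}))" using slide_move(1)[OF iD x(2)] by blast
    have "keeps D (insert u (D - {x})) (BV B u)"
      by (rule keeps_BV_block[OF h]) (use x h in blast)
    then have "opt (insert u (D - {x})) (BV B u)"
      using opt_keeps[OF BV.prems(1) reachable_slide[OF sl]] by blast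
    moreover have "insert u (D - {x}) - ?I = insert u (D - ?I)" using uI BI[OF x(1) xu] by blast
    ultimately show ?thesis using reachable_slide[OF sl] by auto
  next
    case True
    \<comment> \<open>With no token on \<open>B\<close>, the surplus over \<open>D0\<close> must lie
      in a branch behind some \<open>v\<close>; a token is pulled to \<open>v\<close> and then
      slides to \<open>u\<close>.\<close>
    have "\<not> (\<forall>v\<in>?K. nt D (VB v B) \<le> nt D0 (VB v B))"
    proof
      assume "\<forall>v\<in>?K. nt D (VB v B) \<le> nt D0 (VB v B)"
      then have "(\<Sum>v\<in>?K. nt D (VB v B)) \<le> (\<Sum>v\<in>?K. nt D0 (VB v B))" by (intro sum_mono) blast
      moreover have e: "B \<inter> D - {u} = {}" using True by blast
      have "nt D (BV B u) = (\<Sum>v\<in>?K. nt D (VB v B))" unfolding nt_BV[OF h(2,3), of D] e by simp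
      moreover have "(\<Sum>v\<in>?K. nt D0 (VB v B)) \<le> nt D0 (BV B u)" unfolding nt_BV[OF h(2,3), of D0] by simp
      ultimately show False using BV.prems(5) by simp
    qed
    then obtain v where v: "v \<in> ?K" "nt D0 (VB v B) < nt D (VB v B)" by force
    have vB: "v \<in> B" "v \<noteq> u" using v(1) by blast+
    have "opt D (VB v B)" by (rule opt_desc[OF BV.prems(1)]) (use v(1) in simp)
    moreover have "base (VB v B) \<notin> D" using vB True by auto
    moreover have "x \<in> inn G (VB v B)" if "x \<in> D" "adj G (base (VB v B)) x" for x
      using block_nbr[of v x B] that True by auto
    ultimately obtain E1 where E1: "reachable G D E1"
      "E1 - inn G (VB v B) = insert v (D - inn G (VB v B))" "opt E1 (VB v B)"
      using BV.IH[OF v(1) _ _ _ BV.prems(4) v(2)] by auto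
    have iE1: "indep_set G E1" using reachable_indep[OF E1(1) iD] .
    have vE1: "v \<in> E1" using E1(2) by blast
    have uv: "u \<notin> inn G (VB v B)" "v \<notin> inn G (VB v B)" using inn_VB_block[OF h(2) vB(1)] h(3) vB by blast+
    have "y = v" if y: "y \<in> E1" "adj G u y" for y
    proof (rule ccontr)
      assume "y \<noteq> v"
      have "y \<notin> inn G (VB v B)"
      proof
        assume "y \<in> inn G (VB v B)"
        moreover have "adj G y u" using y(2) adj_sym[of G u y] by simp
        ultimately have "u \<in> inn G (VB v B)" using inn_adj[of y u "VB v B"] vB by simp
        then show False using uv by blast
      qed
      then have "y \<in> D" using E1(2) y(1) \<open>y \<noteq> v\<close> by blast
      then show False using nbD y(2) True by blast
    qed
    moreover have "adj G v u" using block_clique[OF h(2) vB(1) h(3) vB(2)] .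
    ultimately have sl: "slide G E1 (insert u (E1 - {v}))" using slide_move(1)[OF iE1 vE1] by blast
    let ?E = "insert u (E1 - {v})"
    have r: "reachable G D ?E" using reachable_trans[OF E1(1) reachable_slide[OF sl]] .
    have pv: "VB v B \<in> pairs G" using v(1) h by (simp add: blocks_at_iff)
    have "keeps D ?E (BV B u)"
    proof (rule keeps_BV_except[OF h vB(1)])
      have "keeps D E1 (VB v B)" using opt_opt_keeps[OF \<open>opt D (VB v B)\<close> E1(3)] .
      moreover have "E1 \<inter> inn G (VB v B) = ?E \<inter> inn G (VB v B)" using uv by blast
      ultimately show "keeps D ?E (VB v B)" using keeps_trans keeps_local[OF pv] by blast
      show "?E - inn G (VB v B) - B = D - inn G (VB v B) - B" using E1(2) vB h(3) by blast
    qed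
    then have o: "opt ?E (BV B u)" using opt_keeps[OF BV.prems(1) r] by blast
    have "inn G (VB v B) \<subseteq> ?I" using inn_BV_eq[OF h(2,3)] v(1) by blast
    then have "?E - ?I = insert u (D - ?I)" using E1(2) uI BI[OF vB] by blast
    then show ?thesis using r o by auto
  qed
next
  case (VB u B)
  note h = VB.hyps
  let ?S = "blocks_at G u - {B}"
  let ?I = "inn G (VB u B)"
  have D: "reachable G C D" using opt_reach[OF VB.prems(1)] .
  have iD: "indep_set G D" using reach_indep[OF D] .
  have uD: "u \<notin> D" using VB.prems(2) by simp
  have Ieq: "?I = (\<Union>B'\<in>?S. inn G (BV B' u))" using inn_VB_eq[OF h(2,3)] .
  have pb: "BV B' u \<in> pairs G" if "B' \<in> ?S" for B' using that h by simp
  have oD: "opt D (BV B' u)" if "B' \<in> ?S" for B' by (rule opt_desc[OF VB.prems(1)]) (use that in simp)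
  have uI: "u \<notin> inn G q" if "base q = u" for q using base_notin_inn[of q] that by simp
  \<comment> \<open>Two stuck blocks would fix the count inside and contradict the surplus over
    \<open>D0\<close>.\<close>
  have one: False if "B1 \<in> ?S" "B2 \<in> ?S" "B1 \<noteq> B2" "stuck D (BV B1 u)" "stuck D (BV B2 u)" for B1 B2
  proof -
    have "nt D0 (VB u B) = nt D (VB u B)"
      using frozen_mx(1)[of B1 u B2 D D0 "VB u B"] that h D VB.prems(4) opt_tot[OF oD] by simp
    then show False using VB.prems(5) by simp
  qed
  have "\<exists>E. reachable G D E \<and> E - ?I = insert u (D - ?I) \<and> (\<forall>B'\<in>?S. opt E (BV B' u))"
  \<comment> \<open>A single stuck block already has a token next to \<open>u\<close>. If no block
    is stuck, one with more tokens than in \<open>D0\<close> gives up a token after the others have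
    been cleared.\<close>
  proof (cases "\<exists>B1\<in>?S. stuck D (BV B1 u)")
    case True
    then obtain B1 where B1: "B1 \<in> ?S" "stuck D (BV B1 u)" by blast
    have S: "insert B1 (?S - {B1}) = ?S" using B1 by blast
    have a: "B1 \<in> blocks_at G u" "?S - {B1} \<subseteq> blocks_at G u" "B1 \<notin> ?S - {B1}" using B1(1) by blast+
    have ns: "\<not> stuck D (BV B' u)" if "B' \<in> ?S - {B1}" for B' using one[OF B1(1), of B'] B1 that by blast
    have nb: "y \<in> (\<Union>B'\<in>insert B1 (?S - {B1}). inn G (BV B' u))" if "y \<in> D" "adj G u y" for y
      using VB.prems(3)[OF that(1)] that unfolding S Ieq[symmetric] by simp
    obtain E where E: "reachable G D E" "E - ?I = insert u (D - ?I)" "\<And>B'. B' \<in> ?S \<Longrightarrow> keeps D E (BV B' u)"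
      using unstick[OF h(1) a iD B1(2) ns nb] unfolding S Ieq[symmetric] by blast
    have "opt E (BV B' u)" if "B' \<in> ?S" for B' using opt_keeps[OF oD[OF that] E(1) E(3)[OF that]] .
    then show ?thesis using E by blast
  next
    case False
    have "\<not> (\<forall>B'\<in>?S. nt D (BV B' u) \<le> nt D0 (BV B' u))"
    proof
      assume "\<forall>B'\<in>?S. nt D (BV B' u) \<le> nt D0 (BV B' u)"
      then have "nt D (VB u B) \<le> nt D0 (VB u B)"
        unfolding nt_VB[OF h(2,3)] by (intro sum_mono) blast
      then show False using VB.prems(5) by simp
    qed
    then obtain B0 where B0: "B0 \<in> ?S" "nt D0 (BV B0 u) < nt D (BV B0 u)" by force
    let ?U = "\<Union>B'\<in>?S - {B0}. inn G (BV B' u)"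
    have IU: "?I = inn G (BV B0 u) \<union> ?U" unfolding Ieq using B0(1) by blast
    obtain D1 where D1: "reachable G D D1" "D1 - ?U = D - ?U"
      "\<And>B'. B' \<in> ?S - {B0} \<Longrightarrow> keeps D D1 (BV B' u)"
      "\<And>B' x. B' \<in> ?S - {B0} \<Longrightarrow> x \<in> D1 \<Longrightarrow> x \<in> inn G (BV B' u) \<Longrightarrow> \<not> adj G u x"
    proof (rule avail_blocks[of "?S - {B0}" u D])
      show "availp (BV B' u)" if "B' \<in> ?S - {B0}" for B' using avail_push[OF pb, of B'] that by blast
      show "\<not> stuck D (BV B' u)" if "B' \<in> ?S - {B0}" for B' using False that by blast
    qed (use h(1) iD in blast)+
    have dj: "inn G (BV B' u) \<inter> inn G (BV B0 u) = {}" if "B' \<in> ?S - {B0}" for B'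
      using inn_BV_disjoint[of B' u B0] that B0 by blast
    have loc1: "D \<inter> inn G (BV B0 u) = D1 \<inter> inn G (BV B0 u)" using D1(2) dj by blast
    have o1: "opt D1 (BV B0 u)"
      using opt_keeps[OF oD[OF B0(1)] D1(1) keeps_local[OF pb[OF B0(1)] loc1]] .
    have "u \<notin> ?U" using uI[of "BV _ u"] by simp
    then have uD1: "base (BV B0 u) \<notin> D1" using D1(2) uD by force
    have nb1: "y \<in> inn G (BV B0 u)" if y: "y \<in> D1" "adj G (base (BV B0 u)) y" for y
    proof -
      have a: "adj G u y" using y(2) by simp
      have nU: "y \<notin> ?U" using D1(4) y(1) a by blast
      then have "y \<in> D" using D1(2) y(1) by blast
      then have "y \<in> ?I" using VB.prems(3) a by simp
      then show ?thesis using nU IU by blast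
    qed
    have nt1: "nt D0 (BV B0 u) < nt D1 (BV B0 u)" using B0(2) nt_local[OF loc1] by simp
    obtain E where E: "reachable G D1 E" "E - inn G (BV B0 u) = insert u (D1 - inn G (BV B0 u))"
      "opt E (BV B0 u)"
      using VB.IH[OF B0(1) o1 uD1 nb1 VB.prems(4) nt1] by auto
    have r: "reachable G D E" using reachable_trans[OF D1(1) E(1)] .
    have "opt E (BV B' u)" if B': "B' \<in> ?S" for B'
    proof (cases "B' = B0")
      case False
      then have B'0: "B' \<in> ?S - {B0}" using B' by blast
      have "u \<notin> inn G (BV B' u)" by (rule uI) simp
      then have "D1 \<inter> inn G (BV B' u) = E \<inter> inn G (BV B' u)" by (rule Int_eq_of_insert_Diff[OF E(2) dj[OF B'0]])
      then have "keeps D1 E (BV B' u)" using keeps_local[OF pb[OF B']] by blast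
      then have "keeps D E (BV B' u)" using keeps_trans[OF D1(3)[OF B'0]] by blast
      then show ?thesis using opt_keeps[OF oD[OF B'] r] by blast
    qed (use E in simp)
    moreover have "E - ?I = insert u (D - ?I)"
    proof -
      have "u \<notin> ?U" using uI[of "BV _ u"] by simp
      then show ?thesis unfolding IU by (rule insert_Diff_Un[OF E(2) D1(2)])
    qed
    ultimately show ?thesis using r by blast
  qed
  then obtain E where E: "reachable G D E" "E - ?I = insert u (D - ?I)" "\<And>B'. B' \<in> ?S \<Longrightarrow> opt E (BV B' u)"
    by blast
  have rE: "reachable G C E" using reachable_trans[OF D E(1)] .
  have uE: "u \<in> E" using E(2) by blast
  \<comment> \<open>Optimal blocks do not make \<open>VB u B\<close> optimal by themselves. Here
    they do because \<open>u\<close> is occupied: \<open>E\<close> attains the formula that bounds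
    the total of \<open>D\<close>, which is already maximal.\<close>
  have "tot E (VB u B) = (\<Sum>B'\<in>?S. mx (BV B' u) - of_bool (ua G (BV B' u))) + of_bool (ua G (VB u B))"
    by (rule tot_VB_base[OF h reach_indep[OF rE] uE]) (use opt_tot[OF E(3)] in blast)
  moreover have "tot D (VB u B) \<le> (\<Sum>B'\<in>?S. mx (BV B' u) - of_bool (ua G (BV B' u))) + of_bool (ua G (VB u B))"
    by (rule tot_VB_le_mx[OF h D]) (use one in blast)
  moreover have "tot E (VB u B) \<le> mx (VB u B)" by (rule mx_ge[OF rE])
  ultimately have "tot E (VB u B) = tot D (VB u B)" using opt_tot[OF VB.prems(1)] by simp
  moreover have "keeps D E (BV B' u)" if "B' \<in> ?S" for B' using opt_opt_keeps[OF oD[OF that] E(3)[OF that]] .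
  ultimately have "keeps D E (VB u B)" using keeps_VB by blast
  then have "opt E (VB u B)" using opt_keeps[OF VB.prems(1) E(1)] by blast
  then show ?case using E by auto
qed

section \<open>Combining optima of disjoint branches\<close>

lemma opt_avail:
  assumes p: "p \<in> pairs G" and F: "opt F p" "of_bool (ua G p) \<le> cp F p"
  shows "\<exists>E. reachable G F E \<and> E - inn G p = F - inn G p \<and> opt E p \<and>
    (\<forall>x\<in>E \<inter> inn G p. \<not> adj G (base p) x)"
proof -
  have "indep_set G F" using F opt_reach reach_indep by blast
  then obtain E where "reachable G F E" "E - inn G p = F - inn G p" "keeps F E p"
    "\<forall>x\<in>E \<inter> inn G p. \<not> adj G (base p) x"
    using avail_push[OF p] F(2) unfolding availp_def by blast
  then show ?thesis using opt_keeps[OF F(1)] by blast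
qed

text \<open>The part of the walk from \<open>D\<close> outside \<open>G[p]\<close> is replayed while the part inside stays optimal:
  an optimal inside configuration can always take, release or make way for a token at the base when
  the original one does.\<close>

lemma combine_step:
  assumes p: "p \<in> pairs G" and s: "slide G D D'" and D: "reachable G C D"
    and F: "opt F p" "F - inn G p = D - inn G p"
  shows "\<exists>F'. opt F' p \<and> F' - inn G p = D' - inn G p"
  using s
proof (cases rule: slide_cases)
  case 1
  then show ?thesis using F by blast
next
  case (2 a b)
  let ?I = "inn G p" and ?u = "base p"
  have D': "reachable G C D'" using D s reachable_trans reachable_slide by blast
  have rF: "reachable G C F" using opt_reach[OF F(1)] .
  have iD: "indep_set G D" and iD': "indep_set G D'" and iF: "indep_set G F"
    using D D' rF reach_indep by blast+
  have fin: "finite D" "finite D'" "finite F" using iD iD' iF indep_finite by blast+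
  have ab: "a \<noteq> b" using adj_verts[OF sG 2(3)] by blast
  have bD': "b \<in> D'" using 2 by blast
  have cardD: "card F = card D" using reachable_card[OF D] reachable_card[OF rF] by simp
  have ntF: "nt F p = nt D p" by (rule nt_outside[OF cardD fin(1,3) F(2)])
  have totF: "tot D' p \<le> tot F p" using mx_ge[OF D'] opt_tot[OF F(1)] by simp
  have uI: "?u \<notin> ?I" by (rule base_notin_inn)
  \<comment> \<open>The slide from \<open>a\<close> to \<open>b\<close> stays inside, stays outside,
    enters or leaves. The answers are to do nothing, to copy the slide after freeing the base if
    \<open>b\<close> is the base, to push, and to pull.\<close>
  consider "a \<in> ?I" "b \<in> ?I" | "a \<notin> ?I" "b \<notin> ?I" | "a \<notin> ?I" "b \<in> ?I" | "a \<in> ?I" "b \<notin> ?I" by blast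
  then show ?thesis
  proof cases
    case 1
    then have "D' - ?I = D - ?I" using 2(4) by blast
    then show ?thesis using F by auto
  next
    case out: 2
    have "\<exists>E. reachable G F E \<and> E - ?I = F - ?I \<and> opt E p \<and> (\<forall>x\<in>E \<inter> ?I. \<not> adj G b x)"
    proof (cases "b = ?u")
      case True
      have uD': "?u \<in> D'" using bD' True by simp
      \<comment> \<open>\<open>D'\<close> occupies the base, so it has at least this capacity;
        \<open>F\<close> has the same count inside and at least the same total.\<close>
      have "of_bool (ua G p) \<le> cp D' p"
        by (rule cp_avail[OF p iD']) (use uD' iD' in \<open>auto simp: indep_set_def\<close>)
      moreover have "nt D' p = nt D p"
      proof (rule nt_local)
        show "D' \<inter> ?I = D \<inter> ?I" using 2(4) out by blast
      qed
      ultimately have c: "of_bool (ua G p) \<le> cp F p" using totF ntF by (simp add: tot_def)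
      show ?thesis using opt_avail[OF p F(1) c] unfolding True .
    next
      case False
      have "\<not> adj G b x" if x: "x \<in> F \<inter> ?I" for x
      proof
        assume "adj G b x"
        then have "adj G x b" using adj_sym[of G b x] by simp
        then have "b \<in> ?I" by (rule inn_adj) (use False x in auto)
        then show False using out by simp
      qed
      then show ?thesis using F(1) by (intro exI[of _ F]) simp
    qed
    then obtain E where E: "reachable G F E" "E - ?I = F - ?I" "opt E p" "\<forall>x\<in>E \<inter> ?I. \<not> adj G b x" by blast
    have iE: "indep_set G E" using reachable_indep[OF E(1) iF] .
    have aE: "a \<in> E" using E(2) F(2) 2(1) out by blast
    have "y = a" if y: "y \<in> E" "adj G b y" for y
    proof (rule ccontr)
      assume "y \<noteq> a"
      have "y \<notin> ?I" using E(4) y by blast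
      then have "y \<in> D'" using E(2) F(2) y(1) 2(4) \<open>y \<noteq> a\<close> by blast
      then show False using iD' bD' y(2) by (auto simp: indep_set_def)
    qed
    then have sl: "slide G E (insert b (E - {a}))" using slide_move(1)[OF iE aE 2(3)] by blast
    have "E \<inter> ?I = insert b (E - {a}) \<inter> ?I" using out by blast
    then have "opt (insert b (E - {a})) p"
      using opt_keeps[OF E(3) reachable_slide[OF sl] keeps_local[OF p]] by blast
    moreover have "insert b (E - {a}) - ?I = D' - ?I" using E(2) F(2) 2(4) by blast
    ultimately show ?thesis by blast
  next
    case inw: 3
    have au: "a = ?u"
    proof (rule ccontr)
      assume "a \<noteq> ?u"
      moreover have "adj G b a" using 2(3) adj_sym[of G a b] by simp
      ultimately show False using inn_adj[of b a p] inw by blast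
    qed
    have out': "D' - ?I = D - ?I - {a}" using 2(4) inw by blast
    have "nt D' p = nt D p + 1"
      by (rule nt_outside_minus[OF slide_card[OF s] fin(1,2) out' 2(1) inw(1)])
    moreover have "0 \<le> cp D' p" by (rule cp_nonneg[OF p iD'])
    \<comment> \<open>\<open>D'\<close> has one token more inside than \<open>F\<close> and
      nonnegative capacity, so the optimal total of \<open>F\<close> leaves room for one.\<close>
    ultimately have "1 \<le> cp F p" using totF ntF by (simp add: tot_def)
    moreover have "?u \<in> F" using F(2) 2(1) au uI by blast
    ultimately obtain E where E: "reachable G F E" "E - ?I = F - ?I - {?u}" "keeps F E p"
      using avail_push[OF p] iF unfolding pushp_def by blast
    then have "opt E p" using opt_keeps[OF F(1)] by blast
    moreover have "E - ?I = D' - ?I" unfolding E(2) F(2) out' au ..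
    ultimately show ?thesis by blast
  next
    case outw: 4
    have bu: "b = ?u" using inn_adj[OF 2(3), of p] outw by blast
    have out': "D' - ?I = insert ?u (D - ?I)" using 2(4) outw bu by blast
    have uF: "?u \<notin> F" using F(2) 2(2) bu uI by blast
    have nb: "x \<in> ?I" if "x \<in> F" "adj G ?u x" for x
    proof (rule ccontr)
      assume "x \<notin> ?I"
      then have "x \<in> D'" using that F(2) out' by blast
      then show False using iD' bD' bu that(2) by (auto simp: indep_set_def)
    qed
    have "nt D p = nt D' p + 1"
    proof (rule nt_outside_minus[OF _ fin(2,1) _ bD' outw(2)])
      show "card D = card D'" using slide_card[OF s] by simp
      show "D - ?I = D' - ?I - {b}" unfolding out' using bu 2(2) by blast
    qed
    \<comment> \<open>\<open>D'\<close> serves as the configuration with fewer tokens inside that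
      \<open>pull\<close> asks for.\<close>
    then have "nt D' p < nt F p" using ntF by simp
    then obtain E where "E - ?I = insert ?u (F - ?I)" "opt E p"
      using pull[OF p F(1) uF nb D'] by blast
    then show ?thesis using out' F(2) by auto
  qed
qed

text \<open>Slides are reversible, so a walk leads from \<open>E\<close> to \<open>D\<close>; its
  part outside is replayed step by step.\<close>

lemma combine:
  assumes p: "p \<in> pairs G" and E: "opt E p" and D: "reachable G C D"
  obtains F where "opt F p" "F - inn G p = D - inn G p"
proof -
  have "(slide G)\<^sup>*\<^sup>* E D"
    using reachable_trans[OF reachable_sym[OF opt_reach[OF E]] D] by (simp add: reachable_def)
  then have "reachable G C D \<and> (\<exists>F. opt F p \<and> F - inn G p = D - inn G p)"
  proof (induction rule: rtranclp_induct)
    case base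
    show ?case using E opt_reach by blast
  next
    case (step D D')
    then obtain F where F: "reachable G C D" "opt F p" "F - inn G p = D - inn G p" by blast
    have "reachable G C D'" using reachable_trans[OF F(1) reachable_slide[OF step(2)]] .
    then show ?case using combine_step[OF p step(2) F] by blast
  qed
  then show ?thesis using that by blast
qed

lemma combine_family:
  assumes Q: "finite Q" "Q \<subseteq> pairs G" "\<And>q r. q \<in> Q \<Longrightarrow> r \<in> Q \<Longrightarrow> q \<noteq> r \<Longrightarrow> inn G q \<inter> inn G r = {}"
    and o: "\<And>q. q \<in> Q \<Longrightarrow> \<exists>D. opt D q" and D: "reachable G C D"
  shows "\<exists>F. reachable G C F \<and> (\<forall>q\<in>Q. opt F q) \<and> F - (\<Union>q\<in>Q. inn G q) = D - (\<Union>q\<in>Q. inn G q)"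
  using Q o
proof (induction Q rule: finite_induct)
  case empty
  then show ?case using D by blast
next
  case (insert p Q)
  have "\<exists>F. reachable G C F \<and> (\<forall>q\<in>Q. opt F q) \<and> F - (\<Union>q\<in>Q. inn G q) = D - (\<Union>q\<in>Q. inn G q)"
    by (rule insert.IH) (use insert.prems in blast)+
  then obtain E where E: "reachable G C E" "\<And>q. q \<in> Q \<Longrightarrow> opt E q"
    "E - (\<Union>q\<in>Q. inn G q) = D - (\<Union>q\<in>Q. inn G q)" by blast
  have p: "p \<in> pairs G" using insert.prems by blast
  obtain D0 where "opt D0 p" using insert.prems(3) by blast
  then obtain F where F: "opt F p" "F - inn G p = E - inn G p" using combine[OF p _ E(1)] by blast
  have rEF: "reachable G E F" using reachable_trans[OF reachable_sym[OF E(1)] opt_reach[OF F(1)]] .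
  have "opt F q" if q: "q \<in> Q" for q
  proof -
    have "inn G q \<inter> inn G p = {}" using insert.prems(2)[of q p] insert.hyps(2) q by blast
    then have "E \<inter> inn G q = F \<inter> inn G q" using F(2) by blast
    moreover have "q \<in> pairs G" using insert.prems(1) q by blast
    ultimately show ?thesis using opt_keeps[OF E(2)[OF q] rEF] keeps_local by blast
  qed
  moreover have "F - (\<Union>q\<in>insert p Q. inn G q) = D - (\<Union>q\<in>insert p Q. inn G q)"
    using F(2) E(3) by blast
  ultimately show ?case using F(1) opt_reach by blast
qed

text \<open>The vertex \<open>u\<close> lies in no inside, so its occupation can be prescribed by
  \<open>D\<close> while the blocks become optimal.\<close>

lemma combine_blocks:
  assumes Q: "Q \<subseteq> blocks_at G u" and u: "u \<in> cut_verts G"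
    and o: "\<And>B'. B' \<in> Q \<Longrightarrow> \<exists>D. opt D (BV B' u)" and D: "reachable G C D"
  shows "\<exists>F. reachable G C F \<and> (\<forall>B'\<in>Q. opt F (BV B' u)) \<and> (u \<in> F \<longleftrightarrow> u \<in> D)"
proof -
  let ?Q = "(\<lambda>B'. BV B' u) ` Q"
  have "finite ?Q" using Q finite_blocks_at finite_subset by blast
  moreover have "?Q \<subseteq> pairs G" using Q u by auto
  moreover have "inn G q \<inter> inn G r = {}" if qr: "q \<in> ?Q" "r \<in> ?Q" "q \<noteq> r" for q r
  proof -
    obtain B1 B2 where "q = BV B1 u" "r = BV B2 u" "B1 \<in> Q" "B2 \<in> Q" using qr by blast
    then show ?thesis using inn_BV_disjoint[of B1 u B2] Q qr(3) by blast
  qed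
  moreover have "\<exists>D. opt D q" if "q \<in> ?Q" for q using o that by blast
  ultimately obtain F where F: "reachable G C F" "\<forall>q\<in>?Q. opt F q"
    "F - (\<Union>q\<in>?Q. inn G q) = D - (\<Union>q\<in>?Q. inn G q)"
    using combine_family[OF _ _ _ _ D, of ?Q] by metis
  have "u \<notin> inn G (BV B' u)" for B' using base_notin_inn[of "BV B' u"] by simp
  then have "u \<in> F \<longleftrightarrow> u \<in> D" using F(3) by blast
  then show ?thesis using F(1,2) by blast
qed

section \<open>Existence of optima and recursion for the maxima\<close>

lemma nt_const:
  assumes nu: "\<And>E. reachable G C E \<Longrightarrow> base q \<notin> E" and D: "reachable G C D" and E: "reachable G C E"
  shows "nt E q = nt D q"
proof -
  have "(slide G)\<^sup>*\<^sup>* D E" using reachable_trans[OF reachable_sym[OF D] E] by (simp add: reachable_def)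
  then have "reachable G C E \<and> nt E q = nt D q"
  proof (induction rule: rtranclp_induct)
    case (step E F)
    then have r: "reachable G C E" "reachable G C F" using reachable_trans reachable_slide by blast+
    then show ?case using slide_nt[OF step(2), of q] nu step.IH by simp
  qed (use D in simp)
  then show ?thesis by simp
qed

text \<open>For a block the total is a sum over disjoint branches, so combined optima are optimal.
  At a cut-vertex that can be occupied, optima combined with a token on \<open>u\<close> attain the
  formula, which is an upper bound because two stuck optimal blocks would forbid occupying
  \<open>u\<close>. At one that is never occupied all counts behind \<open>u\<close> are
  constant.\<close>

lemma opt_exists: "p \<in> pairs G \<Longrightarrow> \<exists>D. opt D p"
proof (induction rule: pair_induct)
  case (BV B u)
  note h = BV.hyps
  let ?K = "B \<inter> cut_verts G - {u}"
  let ?Q = "(\<lambda>v. VB v B) ` ?K"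
  have "finite ?Q" using finite_block[OF h(2)] by blast
  moreover have "?Q \<subseteq> pairs G" using h by (auto simp: blocks_at_iff)
  moreover have "inn G q \<inter> inn G r = {}" if qr: "q \<in> ?Q" "r \<in> ?Q" "q \<noteq> r" for q r
  proof -
    obtain v w where "q = VB v B" "r = VB w B" "v \<in> B" "w \<in> B" using qr by blast
    then show ?thesis using inn_VB_disjoint[of B v w] h qr(3) by blast
  qed
  moreover have "\<exists>D. opt D q" if "q \<in> ?Q" for q using BV.IH that by blast
  ultimately obtain F where F: "reachable G C F" "\<forall>q\<in>?Q. opt F q"
    using combine_family[OF _ _ _ _ reachable_refl, of ?Q] by metis
  have oF: "opt F (VB v B)" if "v \<in> ?K" for v using F(2) that by blast
  have "tot F (BV B u) = mx (BV B u)"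
  proof (rule mx_eqI[OF F(1)])
    fix E assume E: "reachable G C E"
    have "(\<Sum>v\<in>?K. tot E (VB v B)) \<le> (\<Sum>v\<in>?K. tot F (VB v B))"
      by (rule sum_mono) (use mx_ge[OF E] opt_tot[OF oF] in simp)
    then show "tot E (BV B u) \<le> tot F (BV B u)" unfolding tot_BV[OF h] by simp
  qed
  moreover have "tot F q = mx q" if "q \<in> desc (VB v B)" "v \<in> ?K" for q v
    using oF[OF that(2)] that(1) by (simp add: opt_def)
  ultimately have "opt F (BV B u)" unfolding opt_def desc_BV using F(1) by blast
  then show ?case by blast
next
  case (VB u B)
  note h = VB.hyps
  let ?S = "blocks_at G u - {B}"
  let ?X = "(\<Sum>B'\<in>?S. mx (BV B' u) - of_bool (ua G (BV B' u))) + of_bool (ua G (VB u B))"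
  have S: "?S \<subseteq> blocks_at G u" by blast
  have pb: "BV B' u \<in> pairs G" if "B' \<in> ?S" for B' using that h by simp
  have fin: "\<exists>D. opt D (VB u B)" if F: "reachable G C F" "\<And>B'. B' \<in> ?S \<Longrightarrow> opt F (BV B' u)"
    and le: "\<And>E. reachable G C E \<Longrightarrow> tot E (VB u B) \<le> tot F (VB u B)" for F
  proof -
    have "tot F (VB u B) = mx (VB u B)" using mx_eqI[OF F(1) le] .
    moreover have "tot F q = mx q" if "q \<in> desc (BV B' u)" "B' \<in> ?S" for q B'
      using F(2)[OF that(2)] that(1) by (simp add: opt_def)
    ultimately have "opt F (VB u B)" unfolding opt_def desc_VB using F(1) by blast
    then show ?thesis by blast
  qed
  show ?case
  proof (cases "\<exists>D0. reachable G C D0 \<and> u \<in> D0")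
    case True
    then obtain D0 where D0: "reachable G C D0" "u \<in> D0" by blast
    then obtain F where F: "reachable G C F" "\<And>B'. B' \<in> ?S \<Longrightarrow> opt F (BV B' u)" "u \<in> F"
      using combine_blocks[OF S h(1) VB.IH D0(1)] D0(2) by blast
    have X: "tot F (VB u B) = ?X"
      by (rule tot_VB_base[OF h reach_indep[OF F(1)] F(3)]) (use opt_tot[OF F(2)] in blast)
    show ?thesis
    proof (rule fin[OF F(1,2)])
      fix E assume E: "reachable G C E"
      show "tot E (VB u B) \<le> tot F (VB u B)"
        unfolding X
      proof (rule tot_VB_le_mx[OF h E], rule notI, elim bexE conjE)
        fix B1 B2 assume "B1 \<in> ?S" "B2 \<in> ?S" "B1 \<noteq> B2" "stuck E (BV B1 u)" "stuck E (BV B2 u)"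
          "tot E (BV B1 u) = mx (BV B1 u)" "tot E (BV B2 u) = mx (BV B2 u)"
        then show False using frozen_mx(2)[of B1 u B2 E D0] E D0 h(1) by blast
      qed
    qed
  next
    case False
    then have nu: "base q \<notin> E" if "reachable G C E" "base q = u" for E q using that by blast
    obtain F where F: "reachable G C F" "\<And>B'. B' \<in> ?S \<Longrightarrow> opt F (BV B' u)"
      using combine_blocks[OF S h(1) VB.IH reachable_refl] by blast
    have nt: "nt E q = nt F q" if "base q = u" "reachable G C E" for E q
      by (rule nt_const[OF nu[OF _ that(1)] F(1) that(2)])
    show ?thesis
    proof (rule fin[OF F])
      fix E assume E: "reachable G C E"
      show "tot E (VB u B) \<le> tot F (VB u B)"
      \<comment> \<open>A block stuck in the optimum \<open>F\<close> has no capacity in any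
        \<open>E\<close>, since counts are constant; all totals then equal the same count. Otherwise
        no optimal block of \<open>E\<close> is stuck, as \<open>F\<close> would have the same
        capacity there.\<close>
      proof (cases "\<exists>B1\<in>?S. stuck F (BV B1 u)")
        case True
        then obtain B1 where B1: "B1 \<in> ?S" "stuck F (BV B1 u)" by blast
        have "tot E (BV B1 u) \<le> tot F (BV B1 u)" using mx_ge[OF E] opt_tot[OF F(2)[OF B1(1)]] by simp
        then have "cp E (BV B1 u) \<le> cp F (BV B1 u)" using nt[OF _ E, of "BV B1 u"] by (simp add: tot_def)
        then have "stuck E (BV B1 u)" 
          using B1(2) cp_nonneg[OF pb[OF B1(1)] reach_indep[OF E]] by (auto simp: stuck_def)
        then have "tot E (VB u B) = nt E (VB u B)" by (rule tot_VB_stuck[OF h B1(1)])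
        also have "\<dots> = nt F (VB u B)" by (rule nt[OF _ E]) simp
        also have "\<dots> = tot F (VB u B)" using tot_VB_stuck[OF h B1] by simp
        finally show ?thesis by simp
      next
        case False
        have "tot F (VB u B) = (\<Sum>B'\<in>?S. tot F (BV B' u) - of_bool (ua G (BV B' u))) + of_bool (ua G (VB u B))"
          by (rule tot_VB_free[OF h]) (use False in blast)
        then have X: "tot F (VB u B) = ?X" by (simp only: opt_tot[OF F(2)] cong: sum.cong)
        show ?thesis
          unfolding X
        proof (rule tot_VB_le_mx[OF h E], rule notI, elim bexE conjE)
          fix B1 B2 assume B1: "B1 \<in> ?S" "stuck E (BV B1 u)" "tot E (BV B1 u) = mx (BV B1 u)"
          then have "tot F (BV B1 u) = tot E (BV B1 u)" using opt_tot[OF F(2)[OF B1(1)]] by simp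
          then have "cp F (BV B1 u) = cp E (BV B1 u)" using nt[OF _ E, of "BV B1 u"] by (simp add: tot_def)
          then show False using B1 \<open>\<not> (\<exists>B1\<in>?S. stuck F (BV B1 u))\<close> by (simp add: stuck_def)
        qed
      qed
    qed
  qed
qed

lemma mx_BV:
  assumes h: "u \<in> cut_verts G" "B \<in> blocks G" "u \<in> B"
  shows "mx (BV B u) = (\<Sum>v\<in>B \<inter> cut_verts G - {u}. mx (VB v B)) + of_bool (ua G (BV B u))"
proof -
  have "BV B u \<in> pairs G" using h by (simp add: blocks_at_iff)
  then obtain D where D: "opt D (BV B u)" using opt_exists by blast
  have "tot D (VB v B) = mx (VB v B)" if "v \<in> B \<inter> cut_verts G - {u}" for v
    using opt_tot[OF opt_desc[OF D]] that by simp
  then show ?thesis using tot_BV[OF h, of D] opt_tot[OF D] by simp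
qed

text \<open>Without a stuck block a combined optimum attains the formula at once; with one, a token
  can be brought to \<open>u\<close> first. Two stuck ones would freeze \<open>u\<close>, so their
  counts would be those of \<open>C\<close>, which \<open>two\<close> excludes.\<close>

lemma mx_VB_ge:
  assumes h: "u \<in> cut_verts G" "B \<in> blocks G" "u \<in> B"
    and two: "\<And>B1 B2. B1 \<in> blocks_at G u \<Longrightarrow> B2 \<in> blocks_at G u \<Longrightarrow> B1 \<noteq> B2 \<Longrightarrow> ua G (BV B1 u) \<Longrightarrow> ua G (BV B2 u) \<Longrightarrow>
      mx (BV B1 u) = nt C (BV B1 u) \<Longrightarrow> mx (BV B2 u) = nt C (BV B2 u) \<Longrightarrow> False"
  shows "(\<Sum>B'\<in>blocks_at G u - {B}. mx (BV B' u) - of_bool (ua G (BV B' u))) + of_bool (ua G (VB u B)) \<le> mx (VB u B)"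
    (is "?X \<le> _")
proof -
  let ?S = "blocks_at G u - {B}"
  have S: "?S \<subseteq> blocks_at G u" by blast
  have pb: "BV B' u \<in> pairs G" if "B' \<in> blocks_at G u" for B' using that h by simp
  have ex: "\<exists>D. opt D (BV B' u)" if "B' \<in> blocks_at G u" for B' using opt_exists[OF pb[OF that]] .
  \<comment> \<open>All blocks at \<open>u\<close> are combined, including \<open>B\<close>: a token
    can enter \<open>u\<close> only if \<open>B\<close> makes way too.\<close>
  obtain D where D: "reachable G C D" "\<And>B'. B' \<in> blocks_at G u \<Longrightarrow> opt D (BV B' u)"
    using combine_blocks[OF subset_refl h(1) ex reachable_refl] by blast
  have iD: "indep_set G D" using reach_indep[OF D(1)] .
  show ?thesis
  proof (cases "\<exists>B1\<in>?S. stuck D (BV B1 u)")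
    case False
    have "tot D (VB u B) = (\<Sum>B'\<in>?S. tot D (BV B' u) - of_bool (ua G (BV B' u))) + of_bool (ua G (VB u B))"
      by (rule tot_VB_free[OF h]) (use False in blast)
    moreover have "tot D (BV B' u) = mx (BV B' u)" if "B' \<in> ?S" for B' using opt_tot[OF D(2)] that by blast
    ultimately have "tot D (VB u B) = ?X" by (simp only: cong: sum.cong)
    then show ?thesis using mx_ge[OF D(1), of "VB u B"] by simp
  next
    case True
    then obtain B1 where B1: "B1 \<in> ?S" "stuck D (BV B1 u)" by blast
    let ?Q = "blocks_at G u - {B1}"
    have a: "B1 \<in> blocks_at G u" "?Q \<subseteq> blocks_at G u" "B1 \<notin> ?Q" using B1(1) by blast+
    have Q: "insert B1 ?Q = blocks_at G u" using B1 by blast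
    have ns: "\<not> stuck D (BV B2 u)" if B2: "B2 \<in> ?Q" for B2
    proof
      assume st: "stuck D (BV B2 u)"
      have b: "B2 \<in> blocks_at G u" "B1 \<noteq> B2" using B2 by blast+
      have t: "tot D (BV B1 u) = mx (BV B1 u)" "tot D (BV B2 u) = mx (BV B2 u)"
        using opt_tot D(2) a(1) b(1) by blast+
      have "nt C q = nt D q" if "base q = u" for q
        using frozen_mx(1)[OF a(1) b h(1) D(1) B1(2) st t reachable_refl that] .
      then show False using two[OF a(1) b] B1(2) st t by (simp add: stuck_def tot_def)
    qed
    have nb: "y \<in> (\<Union>B'\<in>insert B1 ?Q. inn G (BV B' u))" if y: "y \<in> D" "adj G u y" for y
    proof -
      obtain B' where "B' \<in> blocks G" "u \<in> B'" "y \<in> B'" using adj_in_block[OF y(2)] by blast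
      moreover have "y \<noteq> u" using adj_verts[OF sG y(2)] by blast
      ultimately have "B' \<in> blocks_at G u" "y \<in> inn G (BV B' u)"
        using block_inn_BV[of B' u] by (auto simp: blocks_at_iff simp del: inn.simps)
      then show ?thesis unfolding Q by blast
    qed
    obtain E where E: "reachable G D E"
        "E - (\<Union>B'\<in>insert B1 ?Q. inn G (BV B' u)) = insert u (D - (\<Union>B'\<in>insert B1 ?Q. inn G (BV B' u)))"
      using unstick[OF h(1) a iD B1(2) ns nb] by blast
    have uE: "u \<in> E" using E(2) by blast
    \<comment> \<open>A second combination keeps the token on \<open>u\<close> and makes the blocks
      optimal.\<close>
    obtain F where F: "reachable G C F" "\<And>B'. B' \<in> ?S \<Longrightarrow> opt F (BV B' u)" "u \<in> F"
      using combine_blocks[OF S h(1) _ reachable_trans[OF D(1) E(1)]] ex uE by blast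
    have "tot F (VB u B) = ?X"
      by (rule tot_VB_base[OF h reach_indep[OF F(1)] F(3)]) (use opt_tot[OF F(2)] in blast)
    then show ?thesis using mx_ge[OF F(1), of "VB u B"] by simp
  qed
qed

section \<open>Potentials as the least fixpoint\<close>

lemma pot_eq:
  assumes p: "p \<in> pairs G"
  shows "pot G C p = mx p - nt C p"
proof -
  have off: "off_base (restr G D p) p = D \<inter> inn G p" for D
    using verts_subg_pair[OF p] base_notin_inn[of p] by (auto simp: off_base_def restr_def)
  have eq: "{cap G p (restr G C' p) + int (card (off_base (restr G C' p) p))
            - int (card (off_base (restr G C p) p)) | C'. indep_set G C' \<and> reachable G C C'}
     = (\<lambda>D. tot D p - nt C p) ` {D. reachable G C D}" (is "?L = ?R")
    using reach_indep by (auto simp: off tot_def nt_def cp_def)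
  obtain D where D: "opt D p" using opt_exists[OF p] by blast
  show ?thesis
    unfolding pot_def eq
  proof (rule Max_eqI)
    show "finite ((\<lambda>D. tot D p - nt C p) ` {D. reachable G C D})" using finite_reach by simp
    show "x \<le> mx p - nt C p" if "x \<in> (\<lambda>D. tot D p - nt C p) ` {D. reachable G C D}" for x
      using that mx_ge by auto
    show "mx p - nt C p \<in> (\<lambda>D. tot D p - nt C p) ` {D. reachable G C D}"
      using opt_reach[OF D] opt_tot[OF D] by (intro image_eqI[of _ _ D]) simp_all
  qed
qed

text \<open>The configuration \<open>C\<close> itself is a witness, with nonnegative capacity. So
  the zero array lies below the potentials.\<close>

lemma pot_nonneg:
  assumes p: "p \<in> pairs G"
  shows "0 \<le> pot G C p"
  using mx_ge[of C p] cp_nonneg[OF p indC] pot_eq[OF p] by (simp add: tot_def)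

lemma candidate_BV:
  assumes h: "u \<in> cut_verts G" "B \<in> blocks G" "u \<in> B"
  shows "candidate G C y (BV B u) = (\<Sum>v\<in>B \<inter> cut_verts G - {u}. y (VB v B)) + of_bool (ua G (BV B u))
    - int (card (B \<inter> C - {u}))"
proof -
  have p: "BV B u \<in> pairs G" using h by (simp add: blocks_at_iff)
  have "B \<inter> off_base (restr G C (BV B u)) (BV B u) = B \<inter> C - {u}"
    using verts_subg_pair[OF p] block_inn_BV[OF h(2,3)]
    by (auto simp: off_base_def restr_def simp del: inn.simps subg.simps)
  then show ?thesis using \<kappa>_eq[OF h(2,3)] by simp
qed

definition two_stuck :: "('a vbpair \<Rightarrow> int) \<Rightarrow> 'a \<Rightarrow> bool" where
  "two_stuck y u \<longleftrightarrow> (\<exists>B'\<in>blocks_at G u. \<exists>B''\<in>blocks_at G u. B' \<noteq> B'' \<and>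
              y (BV B' u) = 0 \<and> y (BV B'' u) = 0 \<and> ua G (BV B' u) \<and> ua G (BV B'' u))"

lemma candidate_VB:
  assumes h: "u \<in> cut_verts G" "B \<in> blocks G" "u \<in> B"
  shows "candidate G C y (VB u B) = (if two_stuck y u then y (VB u B)
    else (\<Sum>B'\<in>blocks_at G u - {B}. y (BV B' u) - of_bool (ua G (BV B' u))) + of_bool (ua G (VB u B)))"
proof -
  have b: "\<beta> G u B = blocks_at G u - {B}" using \<beta>_eq[of u B] h by (simp add: blocks_at_iff)
  show ?thesis unfolding candidate.simps b two_stuck_def[symmetric] by simp
qed

text \<open>The delicate point is that the test is made on \<open>y\<close> instead of the
  potentials. As \<open>y\<close> lies between 0 and the potentials, two zero potentials force two
  zero entries, so a failing test allows \<open>mx_VB_ge\<close>.\<close>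

lemma candidate_le_pot:
  assumes y: "\<And>p. p \<in> pairs G \<Longrightarrow> 0 \<le> y p \<and> y p \<le> pot G C p" and p: "p \<in> pairs G"
  shows "candidate G C y p \<le> pot G C p"
proof (cases p)
  case (BV B u)
  then have h: "u \<in> cut_verts G" "B \<in> blocks G" "u \<in> B" using p by (auto simp: blocks_at_iff)
  let ?K = "B \<inter> cut_verts G - {u}"
  have "y (VB v B) \<le> mx (VB v B) - nt C (VB v B)" if "v \<in> ?K" for v
  proof -
    have "VB v B \<in> pairs G" using that h by (simp add: blocks_at_iff)
    then show ?thesis using y pot_eq by metis
  qed
  then have "(\<Sum>v\<in>?K. y (VB v B)) \<le> (\<Sum>v\<in>?K. mx (VB v B) - nt C (VB v B))" by (rule sum_mono)
  then show ?thesis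
    unfolding pot_eq[OF p] unfolding BV candidate_BV[OF h] mx_BV[OF h] nt_BV[OF h(2,3)]
    by (simp add: sum_subtractf)
next
  case (VB u B)
  then have h: "u \<in> cut_verts G" "B \<in> blocks G" "u \<in> B" using p by (auto simp: blocks_at_iff)
  let ?S = "blocks_at G u - {B}"
  have pb: "BV B' u \<in> pairs G" if "B' \<in> blocks_at G u" for B' using that h by simp
  show ?thesis
  proof (cases "two_stuck y u")
    case True
    then show ?thesis using y[OF p] unfolding VB candidate_VB[OF h] by simp
  next
    case False
    have y': "y (BV B' u) \<le> mx (BV B' u) - nt C (BV B' u)" "0 \<le> y (BV B' u)" if "B' \<in> blocks_at G u" for B'
      using y[OF pb[OF that]] pot_eq[OF pb[OF that]] by auto
    have ge: "(\<Sum>B'\<in>?S. mx (BV B' u) - of_bool (ua G (BV B' u))) + of_bool (ua G (VB u B)) \<le> mx (VB u B)"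
    proof (rule mx_VB_ge[OF h])
      fix B1 B2 assume b: "B1 \<in> blocks_at G u" "B2 \<in> blocks_at G u" "B1 \<noteq> B2" "ua G (BV B1 u)" "ua G (BV B2 u)"
        "mx (BV B1 u) = nt C (BV B1 u)" "mx (BV B2 u) = nt C (BV B2 u)"
      then have "y (BV B1 u) = 0" "y (BV B2 u) = 0" using y'[of B1] y'[of B2] by auto
      then show False using False b unfolding two_stuck_def by blast
    qed
    have "(\<Sum>B'\<in>?S. y (BV B' u) - of_bool (ua G (BV B' u))) \<le>
        (\<Sum>B'\<in>?S. mx (BV B' u) - nt C (BV B' u) - of_bool (ua G (BV B' u)))"
      by (rule sum_mono) (use y' in simp)
    also have "\<dots> = (\<Sum>B'\<in>?S. mx (BV B' u) - of_bool (ua G (BV B' u))) - nt C (VB u B)"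
      unfolding nt_VB[OF h(2,3)] by (simp add: sum_subtractf)
    finally show ?thesis
      using False ge unfolding pot_eq[OF p] unfolding VB candidate_VB[OF h] by simp
  qed
qed

text \<open>A token configuration that violates the bound for the first time along a walk from \<open>C\<close> would
  have to be stuck at two blocks of some cut-vertex; but then nothing has passed through that vertex
  since the start.\<close>

lemma pot_le_fixpoint:
  assumes y0: "\<And>p. p \<in> pairs G \<Longrightarrow> 0 \<le> y p"
    and fp: "\<And>p. p \<in> pairs G \<Longrightarrow> candidate G C y p \<le> y p" and p: "p \<in> pairs G"
  shows "pot G C p \<le> y p"
proof -
  define Y where "Y = (\<lambda>p. y p + nt C p)"
  define good where "good = (\<lambda>D. \<forall>p\<in>pairs G. tot D p \<le> Y p)"
  \<comment> \<open>Only the source of a slide has to be \<open>good\<close>; the bound for the end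
    of a walk can then be proved from those before it.\<close>
  define r where "r = (\<lambda>D E. slide G D E \<and> good D)"
  have bound: "tot D p \<le> Y p" if path: "r\<^sup>*\<^sup>* C D" and p: "p \<in> pairs G" for D p
  proof -
    have iD: "indep_set G D" using path
      by (induction rule: rtranclp_induct) (use indC in \<open>auto simp: r_def slide_def\<close>)
    show ?thesis using p
    proof (induction rule: pair_induct)
      case (BV B u)
      note h = BV.hyps
      let ?K = "B \<inter> cut_verts G - {u}"
      have p: "BV B u \<in> pairs G" using h by (simp add: blocks_at_iff)
      have "(\<Sum>v\<in>?K. tot D (VB v B)) \<le> (\<Sum>v\<in>?K. Y (VB v B))" by (rule sum_mono) (rule BV.IH)
      also have "\<dots> = (\<Sum>v\<in>?K. y (VB v B)) + (\<Sum>v\<in>?K. nt C (VB v B))" by (simp add: Y_def sum.distrib)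
      finally show ?case
        using fp[OF p] unfolding candidate_BV[OF h] tot_BV[OF h] Y_def nt_BV[OF h(2,3)] by simp
    next
      case (VB u B)
      note h = VB.hyps
      let ?S = "blocks_at G u - {B}"
      have p: "VB u B \<in> pairs G" using h by (simp add: blocks_at_iff)
      have pb: "BV B' u \<in> pairs G" if "B' \<in> blocks_at G u" for B' using that h by simp
      show ?case
      proof (cases "two_stuck y u")
        case True
        then obtain B1 B2 where b: "B1 \<in> blocks_at G u" "B2 \<in> blocks_at G u" "B1 \<noteq> B2"
          "y (BV B1 u) = 0" "y (BV B2 u) = 0" "ua G (BV B1 u)" "ua G (BV B2 u)"
          by (auto simp: two_stuck_def)
        \<comment> \<open>The candidate is the old entry here, so \<open>fp\<close> says nothing.
          But the two zero entries bound the totals along the walk by the counts in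
          \<open>C\<close>, which freezes \<open>u\<close>.\<close>
        let ?r = "\<lambda>D E. slide G D E \<and> tot D (BV B1 u) \<le> nt C (BV B1 u) \<and> tot D (BV B2 u) \<le> nt C (BV B2 u)"
        have imp: "?r E F" if "r E F" for E F
        proof -
          have E: "slide G E F" "\<forall>p\<in>pairs G. tot E p \<le> Y p" using that by (simp_all add: r_def good_def)
          show ?thesis using E(1) bspec[OF E(2) pb[OF b(1)]] bspec[OF E(2) pb[OF b(2)]] b(4,5) by (simp add: Y_def)
        qed
        have "?r\<^sup>*\<^sup>* C D"
          by (rule rtranclp_mono[THEN predicate2D, OF predicate2I, OF _ path]) (rule imp)
        then have nt: "nt D q = nt C q" if "base q = u" for q
          by (rule frozen[OF b(1-3) h(1) indC b(6,7) _ refl refl that])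
        obtain B0 where B0: "B0 \<in> ?S" "y (BV B0 u) = 0" "ua G (BV B0 u)" using b by (cases "B1 = B") auto
        have "tot D (BV B0 u) \<le> nt D (BV B0 u)" using VB.IH[OF B0(1)] B0(2) nt[of "BV B0 u"] by (simp add: Y_def)
        then have "stuck D (BV B0 u)" using cp_nonneg[OF pb iD, of B0] B0 by (simp add: stuck_def tot_def)
        then have "tot D (VB u B) = nt C (VB u B)" using tot_VB_stuck[OF h B0(1)] nt[of "VB u B"] by simp
        then show ?thesis using y0[OF p] by (simp add: Y_def)
      next
        case False
        have "tot D (VB u B) \<le> (\<Sum>B'\<in>?S. Y (BV B' u) - of_bool (ua G (BV B' u))) + of_bool (ua G (VB u B))"
        proof (rule tot_VB_le[OF h iD VB.IH])
          fix B1 B2 assume b: "B1 \<in> ?S" "B2 \<in> ?S" "B1 \<noteq> B2" and st: "stuck D (BV B1 u)" "stuck D (BV B2 u)"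
            and t: "tot D (BV B1 u) = Y (BV B1 u)" "tot D (BV B2 u) = Y (BV B2 u)"
          \<comment> \<open>The walk is read backwards from \<open>D\<close>: both blocks are stuck
            and attain \<open>Y\<close> there, so \<open>Y\<close> is the count in \<open>D\<close>
            and bounds the totals at all earlier configurations. Freezing makes the counts in
            \<open>C\<close> the same, so both entries of \<open>y\<close> vanish.\<close>
          let ?b = "\<lambda>E. tot E (BV B1 u) \<le> nt D (BV B1 u) \<and> tot E (BV B2 u) \<le> nt D (BV B2 u)"
          let ?r = "\<lambda>E F. slide G E F \<and> ?b E"
          have nt: "nt D (BV B1 u) = Y (BV B1 u)" "nt D (BV B2 u) = Y (BV B2 u)"
            using st t by (simp_all add: stuck_def tot_def)
          have b': "B1 \<in> blocks_at G u" "B2 \<in> blocks_at G u" using b by blast+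
          have "?b E \<longrightarrow> ?r\<^sup>*\<^sup>* E C" if "r\<^sup>*\<^sup>* C E" for E
            using that
          proof (induction rule: rtranclp_induct)
            case (step E F)
            have "?b E" using step.hyps(2) pb[OF b'(1)] pb[OF b'(2)] nt by (simp add: r_def good_def)
            then have "?r\<^sup>*\<^sup>* E C" using step.IH by blast
            moreover have "slide G F E" using step.hyps(2) slide_sym by (simp add: r_def)
            ultimately show ?case by (auto intro: converse_rtranclp_into_rtranclp)
          qed simp
          moreover have "?b D" using nt t by simp
          ultimately have rev: "?r\<^sup>*\<^sup>* D C" using path by blast
          have ua: "ua G (BV B1 u)" "ua G (BV B2 u)" using st by (simp_all add: stuck_def)
          have "nt C q = nt D q" if "base q = u" for q
            by (rule frozen[OF b' b(3) h(1) iD ua rev refl refl that])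
          then have "y (BV B1 u) = 0" "y (BV B2 u) = 0" using nt by (simp_all add: Y_def)
          then show False using False b' b(3) ua unfolding two_stuck_def by blast
        qed
        also have "\<dots> = (\<Sum>B'\<in>?S. y (BV B' u) - of_bool (ua G (BV B' u))) + of_bool (ua G (VB u B)) + nt C (VB u B)"
          unfolding nt_VB[OF h(2,3)] Y_def by (simp add: sum_subtractf sum.distrib)
        also have "\<dots> \<le> Y (VB u B)" using fp[OF p] False unfolding candidate_VB[OF h] Y_def by simp
        finally show ?thesis .
      qed
    qed
  qed
  have path: "r\<^sup>*\<^sup>* C D" if "reachable G C D" for D
    using that unfolding reachable_def
  proof (induction rule: rtranclp_induct)
    case (step D E)
    have "good D" unfolding good_def using bound[OF step.IH] by blast
    then have "r D E" using step.hyps(2) by (simp add: r_def)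
    with step.IH show ?case by (rule rtranclp.rtrancl_into_rtrancl)
  qed simp
  obtain D where D: "opt D p" using opt_exists[OF p] by blast
  have "mx p \<le> Y p" using bound[OF path[OF opt_reach[OF D]] p] opt_tot[OF D] by simp
  then show ?thesis using pot_eq[OF p] by (simp add: Y_def)
qed

end

section \<open>Running time\<close>

lemma scan_round_spec:
  assumes "scan_round G C ps y = (z, upd, t)"
  shows "t \<le> 1 + (\<Sum>p\<leftarrow>ps. 1 + T_candidate G p)"
    "\<not> upd \<Longrightarrow> z = y \<and> (\<forall>p\<in>set ps. candidate G C y p \<le> y p)"
    "upd \<Longrightarrow> \<exists>p\<in>set ps. y p < candidate G C y p \<and> z = y(p := candidate G C y p)"
proof -
  have "t \<le> 1 + (\<Sum>p\<leftarrow>ps. 1 + T_candidate G p) \<and>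
    (\<not> upd \<longrightarrow> z = y \<and> (\<forall>p\<in>set ps. candidate G C y p \<le> y p)) \<and>
    (upd \<longrightarrow> (\<exists>p\<in>set ps. y p < candidate G C y p \<and> z = y(p := candidate G C y p)))"
    using assms
  proof (induction ps arbitrary: t)
    case (Cons p ps)
    show ?case
    proof (cases "y p < candidate G C y p")
      case True
      then show ?thesis using Cons.prems by (auto simp: Let_def)
    next
      case False
      obtain z' upd' t' where s: "scan_round G C ps y = (z', upd', t')" by (metis prod_cases3)
      have "z' = z" "upd' = upd" "t = 1 + T_candidate G p + t'"
        using Cons.prems False s by (auto simp: Let_def)
      then show ?thesis using Cons.IH[of t'] s False by auto
    qed
  qed auto
  then show "t \<le> 1 + (\<Sum>p\<leftarrow>ps. 1 + T_candidate G p)"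
    "\<not> upd \<Longrightarrow> z = y \<and> (\<forall>p\<in>set ps. candidate G C y p \<le> y p)"
    "upd \<Longrightarrow> \<exists>p\<in>set ps. y p < candidate G C y p \<and> z = y(p := candidate G C y p)"
    by blast+
qed

context conn_block_graph
begin

section \<open>Sizes of branches and the cost of one evaluation\<close>

lemma card_inn_BV:
  assumes h: "u \<in> cut_verts G" "B \<in> blocks G" "u \<in> B"
  shows "card (inn G (BV B u)) = card B - 1 + (\<Sum>v\<in>B \<inter> cut_verts G - {u}. card (inn G (VB v B)))" "2 \<le> card B"
proof -
  \<comment> \<open>Counting all vertices as tokens turns the formulas for \<open>nt\<close> into
    formulas for sizes.\<close>
  have n: "nt (verts G) p = int (card (inn G p))" for p
    using inn_subset[of p] unfolding nt_def by (metis Diff_subset Int_absorb1 subset_trans)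
  have fB: "finite B" using finite_block[OF h(2)] .
  have "B \<inter> verts G - {u} = B - {u}" using block_sub[OF h(2)] by blast
  then have "card (B \<inter> verts G - {u}) = card B - 1" using h(3) fB by simp
  then have "int (card (inn G (BV B u))) =
      int (card B - 1 + (\<Sum>v\<in>B \<inter> cut_verts G - {u}. card (inn G (VB v B))))"
    using nt_BV[OF h(2,3), of "verts G"] by (simp add: n)
  then show "card (inn G (BV B u)) = card B - 1 + (\<Sum>v\<in>B \<inter> cut_verts G - {u}. card (inn G (VB v B)))"
    by linarith
  obtain b where "b \<in> B" "b \<noteq> u" using block_other_cut[of u B] h by (auto simp: blocks_at_iff)
  then have "card {b, u} \<le> card B" using h fB by (intro card_mono) auto
  then show "2 \<le> card B" using \<open>b \<noteq> u\<close> by simp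
qed

lemma card_inn_blocks:
  assumes "Q \<subseteq> blocks_at G u"
  shows "(\<Sum>B'\<in>Q. card (inn G (BV B' u))) = card (\<Union>B'\<in>Q. inn G (BV B' u))"
proof -
  have n: "nt (verts G) p = int (card (inn G p))" for p
    using inn_subset[of p] unfolding nt_def by (metis Diff_subset Int_absorb1 subset_trans)
  have "(\<Union>B'\<in>Q. inn G (BV B' u)) \<subseteq> verts G" using inn_subset by blast
  then have "verts G \<inter> (\<Union>B'\<in>Q. inn G (BV B' u)) = (\<Union>B'\<in>Q. inn G (BV B' u))" by blast
  then have "int (card (\<Union>B'\<in>Q. inn G (BV B' u))) = (\<Sum>B'\<in>Q. nt (verts G) (BV B' u))"
    using nt_blocks[OF assms, of "verts G"] by simp
  then show ?thesis unfolding n by (simp flip: of_nat_sum)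
qed

lemma card_inn_VB:
  assumes h: "B \<in> blocks G" "u \<in> B"
  shows "card (inn G (VB u B)) = (\<Sum>B'\<in>blocks_at G u - {B}. card (inn G (BV B' u)))"
  using card_inn_blocks[of "blocks_at G u - {B}" u] inn_VB_eq[OF h] by simp

lemma card_inn_le: "card (inn G p) \<le> card (verts G)"
  by (rule card_mono[OF finV]) (use inn_subset in blast)

text \<open>The slack 3 of each block pays for the call at its cut-vertex: that call costs
  \<open>2 + card ?S\<close>, at most \<open>3 * card ?S\<close> as \<open>?S\<close> is nonempty. A
  block affords its own cost and the slack, \<open>card B + 4\<close>, from
  \<open>6 * (card B - 1)\<close>, since \<open>card B\<close> is at least 2.\<close>

lemma T_ua_bound:
  "p \<in> pairs G \<Longrightarrow> T_ua G p + (case p of BV _ _ \<Rightarrow> 3 | VB _ _ \<Rightarrow> 0) \<le> 6 * card (inn G p)"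
proof (induction rule: pair_induct)
  case (BV B u)
  note h = BV.hyps
  let ?K = "B \<inter> cut_verts G - {u}"
  have p: "BV B u \<in> pairs G" using h by (simp add: blocks_at_iff)
  have "T_ua G (BV B u) = 1 + card B + (\<Sum>v\<in>?K. T_ua G (VB v B))"
    using T_ua.psimps(1)[OF T_ua_dom[OF p]] \<kappa>_eq[OF h(2,3)] by simp
  also have "(\<Sum>v\<in>?K. T_ua G (VB v B)) \<le> (\<Sum>v\<in>?K. 6 * card (inn G (VB v B)))"
    by (rule sum_mono) (use BV.IH in simp)
  also have "\<dots> = 6 * (\<Sum>v\<in>?K. card (inn G (VB v B)))" by (simp only: sum_distrib_left)
  finally have "T_ua G (BV B u) \<le> 1 + card B + 6 * (\<Sum>v\<in>?K. card (inn G (VB v B)))" by simp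
  then show ?case unfolding card_inn_BV(1)[OF h] using card_inn_BV(2)[OF h] by simp
next
  case (VB u B)
  note h = VB.hyps
  let ?S = "blocks_at G u - {B}"
  have p: "VB u B \<in> pairs G" using h by (simp add: blocks_at_iff)
  have Bu: "B \<in> blocks_at G u" using h by (simp add: blocks_at_iff)
  have "?S \<noteq> {}" using blocks_at_other[OF h(1) Bu] .
  then have S1: "1 \<le> card ?S" using finite_blocks_at by (simp add: Suc_le_eq card_gt_0_iff)
  have cS: "card (blocks_at G u) = Suc (card ?S)" using card.remove[OF finite_blocks_at Bu] .
  have "(\<Sum>B'\<in>?S. T_ua G (BV B' u)) + 3 * card ?S = (\<Sum>B'\<in>?S. T_ua G (BV B' u) + 3)"
    by (simp only: sum.distrib sum_constant mult.commute of_nat_id)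
  also have "\<dots> \<le> (\<Sum>B'\<in>?S. 6 * card (inn G (BV B' u)))"
    by (rule sum_mono) (use VB.IH in simp)
  also have "\<dots> = 6 * card (inn G (VB u B))" unfolding card_inn_VB[OF h(2,3)] by (simp only: sum_distrib_left)
  finally have "(\<Sum>B'\<in>?S. T_ua G (BV B' u)) + 3 * card ?S \<le> 6 * card (inn G (VB u B))" .
  moreover have "T_ua G (VB u B) = 1 + card (blocks_at G u) + (\<Sum>B'\<in>?S. T_ua G (BV B' u))"
    using T_ua.psimps(2)[OF T_ua_dom[OF p]] \<beta>_eq[OF h(1) Bu] by simp
  ultimately show ?case using S1 cS by simp
qed

text \<open>Insides of distinct blocks at \<open>u\<close> are disjoint, so evaluating
  \<open>ua\<close> at all of them is still linear in total: \<open>6 * card (verts G)\<close> for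
  the blocks and as much for \<open>VB u B\<close>.\<close>

lemma T_candidate_bound:
  assumes p: "p \<in> pairs G"
  shows "T_candidate G p \<le> 1 + 12 * card (verts G)"
proof (cases p)
  case (BV B u)
  then have h: "B \<in> blocks G" using p by (auto simp: blocks_at_iff)
  have "card B \<le> card (verts G)" using card_mono[OF finV block_sub[OF h]] .
  then show ?thesis using T_ua_bound[OF p] card_inn_le[of p] by (simp add: BV)
next
  case (VB u B)
  then have u: "u \<in> cut_verts G" using p by simp
  have "1 + T_ua G (BV B' u) \<le> 6 * card (inn G (BV B' u))" if "B' \<in> blocks_at G u" for B'
    using T_ua_bound[of "BV B' u"] that u by simp
  then have "(\<Sum>B'\<in>blocks_at G u. 1 + T_ua G (BV B' u)) \<le> (\<Sum>B'\<in>blocks_at G u. 6 * card (inn G (BV B' u)))"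
    by (rule sum_mono)
  also have "\<dots> = 6 * card (\<Union>B'\<in>blocks_at G u. inn G (BV B' u))"
    using card_inn_blocks[of "blocks_at G u" u] by (simp flip: sum_distrib_left)
  also have "card (\<Union>B'\<in>blocks_at G u. inn G (BV B' u)) \<le> card (verts G)"
    by (rule card_mono[OF finV]) (use inn_subset in blast)
  finally show ?thesis using T_ua_bound[OF p] card_inn_le[of p] by (simp add: VB)
qed

section \<open>Vertices, pairs and the cost of a round in terms of edges\<close>

lemma finite_edges: "finite (edges G)"
proof (rule finite_subset)
  show "edges G \<subseteq> Pow (verts G)" using sG by (auto simp: simple_graph_def)
  show "finite (Pow (verts G))" using finV by simp
qed

lemma sum_card_edges: "(\<Sum>e\<in>edges G. card e) = 2 * card (edges G)"
  using sG by (simp add: simple_graph_def)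

text \<open>In a connected graph every vertex other than a chosen \<open>r\<close> lies on an edge,
  and each edge covers two vertices; the summand 1 is for \<open>r\<close>, which is alone in the
  one-vertex graph.\<close>

lemma card_verts_le: "card (verts G) \<le> 2 * card (edges G) + 1"
proof -
  obtain r where r: "r \<in> verts G" using conG by (auto simp: connected_graph_def)
  have "x \<in> insert r (\<Union>(edges G))" if x: "x \<in> verts G" for x
  proof (cases "x = r")
    case False
    obtain b where "adj G x b" using connected_nbr[OF sG conG x r] False by blast
    then show ?thesis by (auto simp: adj_def)
  qed simp
  then have sub: "verts G \<subseteq> insert r (\<Union>(edges G))" by blast
  have fin: "finite (\<Union>(edges G))"
    by (rule finite_subset[OF _ finV]) (use sG in \<open>auto simp: simple_graph_def\<close>)
  have "finite (insert r (\<Union>(edges G)))" using fin by simp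
  then have "card (verts G) \<le> card (insert r (\<Union>(edges G)))" using sub by (rule card_mono)
  also have "\<dots> \<le> card (\<Union>(edges G)) + 1" using fin by (simp add: card_insert_if)
  also have "card (\<Union>(edges G)) \<le> (\<Sum>e\<in>edges G. card e)" by (rule card_Union_le_sum_card)
  finally show ?thesis using sum_card_edges by simp
qed

text \<open>Distinct blocks at \<open>u\<close> share no edge at \<open>u\<close>, so choosing an
  edge at \<open>u\<close> inside \<open>B\<close> maps \<open>(u,B)\<close> injectively to
  incidences of edges and ends. There are \<open>2 * card (edges G)\<close> of these, and each
  \<open>(u,B)\<close> gives two pairs.\<close>

lemma card_pairs_le: "card (pairs G) \<le> 4 * card (edges G)"
proof -
  let ?P = "SIGMA u:cut_verts G. blocks_at G u"
  define f where "f = (\<lambda>(u :: 'a, B :: 'a set). let b = (SOME b. b \<in> B \<and> b \<noteq> u) in ({u, b}, u))"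
  have f: "\<exists>b. b \<in> B \<and> b \<noteq> u \<and> f (u, B) = ({u, b}, u)" if "u \<in> cut_verts G" "B \<in> blocks_at G u" for u B
  proof -
    have "\<exists>b. b \<in> B \<and> b \<noteq> u" using block_other_cut[OF that] by blast
    from someI_ex[OF this] show ?thesis by (auto simp: f_def Let_def)
  qed
  have "inj_on f ?P"
  proof (rule inj_onI, clarify)
    fix u B v B'
    assume a: "u \<in> cut_verts G" "B \<in> blocks_at G u" "v \<in> cut_verts G" "B' \<in> blocks_at G v" "f (u, B) = f (v, B')"
    obtain b where b: "b \<in> B" "b \<noteq> u" "f (u, B) = ({u, b}, u)" using f[OF a(1,2)] by blast
    obtain c where c: "c \<in> B'" "c \<noteq> v" "f (v, B') = ({v, c}, v)" using f[OF a(3,4)] by blast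
    have "({u, b}, u) = ({v, c}, v)" using a(5) unfolding b(3) c(3) .
    then have uv: "u = v" "{u, b} = {v, c}" by blast+
    then have "b = c" using b(2) c(2) by (auto simp: doubleton_eq_iff)
    then have "B = B'" using block_unique[of B B' u b] a b c uv by (auto simp: blocks_at_iff)
    then show "u = v \<and> B = B'" using uv by simp
  qed
  moreover have "f ` ?P \<subseteq> (SIGMA e:edges G. e)"
  proof (clarify)
    fix e x u B assume a: "(e, x) = f (u, B)" "u \<in> cut_verts G" "B \<in> blocks_at G u"
    obtain b where b: "b \<in> B" "b \<noteq> u" "f (u, B) = ({u, b}, u)" using f[OF a(2,3)] by blast
    then have "adj G u b" using block_clique[of B u b] a(3) by (auto simp: blocks_at_iff)
    then show "e \<in> edges G \<and> x \<in> e" using a(1) b(3) by (simp add: adj_def)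
  qed
  moreover have fe: "finite e" if "e \<in> edges G" for e
    by (rule finite_subset[OF _ finV]) (use that sG in \<open>auto simp: simple_graph_def\<close>)
  then have finS: "finite (SIGMA e:edges G. e)" using finite_edges by blast
  ultimately have "card ?P \<le> card (SIGMA e:edges G. e)" by (intro card_inj_on_le)
  also have "\<dots> = 2 * card (edges G)"
    using card_SigmaI[of "edges G" "\<lambda>e. e"] finite_edges fe sum_card_edges by simp
  finally have cP: "card ?P \<le> 2 * card (edges G)" .
  have finP: "finite ?P" using finV finite_blocks_at
    by (intro finite_SigmaI) (auto simp: cut_verts_def)
  have "pairs G = (\<lambda>(u, B). VB u B) ` ?P \<union> (\<lambda>(u, B). BV B u) ` ?P"
    unfolding pairs_def by (auto simp: image_iff)
  then have "card (pairs G) \<le> card ((\<lambda>(u, B). VB u B) ` ?P) + card ((\<lambda>(u, B). BV B u) ` ?P)"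
    by (simp add: card_Un_le)
  also have "\<dots> \<le> card ?P + card ?P" using card_image_le[OF finP] by (intro add_mono) blast+
  finally show ?thesis using cP by simp
qed

text \<open>With \<open>m\<close> edges, handling one pair costs at most
  \<open>2 + 12 * (2 * m + 1)\<close>, below \<open>26 * (m + 1)\<close>. At most
  \<open>4 * m\<close> pairs give the factor 104, and the remaining unit ends the scan.\<close>

lemma round_time:
  assumes ps: "distinct ps" "set ps = pairs G" and s: "scan_round G C ps y = (z, upd, t)"
  shows "t \<le> 105 * (card (edges G) + 1) ^ 2"
proof -
  let ?m = "card (edges G)"
  have "t \<le> 1 + (\<Sum>p\<leftarrow>ps. 1 + T_candidate G p)" by (rule scan_round_spec(1)[OF s])
  also have "(\<Sum>p\<leftarrow>ps. 1 + T_candidate G p) = (\<Sum>p\<in>pairs G. 1 + T_candidate G p)"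
    using sum_list_distinct_conv_sum_set[OF ps(1)] ps(2) by simp
  also have "\<dots> \<le> (\<Sum>p\<in>pairs G. 26 * (?m + 1))"
  proof (rule sum_mono)
    fix p assume "p \<in> pairs G"
    then have "T_candidate G p \<le> 1 + 12 * card (verts G)" by (rule T_candidate_bound)
    moreover have "12 * card (verts G) \<le> 12 * (2 * ?m + 1)" using card_verts_le by (rule mult_left_mono) simp
    ultimately show "1 + T_candidate G p \<le> 26 * (?m + 1)" by simp
  qed
  also have "\<dots> = card (pairs G) * (26 * (?m + 1))" by simp
  also have "\<dots> \<le> (4 * ?m) * (26 * (?m + 1))" using card_pairs_le by (rule mult_right_mono) simp
  finally have "t \<le> 1 + (4 * ?m) * (26 * (?m + 1))" by simp
  also have "\<dots> \<le> 105 * (?m + 1) ^ 2" by (simp add: power2_eq_square algebra_simps)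
  finally show ?thesis .
qed

end

context conn_block_graph_indep
begin

section \<open>The number of rounds and the total time\<close>

lemma tot_bound:
  "p \<in> pairs G \<Longrightarrow> indep_set G D \<Longrightarrow> tot D p \<le> int (card (inn G p))"
proof (induction rule: pair_induct)
  case (BV B u)
  note h = BV.hyps
  let ?K = "B \<inter> cut_verts G - {u}"
  have "(\<Sum>v\<in>?K. tot D (VB v B)) \<le> (\<Sum>v\<in>?K. int (card (inn G (VB v B))))"
    by (rule sum_mono) (rule BV.IH, assumption, rule BV.prems)
  \<comment> \<open>The summand \<open>ua\<close> of a block is covered by a vertex of
    \<open>B\<close> other than \<open>u\<close>.\<close>
  moreover have "of_bool (ua G (BV B u)) \<le> int (card B - 1)"
    using card_inn_BV(2)[OF h] by (cases "ua G (BV B u)") auto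
  ultimately show ?case unfolding tot_BV[OF h] card_inn_BV(1)[OF h] by simp
next
  case (VB u B)
  note h = VB.hyps
  let ?S = "blocks_at G u - {B}"
  show ?case
  proof (cases "\<exists>B'\<in>?S. stuck D (BV B' u)")
    case True
    then have "tot D (VB u B) = nt D (VB u B)" using tot_VB_stuck[OF h] by blast
    also have "\<dots> \<le> int (card (inn G (VB u B)))"
      unfolding nt_def using card_mono[OF finite_inn, of "D \<inter> inn G (VB u B)" "VB u B"] by simp
    finally show ?thesis .
  next
    case False
    have fS: "finite ?S" using finite_blocks_at by simp
    have "tot D (VB u B) = (\<Sum>B'\<in>?S. tot D (BV B' u) - of_bool (ua G (BV B' u))) + of_bool (ua G (VB u B))"
      by (rule tot_VB_free[OF h]) (use False in blast)
    also have "\<dots> = (\<Sum>B'\<in>?S. tot D (BV B' u)) - (\<Sum>B'\<in>?S. of_bool (ua G (BV B' u))) + of_bool (ua G (VB u B))"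
      by (simp only: sum_subtractf)
    \<comment> \<open>The summand \<open>ua\<close> of \<open>VB u B\<close> comes from some block
      with \<open>ua\<close>, where it has been subtracted.\<close>
    also have "of_bool (ua G (VB u B)) \<le> (\<Sum>B'\<in>?S. of_bool (ua G (BV B' u)) :: int)"
    proof (cases "ua G (VB u B)")
      case True
      then obtain B1 where B1: "B1 \<in> ?S" "ua G (BV B1 u)" using ua_VB[OF h] by blast
      then show ?thesis
        using member_le_sum[of B1 ?S "\<lambda>B'. of_bool (ua G (BV B' u)) :: int"] fS True by simp
    next
      case False
      then show ?thesis by (simp only: of_bool_eq(1)) (rule sum_nonneg, simp)
    qed
    also have "(\<Sum>B'\<in>?S. tot D (BV B' u)) \<le> (\<Sum>B'\<in>?S. int (card (inn G (BV B' u))))"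
      by (rule sum_mono) (rule VB.IH, assumption, rule VB.prems)
    also have "\<dots> = int (card (inn G (VB u B)))" unfolding card_inn_VB[OF h(2,3)] by simp
    finally show ?thesis by simp
  qed
qed

lemma pot_bound:
  assumes p: "p \<in> pairs G"
  shows "pot G C p \<le> int (card (verts G))"
proof -
  obtain D where D: "opt D p" using opt_exists[OF p] by blast
  have "mx p \<le> int (card (inn G p))"
    using tot_bound[OF p reach_indep[OF opt_reach[OF D]]] opt_tot[OF D] by simp
  moreover have "0 \<le> nt C p" by (simp add: nt_def)
  ultimately show ?thesis using pot_eq[OF p] card_inn_le[of p] by linarith
qed

text \<open>The measure is the total gap to the potentials: an update raises one entry by at least 1
  and cannot overshoot. The round number \<open>i\<close> varies in the induction because the
  scanning order may depend on it.\<close>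

lemma run_terminates:
  assumes ord: "ord \<in> scan_orders G"
    and y: "\<And>p. p \<in> pairs G \<Longrightarrow> 0 \<le> y p \<and> y p \<le> pot G C p"
  shows "\<exists>z t. run_rounds G C ord i y z t \<and> (\<forall>p\<in>pairs G. z p = pot G C p) \<and>
    t \<le> (nat (\<Sum>p\<in>pairs G. pot G C p - y p) + 1) * (105 * (card (edges G) + 1) ^ 2)"
  using y
proof (induction "nat (\<Sum>p\<in>pairs G. pot G C p - y p)" arbitrary: y i rule: less_induct)
  case less
  let ?R = "105 * (card (edges G) + 1) ^ 2"
  let ?k = "\<lambda>y. nat (\<Sum>p\<in>pairs G. pot G C p - y p)"
  have o: "distinct (ord i)" "set (ord i) = pairs G" using ord by (auto simp: scan_orders_def)
  obtain z upd t where s: "scan_round G C (ord i) y = (z, upd, t)" by (metis prod_cases3)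
  have t: "t \<le> ?R" by (rule round_time[OF o s])
  show ?case
  proof (cases upd)
    case False
    then have z: "z = y" "\<And>p. p \<in> pairs G \<Longrightarrow> candidate G C y p \<le> y p"
      using scan_round_spec(2)[OF s] o(2) by auto
    have "y p = pot G C p" if "p \<in> pairs G" for p
    proof (rule antisym)
      show "y p \<le> pot G C p" using less.prems[OF that] by simp
      show "pot G C p \<le> y p" by (rule pot_le_fixpoint[OF _ z(2) that]) (use less.prems in blast)
    qed
    moreover have "run_rounds G C ord i y z t" using s False by (intro run_rounds.stop) simp
    moreover have "t \<le> (?k y + 1) * ?R" using t by (simp add: algebra_simps)
    ultimately show ?thesis using z(1) by blast
  next
    case True
    then obtain p where p: "p \<in> pairs G" "y p < candidate G C y p" "z = y(p := candidate G C y p)"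
      using scan_round_spec(3)[OF s] o(2) by auto
    have "candidate G C y p \<le> pot G C p" by (rule candidate_le_pot[OF less.prems p(1)])
    then have z: "0 \<le> z q \<and> z q \<le> pot G C q" if "q \<in> pairs G" for q
      using less.prems[OF that] p by auto
    have "(\<Sum>p\<in>pairs G. pot G C p - z p) < (\<Sum>p\<in>pairs G. pot G C p - y p)"
      by (rule sum_strict_mono_ex1[OF finite_pairs]) (use p in auto)
    moreover have "0 \<le> (\<Sum>p\<in>pairs G. pot G C p - z p)" by (rule sum_nonneg) (use z in simp)
    ultimately have k: "?k z < ?k y" by linarith
    from less.hyps[OF k z, of "Suc i"] obtain w t' where w: "run_rounds G C ord (Suc i) z w t'"
      "\<forall>p\<in>pairs G. w p = pot G C p" "t' \<le> (?k z + 1) * ?R" by blast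
    have "run_rounds G C ord i y w (t + t')"
      by (rule run_rounds.continue[OF _ w(1)]) (use s True in simp)
    moreover have "t + t' \<le> (?k y + 1) * ?R"
    proof -
      have "(?k z + 1) * ?R \<le> ?k y * ?R" using k by (intro mult_right_mono) auto
      then show ?thesis using t w(3) by (simp only: add_mult_distrib mult_1)
    qed
    ultimately show ?thesis using w(2) by blast
  qed
qed

text \<open>With \<open>m\<close> edges, at most \<open>8 * (m + 1) ^ 2\<close> rounds of cost
  \<open>105 * (m + 1) ^ 2\<close> give the factor 840; the remaining 160 absorb the initial cost,
  which is at most \<open>8 * (m + 1)\<close>.\<close>

lemma compute_potentials_correct:
  assumes ord: "ord \<in> scan_orders G"
  shows "\<exists>y t. compute_potentials G C ord y t \<and> t \<le> 1000 * (card (edges G) + 1) ^ 4 \<and>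
    (\<forall>p\<in>pairs G. y p = pot G C p)"
proof -
  let ?m = "card (edges G)"
  let ?R = "105 * (?m + 1) ^ 2"
  obtain y t where y: "run_rounds G C ord 0 (\<lambda>p. 0) y t" "\<forall>p\<in>pairs G. y p = pot G C p"
    and t: "t \<le> (nat (\<Sum>p\<in>pairs G. pot G C p - 0) + 1) * ?R"
    using run_terminates[OF ord, of "\<lambda>p. 0" 0] pot_nonneg by auto
  have "(\<Sum>p\<in>pairs G. pot G C p - 0) \<le> (\<Sum>p\<in>pairs G. int (2 * ?m + 1))"
  proof (rule sum_mono)
    fix p assume "p \<in> pairs G"
    then show "pot G C p - 0 \<le> int (2 * ?m + 1)" using pot_bound[of p] card_verts_le by linarith
  qed
  also have "\<dots> = int (card (pairs G) * (2 * ?m + 1))" by (simp add: algebra_simps)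
  finally have "nat (\<Sum>p\<in>pairs G. pot G C p - 0) \<le> card (pairs G) * (2 * ?m + 1)" by linarith
  also have "\<dots> \<le> (4 * ?m) * (2 * ?m + 1)" using card_pairs_le by (rule mult_right_mono) simp
  \<comment> \<open>There is one more round than updates, as the last one only detects the
    end.\<close>
  also have "\<dots> + 1 \<le> 8 * (?m + 1) ^ 2" by (simp add: power2_eq_square algebra_simps)
  finally have "nat (\<Sum>p\<in>pairs G. pot G C p - 0) + 1 \<le> 8 * (?m + 1) ^ 2" by simp
  then have "t \<le> (8 * (?m + 1) ^ 2) * ?R" using t by (meson le_trans mult_le_mono1)
  also have "\<dots> = 840 * (?m + 1) ^ 4"
  proof -
    have "(8 * x) * (105 * x) = 840 * (x * x)" for x :: nat by simp
    moreover have "(?m + 1) ^ 4 = (?m + 1) ^ 2 * (?m + 1) ^ 2" using power_add[of "?m + 1" 2 2] by simp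
    ultimately show ?thesis by presburger
  qed
  finally have "t \<le> 840 * (?m + 1) ^ 4" .
  moreover have "card (verts G) + ?m + card (pairs G) \<le> 8 * (?m + 1)"
    using card_verts_le card_pairs_le by simp
  moreover have "?m + 1 \<le> (?m + 1) ^ 4" by (rule self_le_power) auto
  moreover have "a + s \<le> 1000 * x" if "s \<le> 840 * x" "a \<le> 8 * k" "k \<le> x" for a s k x :: nat
    using that by linarith
  ultimately have "card (verts G) + ?m + card (pairs G) + t \<le> 1000 * (?m + 1) ^ 4" by blast
  moreover have "compute_potentials G C ord y (card (verts G) + ?m + card (pairs G) + t)"
    unfolding compute_potentials_def using y(1) by blast
  ultimately show ?thesis using y(2) by blast
qed

end

theorem theorem5p14:
  shows "\<exists>T :: nat \<Rightarrow> nat.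
    (\<lambda>m. real (T m)) \<in> O(\<lambda>m. real m ^ 4) \<and>
    (\<forall>(G :: 'a sgraph) C ord.
       connected_graph G \<and> block_graph G \<and> indep_set G C \<and> ord \<in> scan_orders G \<longrightarrow>
       (\<exists>y t. compute_potentials G C ord y t \<and> t \<le> T (card (edges G)) \<and>
          (\<forall>p\<in>pairs G. y p = pot G C p)))"
proof (intro exI[of _ "\<lambda>m. 1000 * (m + 1) ^ 4"] conjI allI impI)
  \<comment> \<open>From \<open>m \<ge> 1\<close> on, \<open>m + 1 \<le> 2 * m\<close>, so the
    factor is \<open>2 ^ 4 * 1000\<close>.\<close>
  have "eventually (\<lambda>m::nat. norm (real (1000 * (m + 1) ^ 4)) \<le> 16000 * norm (real m ^ 4)) at_top"
    using eventually_ge_at_top[of 1]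
  proof eventually_elim
    case (elim m)
    then have "(real m + 1) ^ 4 \<le> (2 * real m) ^ 4" by (intro power_mono) auto
    also have "\<dots> = 16 * real m ^ 4" by (simp add: power_mult_distrib)
    finally show ?case by (simp add: add.commute)
  qed
  then show "(\<lambda>m. real (1000 * (m + 1) ^ 4)) \<in> O(\<lambda>m. real m ^ 4)" by (rule bigoI)
next
  fix G :: "'a sgraph" and C ord
  assume a: "connected_graph G \<and> block_graph G \<and> indep_set G C \<and> ord \<in> scan_orders G"
  then interpret conn_block_graph_indep G C by unfold_locales auto
  show "\<exists>y t. compute_potentials G C ord y t \<and> t \<le> 1000 * (card (edges G) + 1) ^ 4 \<and>
          (\<forall>p\<in>pairs G. y p = pot G C p)"
    using compute_potentials_correct a by blast
qed

end
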